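(* Let $\lambda>0$, $\mu>0$, $\epsilon>0$, $0<p\le 1$ and let $n\ge 0$ be an integer. Consider the $M/GI/1/n$ queueing system with Poisson arrival rate $\lambda$ and service time distribution function $B(x)$, $B(0)=0$, and let $L_n$ be the number of losses during a busy period. Assume that: (1) $B(x)=pF(x)+(1-p)(1-\mathrm{e}^{-\mu x})$ for $x\ge 0$, where $F(x)=\Pr\{\zeta\le x\}$ is the distribution function of a nonnegative random variable $\zeta$ with expectation $1/\mu$, and $$\sup_{x,y\ge 0}|F_y(x)-F(x)|<\epsilon,\qquad F_y(x)=\Pr\{\zeta\le x+y\mid \zeta>y\};$$ (2) there is a member $F_{y^0}$ of the family $\{F_y\}_{y\ge 0}$ such that $F_{y^0}\le_{\mathscr{C}_\lambda}F_y$ for all $y\ge 0$. Put $\widehat F(\lambda)=\int_0^\infty \mathrm{e}^{-\lambda x}\,\mathrm{d}F(x)$ and $\widehat B(\lambda)=p\widehat F(\lambda)+(1-p)\frac{\mu}{\mu+\lambda}$. Then there is a Galton--Watson branching process with $Z_0=1$ whose offspring probability generating function $g$ satisfies $$g(z)<\frac{\widehat B(\lambda)}{1-z+z\widehat B(\lambda)}+5\epsilon\cdot\frac{1-z+2z\widehat B(\lambda)}{1-z+z\widehat B(\lambda)}\qquad\text{for all real } z \text{ with } |z|\le 1,$$ such that the following holds. Let $Z_n$ be the number of offspring in the $n$th generation of this process. Let $G$ be any probability distribution function of a nonnegative random variable with $G\le_{\mathscr{C}_\lambda}F_{y^0}$ and $G\le_{\mathscr{C}_\lambda}E_\mu$,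 where $E_\mu(x)=1-\mathrm{e}^{-\mu x}$. Let $\varsigma_1,\varsigma_2,\ldots$ be independent identically distributed nonnegative integer-valued random variables, independent of the branching process, with $$\Pr\{\varsigma_i=m\}=\int_0^\infty \mathrm{e}^{-\lambda x}\frac{(\lambda x)^m}{m!}\,\mathrm{d}G(x),\qquad m=0,1,2,\ldots$$ Then $$L_n\ge_{st}\sum_{i=1}^{Z_n}\varsigma_i .$$
   Context: $M/GI/1/n$ queue: customers arrive according to a Poisson process of rate $\lambda$ at a single server; service times are i.i.d. with distribution function $B$, independent of arrivals; $n$ is the buffer size excluding the customer in service, so an arriving customer who finds $n+1$ customers in the system is lost. A busy period starts when a customer arrives at an empty system and ends at the first subsequent instant at which the system becomes empty; $L_n$ is the number of customers lost during one busy period. Stochastic order: $X\ge_{st}Y$ means $\Pr\{X>t\}\ge\Pr\{Y>t\}$ for all real $t$. Order relation $\mathscr{C}_\lambda$ (for fixed $\lambda>0$): for distribution functions $\Xi_1,\Xi_2$ of nonnegative random variables, $\Xi_1\le_{\mathscr{C}_\lambda}\Xi_2$ means that for all $i=0,1,2,\ldots$ $$\int_0^\infty \mathrm{e}^{-\lambda x}x^i\,\Xi_1(x)\,\mathrm{d}x\ \ge\ \int_0^\infty \mathrm{e}^{-\lambda x}x^i\,\Xi_2(x)\,\mathrm{d}x .$$ The conditional distribution $F_y$ is considered for those $y\ge 0$ with $\Pr\{\zeta>y\}>0$. An empty sum equals $0$. *)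

theory Defs
  imports "HOL-Probability.Probability"
begin

section \<open>Sample paths of the single-server queue with a finite buffer\<close>

text \<open>
  Customer \<open>0\<close> arrives at an empty system; customer \<open>k\<close> arrives at time \<open>a k\<close>.  The service times
  \<open>s 0, s 1, \<dots>\<close> are numbered in the order in which customers are admitted; as the discipline is
  first-come-first-served, this is also the order in which services begin.  Lost customers receive
  no service and consume no service time.  The list \<open>departures n a s k\<close> holds the departure times
  of those among the customers \<open>0, \<dots>, k - 1\<close> who were admitted, in the order of admission.
\<close>

definition remaining :: "real list \<Rightarrow> real \<Rightarrow> nat" where
  "remaining ds t = length (filter (\<lambda>d. t < d) ds)"

primrec departures :: "nat \<Rightarrow> (nat \<Rightarrow> real) \<Rightarrow> (nat \<Rightarrow> real) \<Rightarrow> nat \<Rightarrow> real list" where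
  "departures n a s 0 = []"
| "departures n a s (Suc k) =
     (let ds = departures n a s k in
      if remaining ds (a k) < n + 1
      then ds @ [Max (insert (a k) (set ds)) + s (length ds)]
      else ds)"

definition lost :: "nat \<Rightarrow> (nat \<Rightarrow> real) \<Rightarrow> (nat \<Rightarrow> real) \<Rightarrow> nat \<Rightarrow> bool" where
  "lost n a s k \<longleftrightarrow> n + 1 \<le> remaining (departures n a s k) (a k)"

text \<open>
  The set of customers who arrive up to time \<open>t\<close> is an initial segment \<open>{0, \<dots>, m - 1}\<close> of the
  natural numbers whenever \<open>a\<close> is nondecreasing and unbounded.
\<close>

definition number_in_system :: "nat \<Rightarrow> (nat \<Rightarrow> real) \<Rightarrow> (nat \<Rightarrow> real) \<Rightarrow> real \<Rightarrow> nat" where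
  "number_in_system n a s t = remaining (departures n a s (card {k. a k \<le> t})) t"

definition busy_period_end :: "nat \<Rightarrow> (nat \<Rightarrow> real) \<Rightarrow> (nat \<Rightarrow> real) \<Rightarrow> ereal" where
  "busy_period_end n a s = Inf {ereal t | t. a 0 < t \<and> number_in_system n a s t = 0}"

text \<open>
  The set below is infinite only on a null event (the busy period is almost surely finite), where
  the value of the cardinality, by convention \<open>0\<close>, is irrelevant.
\<close>

definition losses :: "nat \<Rightarrow> (nat \<Rightarrow> real) \<Rightarrow> (nat \<Rightarrow> real) \<Rightarrow> nat" where
  "losses n a s = card {k. lost n a s k \<and> ereal (a k) < busy_period_end n a s}"

section \<open>Stochastic input of the M/GI/1/n queue\<close>

text \<open>
  The arrivals after the one at time \<open>0\<close> form a Poisson process of rate \<open>lam\<close>: the interarrival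
  times \<open>T 0, T 1, \<dots>\<close> are independent and exponential.  Independence of the whole family
  \<open>case_sum T S\<close> says that the \<open>T i\<close> are independent, the \<open>S i\<close> are independent, and the two
  sequences are independent of each other.
\<close>

definition MGI1_input ::
  "real \<Rightarrow> real measure \<Rightarrow> 'a measure \<Rightarrow> (nat \<Rightarrow> 'a \<Rightarrow> real) \<Rightarrow> (nat \<Rightarrow> 'a \<Rightarrow> real) \<Rightarrow> bool" where
  "MGI1_input lam B M T S \<longleftrightarrow>
     prob_space M \<and>
     prob_space.indep_vars M (\<lambda>_. borel) (case_sum T S) UNIV \<and>
     (\<forall>i. distributed M lborel (T i) (exponential_density lam)) \<and>
     (\<forall>i. distr M borel (S i) = B)"

definition arrival_times :: "(nat \<Rightarrow> 'a \<Rightarrow> real) \<Rightarrow> 'a \<Rightarrow> nat \<Rightarrow> real" where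
  "arrival_times T \<omega> k = (\<Sum>i<k. T i \<omega>)"

definition busy_period_losses ::
  "nat \<Rightarrow> (nat \<Rightarrow> 'a \<Rightarrow> real) \<Rightarrow> (nat \<Rightarrow> 'a \<Rightarrow> real) \<Rightarrow> 'a \<Rightarrow> nat" where
  "busy_period_losses n T S \<omega> = losses n (arrival_times T \<omega>) (\<lambda>i. S i \<omega>)"

section \<open>Distribution functions and order relations\<close>

definition nonneg_law :: "real measure \<Rightarrow> bool" where
  "nonneg_law F \<longleftrightarrow> real_distribution F \<and> (AE x in F. 0 \<le> x)"

definition residual_cdf :: "real measure \<Rightarrow> real \<Rightarrow> real \<Rightarrow> real" where
  "residual_cdf F y x = \<P>(z in F. z \<le> x + y \<bar> y < z)"

definition LST :: "real measure \<Rightarrow> real \<Rightarrow> real" where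
  "LST F lam = (\<integral>x. exp (- lam * x) \<partial>F)"

definition C_le :: "real \<Rightarrow> (real \<Rightarrow> real) \<Rightarrow> (real \<Rightarrow> real) \<Rightarrow> bool" where
  "C_le lam \<Xi>1 \<Xi>2 \<longleftrightarrow>
     (\<forall>i::nat. (LBINT x:{0..}. exp (- lam * x) * x ^ i * \<Xi>1 x)
             \<ge> (LBINT x:{0..}. exp (- lam * x) * x ^ i * \<Xi>2 x))"

definition st_ge :: "'a measure \<Rightarrow> ('a \<Rightarrow> real) \<Rightarrow> 'b measure \<Rightarrow> ('b \<Rightarrow> real) \<Rightarrow> bool" where
  "st_ge M X N Y \<longleftrightarrow> (\<forall>t. \<P>(\<omega> in M. X \<omega> > t) \<ge> \<P>(\<omega> in N. Y \<omega> > t))"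

section \<open>Galton--Watson processes\<close>

definition pgf :: "nat pmf \<Rightarrow> real \<Rightarrow> real" where
  "pgf q z = (\<Sum>k. pmf q k * z ^ k)"

definition galton_watson :: "nat pmf \<Rightarrow> 'b measure \<Rightarrow> (nat \<Rightarrow> 'b \<Rightarrow> nat) \<Rightarrow> bool" where
  "galton_watson q N Z \<longleftrightarrow>
     prob_space N \<and>
     (\<exists>\<xi> :: nat \<Rightarrow> nat \<Rightarrow> 'b \<Rightarrow> nat.
        prob_space.indep_vars N (\<lambda>_. count_space UNIV) (\<lambda>(k, i). \<xi> k i) UNIV \<and>
        (\<forall>k i. distr N (count_space UNIV) (\<xi> k i) = measure_pmf q) \<and>
        (\<forall>\<omega>\<in>space N. Z 0 \<omega> = 1 \<and> (\<forall>k. Z (Suc k) \<omega> = (\<Sum>i<Z k \<omega>. \<xi> k i \<omega>))))"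

text \<open>Independence of two sequences of \<open>nat\<close>-valued random variables, as random elements of the
  product space.\<close>

definition indep_sequences ::
  "'b measure \<Rightarrow> (nat \<Rightarrow> 'b \<Rightarrow> nat) \<Rightarrow> (nat \<Rightarrow> 'b \<Rightarrow> nat) \<Rightarrow> bool" where
  "indep_sequences N X Y \<longleftrightarrow>
     prob_space.indep_var N
       (Pi\<^sub>M UNIV (\<lambda>_. count_space UNIV)) (\<lambda>\<omega> i. X i \<omega>)
       (Pi\<^sub>M UNIV (\<lambda>_. count_space UNIV)) (\<lambda>\<omega> i. Y i \<omega>)"

end

theory Submission
  imports Defs
begin

text \<open>
  Why the losses dominate a branching process.  A busy period influences its losses only through
  the numbers \<open>\<nu>\<^sub>0, \<nu>\<^sub>1, \<dots>\<close> of customers who arrive during the successive services: if \<open>x\<close> customers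
  are present when a service starts and \<open>m\<close> arrive during it, then \<open>x + m - (n + 1)\<close> of them (truncated
  at \<open>0\<close>) are lost and \<open>min (x + m) (n + 1) - 1\<close> customers are left behind.  Because arrivals are Poisson and
  independent of the services, the \<open>\<nu>\<^sub>i\<close> are independent with the mixed Poisson law \<open>\<pi>\<close> of parameter
  \<open>lam\<close> and mixing law \<open>B\<close> (lemmas \<open>losses_of_realized_path\<close> and \<open>nn_integral_service\<close>).

  Read this process one arrival at a time.  If the current service has seen \<open>j\<close> arrivals, it ends
  without another one with probability \<open>h j = \<P>(\<nu> = j | \<nu> \<ge> j)\<close>, the hazard of \<open>\<pi>\<close>.
  Otherwise an arrival takes one place of the room \<open>r + 1\<close> that is left, and until this place is free
  again the same system runs with room \<open>r\<close>; the place becomes free at the end of a service, so that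
  from then on \<open>j = 0\<close>.  The losses \<open>V (r + 1) j\<close> before the initial level is left are therefore
  \<open>0\<close> with probability \<open>h j\<close>, and otherwise \<open>V r (j + 1)\<close> plus a geometric number, with parameter
  \<open>h 0 = Bhat\<close>, of independent copies of \<open>V r 1\<close>.  Suppose all hazards are at most \<open>\<beta>\<close>.  Replacing
  \<open>h j\<close> by \<open>\<beta>\<close> in this recursion makes the losses smaller and gives a Galton--Watson process
  whose offspring number is \<open>0\<close> with probability \<open>\<beta>\<close> and otherwise one plus a geometric variable
  of parameter \<open>Bhat\<close>.  With no room left, all further arrivals of the current service are lost; their
  number dominates \<open>\<sigma>\<close>.  Induction on the room yields the stochastic inequality
  (\<open>branching_st_le_overflow\<close>).

  The hazards are bounded by conditioning on the epoch \<open>y\<close> of the \<open>j\<close>-th arrival: the remaining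
  service then has a law that mixes the residual law \<open>F_y\<close> with the exponential law.  The
  probability of at most \<open>i\<close> Poisson arrivals in a time with distribution function \<open>\<Xi>\<close> equals
  \<open>\<integral> lam exp (- lam x) (lam x)\<^sup>i / i! \<Xi>(x) dx\<close>, so that the order \<open>C_le\<close> is just the stochastic order
  of Poisson counts.  Hence \<open>\<beta> = \<integral> lam exp (- lam x) F_y0(x) dx\<close> is admissible
  (\<open>mixture_window_le\<close>).

  The offspring generating function is \<open>(\<beta> (1 - z) + z Bhat) / (1 - z + z Bhat)\<close>, and the asserted
  bound, for negative \<open>z\<close> too, reduces to \<open>\<beta> - Bhat < 5 eps (1 - Bhat)\<close>.  With
  \<open>R y = \<integral> exp (- lam x) (1 - F_y(x)) dx\<close> and \<open>r = R y0\<close>, the minimum of \<open>R\<close>, this says that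
  \<open>r\<close> exceeds \<open>1 - 5 eps\<close> times a convex combination of \<open>R 0\<close> and \<open>1 / (lam + mu)\<close>.  To see this,
  cut the residual life at \<open>h = 3 / (2 mu)\<close>: up to \<open>h\<close> the tail of \<open>F_y0\<close> differs from that of \<open>F\<close> by
  less than \<open>eps\<close>, and what survives \<open>h\<close> contributes at least \<open>r\<close> again.  The tail of \<open>F\<close> in turn is
  compared with its equilibrium tail \<open>mu \<integral> (1 - F(u)) du\<close>, \<open>u \<ge> x\<close>, which is an average of residual tails (here
  the mean \<open>1 / mu\<close> enters), differs from the tail by less than \<open>eps\<close> too, and satisfies a linear
  differential equation with this error as right-hand side.  What is left is a numerical
  inequality, whose constant is about \<open>4.5\<close> for small \<open>lam / mu\<close>; see \<open>minimiser_exceeds_fraction\<close>.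
\<close>

section \<open>Stochastic order and random sums of integer-valued laws\<close>

definition st_le :: "nat pmf \<Rightarrow> nat pmf \<Rightarrow> bool" where
  "st_le p q \<longleftrightarrow> (\<forall>k. emeasure (measure_pmf p) {k..} \<le> emeasure (measure_pmf q) {k..})"

text \<open>
  An increasing function is a nonnegative combination of indicators of the up-sets that define
  \<open>st_le\<close>; integrals of increasing functions are therefore monotone in the law.
\<close>

lemma mono_nat_eq_suminf_increments:
  fixes f :: "nat \<Rightarrow> ennreal"
  assumes "mono f"
  shows "f k = f 0 + (\<Sum>i. (f (Suc i) - f i) * indicator {Suc i..} k)"
proof -
  have "f k = f 0 + (\<Sum>i<k. f (Suc i) - f i)"
  proof (induction k)
    case (Suc k)
    have "f k + (f (Suc k) - f k) = f (Suc k)"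
      using assms by (intro add_diff_inverse_ennreal) (auto simp: mono_def)
    then show ?case using Suc by (metis add.assoc sum.lessThan_Suc)
  qed simp
  also have "(\<Sum>i<k. f (Suc i) - f i) = (\<Sum>i<k. (f (Suc i) - f i) * indicator {Suc i..} k)"
    by (intro sum.cong) auto
  also have "\<dots> = (\<Sum>i. (f (Suc i) - f i) * indicator {Suc i..} k)"
    by (intro suminf_finite[symmetric]) auto
  finally show ?thesis .
qed

lemma st_le_nn_integral_mono:
  fixes f :: "nat \<Rightarrow> ennreal"
  assumes "st_le p q" "mono f"
  shows "(\<integral>\<^sup>+x. f x \<partial>measure_pmf p) \<le> (\<integral>\<^sup>+x. f x \<partial>measure_pmf q)"
proof -
  have *: "(\<integral>\<^sup>+x. f x \<partial>measure_pmf r) = f 0 + (\<Sum>i. (f (Suc i) - f i) * emeasure (measure_pmf r) {Suc i..})" for r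
    by (subst mono_nat_eq_suminf_increments[OF assms(2)])
       (simp add: nn_integral_add nn_integral_suminf nn_integral_cmult)
  show ?thesis unfolding *
    using assms(1) by (intro add_left_mono suminf_le mult_left_mono) (auto simp: st_le_def)
qed

lemma st_le_refl [simp]: "st_le p p"
  by (simp add: st_le_def)

text \<open>
  Coupling-free form of the usual closure under mixtures: first compare the kernels, then
  integrate the increasing function \<open>x \<mapsto> \<P>(g x \<ge> k)\<close> against the two mixing laws.
\<close>

lemma st_le_bind:
  assumes "st_le p q" "\<And>x. st_le (f x) (g x)" "\<And>x y. x \<le> y \<Longrightarrow> st_le (g x) (g y)"
  shows "st_le (bind_pmf p f) (bind_pmf q g)"
  unfolding st_le_def
proof
  fix k
  have "emeasure (bind_pmf p f) {k..} \<le> (\<integral>\<^sup>+x. emeasure (g x) {k..} \<partial>measure_pmf p)"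
    using assms(2) by (auto intro!: nn_integral_mono simp: st_le_def)
  also have "\<dots> \<le> (\<integral>\<^sup>+x. emeasure (g x) {k..} \<partial>measure_pmf q)"
    using assms(3) by (intro st_le_nn_integral_mono[OF assms(1)]) (auto simp: st_le_def mono_def)
  finally show "emeasure (bind_pmf p f) {k..} \<le> emeasure (bind_pmf q g) {k..}" by simp
qed

definition conv_pmf :: "nat pmf \<Rightarrow> nat pmf \<Rightarrow> nat pmf" where
  "conv_pmf p q = bind_pmf p (\<lambda>a. map_pmf ((+) a) q)"

lemma conv_pmf_assoc: "conv_pmf (conv_pmf p q) r = conv_pmf p (conv_pmf q r)"
proof -
  have "(+) (a + b) = (\<lambda>x. a + (b + x))" for a b :: nat by auto
  then show ?thesis
    by (simp add: conv_pmf_def bind_assoc_pmf map_bind_pmf bind_map_pmf map_pmf_comp)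
qed

lemma conv_pmf_commute: "conv_pmf p q = conv_pmf q p"
  by (simp add: conv_pmf_def map_pmf_def bind_commute_pmf[of p q] add.commute)

lemma conv_pmf_return_0 [simp]: "conv_pmf (return_pmf 0) q = q" "conv_pmf q (return_pmf 0) = q"
proof -
  have "(+) (0::nat) = (\<lambda>x. x)" by auto
  then show "conv_pmf (return_pmf 0) q = q" by (simp add: conv_pmf_def bind_return_pmf)
  then show "conv_pmf q (return_pmf 0) = q" by (simp add: conv_pmf_commute)
qed

lemma conv_pmf_bind: "conv_pmf (bind_pmf p f) q = bind_pmf p (\<lambda>x. conv_pmf (f x) q)"
  by (simp add: conv_pmf_def bind_assoc_pmf)

lemma st_le_map_add: "st_le p q \<Longrightarrow> a \<le> b \<Longrightarrow> st_le (map_pmf ((+) a) p) (map_pmf ((+) b) q)"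
  unfolding map_pmf_def
proof (rule st_le_bind)
  show "st_le (return_pmf (a + x)) (return_pmf (b + x))" if "a \<le> b" for x
    using that by (auto simp: st_le_def indicator_def)
qed (auto simp: st_le_def indicator_def)

lemma st_le_conv: "st_le p p' \<Longrightarrow> st_le q q' \<Longrightarrow> st_le (conv_pmf p q) (conv_pmf p' q')"
  unfolding conv_pmf_def by (intro st_le_bind st_le_map_add) auto

lemma st_le_return_0 [simp]: "st_le (return_pmf 0) p"
proof -
  have "emeasure (return_pmf 0) {k..} \<le> emeasure (measure_pmf p) {k..}" for k :: nat
    by (cases k) (auto simp: atLeast_0)
  then show ?thesis by (auto simp: st_le_def)
qed

primrec iid_sum :: "nat pmf \<Rightarrow> nat \<Rightarrow> nat pmf" where
  "iid_sum s 0 = return_pmf 0"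
| "iid_sum s (Suc k) = conv_pmf s (iid_sum s k)"

lemma iid_sum_add: "iid_sum s (a + b) = conv_pmf (iid_sum s a) (iid_sum s b)"
  by (induction a) (auto simp: conv_pmf_assoc)

lemma st_le_iid_sum: "st_le s s' \<Longrightarrow> st_le (iid_sum s k) (iid_sum s' k)"
  by (induction k) (auto intro: st_le_conv)

lemma st_le_iid_sum_mono: "k \<le> l \<Longrightarrow> st_le (iid_sum s k) (iid_sum s l)"
  using st_le_conv[of "return_pmf 0" "iid_sum s (l - k)" "iid_sum s k" "iid_sum s k"]
  by (simp flip: iid_sum_add)

definition compound_pmf :: "nat pmf \<Rightarrow> nat pmf \<Rightarrow> nat pmf" where
  "compound_pmf q s = bind_pmf q (iid_sum s)"

lemma st_le_compound: "st_le s s' \<Longrightarrow> st_le (compound_pmf q s) (compound_pmf q s')"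
  unfolding compound_pmf_def by (intro st_le_bind st_le_iid_sum st_le_iid_sum_mono) auto

lemma compound_map_Suc: "compound_pmf (map_pmf Suc q) s = conv_pmf s (compound_pmf q s)"
  by (simp add: compound_pmf_def bind_map_pmf conv_pmf_commute[of s] conv_pmf_bind)

text \<open>
  A sum of \<open>k\<close> offspring numbers, each offspring contributing an independent copy of \<open>s\<close>, can be
  grouped by parent.  This turns the last-generation decomposition of a Galton--Watson process
  into the first-generation one.
\<close>

lemma bind_iid_sum_compound: "bind_pmf (iid_sum q k) (iid_sum s) = iid_sum (compound_pmf q s) k"
proof (induction k)
  case (Suc k)
  have "bind_pmf (iid_sum q (Suc k)) (iid_sum s)
      = bind_pmf q (\<lambda>a. bind_pmf (iid_sum q k) (\<lambda>b. conv_pmf (iid_sum s b) (iid_sum s a)))"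
    by (simp add: conv_pmf_def[of q] bind_assoc_pmf bind_map_pmf iid_sum_add conv_pmf_commute)
  also have "\<dots> = bind_pmf q (\<lambda>a. conv_pmf (iid_sum s a) (bind_pmf (iid_sum q k) (iid_sum s)))"
    by (simp add: conv_pmf_bind conv_pmf_commute[of "iid_sum s _" "bind_pmf _ _"])
  finally show ?case
    by (simp add: Suc compound_pmf_def conv_pmf_bind)
qed (simp add: bind_return_pmf)

text \<open>
  The offspring law.  In the exponential case \<open>\<beta> = b\<close> it is the geometric law; in general only the
  first trial, made in the service that is under way when a customer arrives, has the success
  probability \<open>\<beta>\<close>, while later trials start with a fresh service.
\<close>

definition delayed_geometric :: "real \<Rightarrow> real \<Rightarrow> nat pmf" where
  "delayed_geometric \<beta> b = bind_pmf (bernoulli_pmf \<beta>)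
     (\<lambda>c. if c then return_pmf 0 else map_pmf Suc (geometric_pmf b))"

lemma compound_delayed_geometric:
  "compound_pmf (delayed_geometric \<beta> b) s = bind_pmf (bernoulli_pmf \<beta>)
     (\<lambda>c. if c then return_pmf 0 else conv_pmf s (compound_pmf (geometric_pmf b) s))"
  unfolding compound_pmf_def delayed_geometric_def bind_assoc_pmf
  by (intro bind_pmf_cong refl)
     (auto simp: bind_return_pmf compound_map_Suc[unfolded compound_pmf_def])

lemma delayed_geometric_same: "0 < b \<Longrightarrow> b \<le> 1 \<Longrightarrow> delayed_geometric b b = geometric_pmf b"
  unfolding delayed_geometric_def by (subst (2) geometric_bind_pmf_unfold) auto

lemma st_le_bernoulli_bind:
  assumes "st_le p q" "0 \<le> h" "h \<le> \<beta>" "\<beta> \<le> 1"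
  shows "st_le (bind_pmf (bernoulli_pmf \<beta>) (\<lambda>c. if c then return_pmf 0 else p))
               (bind_pmf (bernoulli_pmf h) (\<lambda>c. if c then return_pmf 0 else q))"
  unfolding st_le_def
proof
  fix k :: nat
  show "emeasure (bind_pmf (bernoulli_pmf \<beta>) (\<lambda>c. if c then return_pmf 0 else p)) {k..}
    \<le> emeasure (bind_pmf (bernoulli_pmf h) (\<lambda>c. if c then return_pmf 0 else q)) {k..}"
  proof (cases "k = 0")
    case True
    then show ?thesis by (simp only: atLeast_0 emeasure_pmf_UNIV)
  next
    case False
    have "ennreal (1 - \<beta>) * emeasure p {k..} \<le> ennreal (1 - h) * emeasure q {k..}"
      using assms by (intro mult_mono ennreal_leI) (auto simp: st_le_def)
    with False assms show ?thesis by (simp add: mult.commute)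
  qed
qed

section \<open>Overflow of a finite buffer, one arrival at a time\<close>

definition remaining_arrivals :: "nat pmf \<Rightarrow> nat \<Rightarrow> nat pmf" where
  "remaining_arrivals \<pi> j = map_pmf (\<lambda>m. m - j) (cond_pmf \<pi> {j..})"

definition hazard :: "nat pmf \<Rightarrow> nat \<Rightarrow> real" where
  "hazard \<pi> j = pmf \<pi> j / measure (measure_pmf \<pi>) {j..}"

context
  fixes \<pi> :: "nat pmf"
  assumes full_support: "set_pmf \<pi> = UNIV"
begin

lemma tail_pos: "measure (measure_pmf \<pi>) {j..} > 0"
  using full_support by (intro measure_pmf_posI[of j]) auto

lemma tail_Suc: "measure (measure_pmf \<pi>) {j..} = pmf \<pi> j + measure (measure_pmf \<pi>) {Suc j..}"
proof -
  have "measure (measure_pmf \<pi>) {j..} = measure (measure_pmf \<pi>) ({j} \<union> {Suc j..})"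
    by (rule arg_cong[where f="measure (measure_pmf \<pi>)"]) auto
  also have "\<dots> = measure (measure_pmf \<pi>) {j} + measure (measure_pmf \<pi>) {Suc j..}"
    by (rule measure_pmf.finite_measure_Union) auto
  finally show ?thesis by (simp add: measure_pmf_single)
qed

lemma hazard_bounds: "0 \<le> hazard \<pi> j" "hazard \<pi> j \<le> 1" "hazard \<pi> j < 1"
  using tail_pos[of j] tail_pos[of "Suc j"] tail_Suc[of j] by (auto simp: hazard_def divide_simps)

lemma pmf_remaining_arrivals:
  "pmf (remaining_arrivals \<pi> j) i = pmf \<pi> (j + i) / measure (measure_pmf \<pi>) {j..}"
proof -
  have ne: "set_pmf \<pi> \<inter> {j..} \<noteq> {}" using full_support by auto
  have "pmf (remaining_arrivals \<pi> j) i = measure (cond_pmf \<pi> {j..}) {m. m - j = i}"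
    by (simp add: remaining_arrivals_def pmf_map vimage_def)
  also have "\<dots> = measure (cond_pmf \<pi> {j..}) {j + i}"
    using ne by (intro measure_pmf.finite_measure_eq_AE) (auto simp: AE_measure_pmf_iff)
  finally show ?thesis using ne by (simp add: measure_pmf_single pmf_cond)
qed

lemma remaining_arrivals_0: "remaining_arrivals \<pi> 0 = \<pi>"
  by (intro pmf_eqI) (simp add: pmf_remaining_arrivals atLeast_0)

text \<open>
  The decomposition of a service at its next arrival; the recursion of \<open>overflow\<close> follows it.
\<close>

lemma remaining_arrivals_unfold:
  "remaining_arrivals \<pi> j = bind_pmf (bernoulli_pmf (hazard \<pi> j))
     (\<lambda>c. if c then return_pmf 0 else map_pmf Suc (remaining_arrivals \<pi> (Suc j)))" (is "_ = ?R")
proof (intro pmf_eqI)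
  fix i
  have "pmf ?R i = hazard \<pi> j * indicator {i} 0
      + (1 - hazard \<pi> j) * pmf (map_pmf Suc (remaining_arrivals \<pi> (Suc j))) i"
    using hazard_bounds[of j] by (subst pmf_bind) (simp add: mult.commute)
  also have "\<dots> = pmf (remaining_arrivals \<pi> j) i"
  proof (cases i)
    case 0
    have "pmf (map_pmf Suc (remaining_arrivals \<pi> (Suc j))) 0 = 0"
      by (intro pmf_map_outside) auto
    with 0 show ?thesis by (simp add: pmf_remaining_arrivals hazard_def)
  next
    case (Suc i')
    have "1 - hazard \<pi> j = measure (measure_pmf \<pi>) {Suc j..} / measure (measure_pmf \<pi>) {j..}"
      using tail_pos[of j] tail_Suc[of j] by (simp add: hazard_def field_simps)
    with Suc tail_pos[of "Suc j"] show ?thesis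
      by (simp add: pmf_map_inj' pmf_remaining_arrivals)
  qed
  finally show "pmf (remaining_arrivals \<pi> j) i = pmf ?R i" ..
qed

text \<open>
  \<open>overflow r j\<close> is the law of the losses from a moment at which \<open>r\<close> places are free and the
  current service has seen \<open>j\<close> arrivals, until the number of customers falls below its present
  value.  The geometric sum accounts for the services that start afresh at the present level.
\<close>

primrec overflow :: "nat \<Rightarrow> nat \<Rightarrow> nat pmf" where
  "overflow 0 = remaining_arrivals \<pi>"
| "overflow (Suc r) = (\<lambda>j. bind_pmf (bernoulli_pmf (hazard \<pi> j)) (\<lambda>c. if c then return_pmf 0
     else conv_pmf (overflow r (Suc j)) (compound_pmf (geometric_pmf (pmf \<pi> 0)) (overflow r (Suc 0)))))"

lemma pmf_0_bounds: "0 < pmf \<pi> 0" "pmf \<pi> 0 < 1"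
proof -
  show "0 < pmf \<pi> 0" using full_support by (simp add: pmf_positive_iff)
  show "pmf \<pi> 0 < 1" using hazard_bounds(3)[of 0] by (simp add: hazard_def atLeast_0)
qed

text \<open>
  A service that has seen no arrival is a fresh one, so its first trial has the same success
  probability as the later ones and the two combine to a single geometric number.
\<close>

lemma overflow_Suc_0:
  "overflow (Suc r) 0 = compound_pmf (geometric_pmf (pmf \<pi> 0)) (overflow r (Suc 0))"
proof -
  have "overflow (Suc r) 0 = compound_pmf (delayed_geometric (pmf \<pi> 0) (pmf \<pi> 0)) (overflow r (Suc 0))"
    by (simp add: compound_delayed_geometric hazard_def atLeast_0)
  then show ?thesis using pmf_0_bounds by (simp add: delayed_geometric_same)
qed

text \<open>
  The induction on the room that compares the queue with the branching process: a larger
  probability of stopping at once and a smaller law for every sub-busy period make the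
  losses smaller.  All \<open>j\<close> are treated at once because the hazard bound is uniform in \<open>j\<close>.
\<close>

lemma branching_st_le_overflow:
  assumes hz: "\<And>j. hazard \<pi> j \<le> \<beta>" and "\<beta> \<le> 1"
    and base: "\<And>j. st_le s (remaining_arrivals \<pi> j)"
  shows "st_le ((compound_pmf (delayed_geometric \<beta> (pmf \<pi> 0)) ^^ r) s) (overflow r j)"
proof (induction r arbitrary: j)
  case (Suc r)
  show ?case
    unfolding funpow.simps o_apply overflow.simps
      compound_delayed_geometric[where s="(compound_pmf _ ^^ _) _"]
    using hazard_bounds
    by (intro st_le_bernoulli_bind st_le_conv st_le_compound Suc hz assms)
qed (simp add: base)

text \<open>
  The losses until the system is empty, from the start of a service with \<open>x\<close> customers: the number of
  customers has to pass down through the levels \<open>x, x - 1, \<dots>, 1\<close>, and level \<open>y + 1\<close> leaves \<open>n - y\<close>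
  free places.
\<close>

primrec total_losses :: "nat \<Rightarrow> nat \<Rightarrow> nat pmf" where
  "total_losses n 0 = return_pmf 0"
| "total_losses n (Suc y) = conv_pmf (overflow (n - y) 0) (total_losses n y)"

lemma plus_0_eq_id: "(+) (0::nat) = (\<lambda>x. x)"
  by auto

text \<open>
  The recursion along single arrivals, summed over all arrivals of one service, gives the
  recursion along services.
\<close>

lemma overflow_conv_total_losses:
  assumes "x + r = n"
  shows "conv_pmf (overflow r j) (total_losses n x)
    = bind_pmf (remaining_arrivals \<pi> j)
        (\<lambda>m. map_pmf ((+) (m - r)) (total_losses n (x + min m r)))"
  using assms
proof (induction r arbitrary: j x)
  case 0
  then show ?case by (simp add: conv_pmf_def)
next
  case (Suc r)
  let ?G = "compound_pmf (geometric_pmf (pmf \<pi> 0)) (overflow r (Suc 0))"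
  have "n - x = Suc r" using Suc.prems by simp
  then have G: "conv_pmf ?G (total_losses n x) = total_losses n (Suc x)"
    by (simp only: total_losses.simps overflow_Suc_0)
  have "conv_pmf (overflow (Suc r) j) (total_losses n x)
      = bind_pmf (bernoulli_pmf (hazard \<pi> j)) (\<lambda>c. if c then total_losses n x
          else conv_pmf (overflow r (Suc j)) (total_losses n (Suc x)))"
    unfolding overflow.simps conv_pmf_bind
    by (intro bind_pmf_cong refl) (simp add: conv_pmf_assoc G del: total_losses.simps)
  also have "\<dots> = bind_pmf (bernoulli_pmf (hazard \<pi> j)) (\<lambda>c. if c then total_losses n x
          else bind_pmf (remaining_arrivals \<pi> (Suc j))
            (\<lambda>m. map_pmf ((+) (m - r)) (total_losses n (Suc x + min m r))))"
    using Suc.prems by (subst Suc.IH) auto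
  also have "\<dots> = bind_pmf (remaining_arrivals \<pi> j)
            (\<lambda>m. map_pmf ((+) (m - Suc r)) (total_losses n (x + min m (Suc r))))"
    by (subst remaining_arrivals_unfold[of j], unfold bind_assoc_pmf, intro bind_pmf_cong refl)
       (auto simp: bind_return_pmf bind_map_pmf plus_0_eq_id)
  finally show ?case .
qed

lemma total_losses_step:
  assumes "0 < x" "x \<le> n + 1"
  shows "total_losses n x
    = bind_pmf \<pi> (\<lambda>m. map_pmf ((+) (x + m - (n + 1))) (total_losses n (min (x + m) (n + 1) - 1)))"
proof -
  obtain y where y: "x = Suc y" using assms by (cases x) auto
  have "total_losses n x = conv_pmf (overflow (n - y) 0) (total_losses n y)" by (simp add: y)
  also have "\<dots> = bind_pmf \<pi> (\<lambda>m. map_pmf ((+) (m - (n - y))) (total_losses n (y + min m (n - y))))"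
    using assms y by (subst overflow_conv_total_losses) (auto simp: remaining_arrivals_0)
  also have "\<dots> = bind_pmf \<pi> (\<lambda>m. map_pmf ((+) (x + m - (n + 1))) (total_losses n (min (x + m) (n + 1) - 1)))"
    using assms y by (intro bind_pmf_cong refl) (auto intro!: arg_cong2[where f=map_pmf] arg_cong[where f="total_losses n"])
  finally show ?thesis .
qed

text \<open>
  The probability that the chain observed at the starts of services has not reached \<open>0\<close> after
  \<open>K\<close> services.
\<close>

primrec not_emptied :: "nat \<Rightarrow> nat \<Rightarrow> nat \<Rightarrow> ennreal" where
  "not_emptied n 0 x = (if x = 0 then 0 else 1)"
| "not_emptied n (Suc K) x = (if x = 0 then 0
     else \<integral>\<^sup>+m. not_emptied n K (min (x + m) (n + 1) - 1) \<partial>measure_pmf \<pi>)"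

lemma not_emptied_0 [simp]: "not_emptied n K 0 = 0"
  by (cases K) auto

text \<open>
  From \<open>x\<close> customers the system empties in \<open>x\<close> services if nobody arrives during them, which has
  probability \<open>pmf \<pi> 0 ^ x\<close>.  The alternative \<open>x > j\<close> in the conclusion makes the induction on \<open>j\<close> start.
\<close>

lemma not_emptied_le: "(\<And>x. x \<le> n + 1 \<Longrightarrow> not_emptied n K x \<le> c) \<Longrightarrow> x \<le> n + 1 \<Longrightarrow>
   not_emptied n (K + j) x \<le> c * ennreal (1 - pmf \<pi> 0 ^ x) \<or> x > j"
proof (induction j arbitrary: x)
  case (Suc j)
  show ?case
  proof (cases "x = 0 \<or> x > Suc j")
    case False
    then obtain y where y: "x = Suc y" "y \<le> j" by (cases x) auto
    have le_c: "not_emptied n (K + j) z \<le> c" if "z \<le> n + 1" for z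
      using that
    proof (induction j arbitrary: z)
      case (Suc j)
      have "not_emptied n (K + Suc j) z \<le> (\<integral>\<^sup>+m. c \<partial>measure_pmf \<pi>)"
        by (cases "z = 0") (auto intro!: nn_integral_mono Suc.IH simp del: nn_integral_const)
      then show ?case by simp
    qed (use Suc in auto)
    have "not_emptied n (K + Suc j) x
        = (\<integral>\<^sup>+m. not_emptied n (K + j) (min (x + m) (n + 1) - 1) \<partial>measure_pmf \<pi>)"
      using y by simp
    also have "\<dots> \<le> (\<integral>\<^sup>+m. c * (ennreal (1 - pmf \<pi> 0 ^ y) * indicator {0} m + indicator (-{0}) m) \<partial>measure_pmf \<pi>)"
    proof (intro nn_integral_mono)
      fix m
      show "not_emptied n (K + j) (min (x + m) (n + 1) - 1)
        \<le> c * (ennreal (1 - pmf \<pi> 0 ^ y) * indicator {0} m + indicator (-{0}) m)"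
        using Suc.IH[of y] Suc.prems y le_c[of "min (x + m) (n + 1) - 1"]
        by (cases "m = 0") auto
    qed
    also have "\<dots> = c * (ennreal (1 - pmf \<pi> 0 ^ y) * emeasure \<pi> {0} + emeasure \<pi> (-{0}))"
      by (simp add: nn_integral_cmult nn_integral_add)
    also have "emeasure \<pi> (-{0}) = ennreal (1 - pmf \<pi> 0)"
      using measure_pmf.prob_compl[of "{0}" \<pi>]
      by (simp add: measure_pmf.emeasure_eq_measure measure_pmf_single Compl_eq_Diff_UNIV)
    also have "emeasure \<pi> {0} = ennreal (pmf \<pi> 0)"
      by (simp add: emeasure_pmf_single)
    also have "ennreal (1 - pmf \<pi> 0 ^ y) * ennreal (pmf \<pi> 0) + ennreal (1 - pmf \<pi> 0)
        = ennreal (1 - pmf \<pi> 0 ^ x)"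
      using pmf_0_bounds power_le_one[of "pmf \<pi> 0" y]
      by (simp add: y ennreal_mult[symmetric] ennreal_plus[symmetric] algebra_simps del: ennreal_plus)
    finally show ?thesis by auto
  qed auto
qed auto

text \<open>
  The probability of being still busy shrinks by a fixed factor in every block of \<open>n + 1\<close> services.
\<close>

lemma not_emptied_tendsto_0:
  assumes "x \<le> n + 1"
  shows "(INF K. not_emptied n K x) = 0"
proof -
  define d where "d = 1 - pmf \<pi> 0 ^ (n + 1)"
  have d: "0 \<le> d" "d < 1" using pmf_0_bounds by (auto simp: d_def power_le_one simp del: power_Suc)
  have *: "x \<le> n + 1 \<Longrightarrow> not_emptied n (i * (n + 1)) x \<le> ennreal (d ^ i)" for i x
  proof (induction i arbitrary: x)
    case (Suc i)
    have "not_emptied n (i * (n + 1) + (n + 1)) x \<le> ennreal (d ^ i) * ennreal (1 - pmf \<pi> 0 ^ x)"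
      using not_emptied_le[where K="i * (n + 1)" and j="n + 1" and x=x] Suc by auto
    also have "\<dots> \<le> ennreal (d ^ i) * ennreal d"
      using pmf_0_bounds Suc.prems
      by (intro mult_left_mono ennreal_leI) (auto simp: d_def intro!: power_decreasing simp del: power_Suc)
    also have "\<dots> = ennreal (d ^ Suc i)" using d by (simp add: ennreal_mult[symmetric] mult.commute)
    finally show ?case by (simp only: mult_Suc add.commute[of "n + 1"])
  qed auto
  have "(\<lambda>i. ennreal (d ^ i)) \<longlonglongrightarrow> ennreal 0"
    using d by (intro tendsto_ennrealI LIMSEQ_realpow_zero) auto
  moreover have "(INF K. not_emptied n K x) \<le> ennreal (d ^ i)" for i
    by (rule INF_lower2[of "i * (n + 1)"]) (use *[OF assms] in auto)
  ultimately have "(INF K. not_emptied n K x) \<le> ennreal 0"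
    by (intro LIMSEQ_le_const) auto
  then show ?thesis by simp
qed

text \<open>
  \<open>total_losses\<close> solves the one-service recursion exactly, \<open>u\<close> satisfies it as an inequality; after
  \<open>K\<close> services the two can differ only by the probability that the system is still busy, which
  vanishes in the limit.
\<close>

lemma total_losses_tail_le:
  fixes u :: "nat \<Rightarrow> nat \<Rightarrow> ennreal"
  assumes u0: "u 0 0 = 1"
    and uS: "\<And>x k. 0 < x \<Longrightarrow> x \<le> n + 1 \<Longrightarrow>
      (\<integral>\<^sup>+m. u (min (x + m) (n + 1) - 1) (k - (x + m - (n + 1))) \<partial>measure_pmf \<pi>) \<le> u x k"
    and x: "x \<le> n + 1"
  shows "emeasure (total_losses n x) {k..} \<le> u x k"
proof -
  have *: "emeasure (total_losses n x) {k..} \<le> u x k + not_emptied n K x" if "x \<le> n + 1" for K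
    using that
  proof (induction K arbitrary: x k)
    case 0
    show ?case
    proof (cases "x = 0")
      case True
      then show ?thesis by (cases k) (auto simp: u0)
    next
      case False
      have "emeasure (total_losses n x) {k..} \<le> 1" by (rule measure_pmf.emeasure_le_1)
      then show ?thesis using False by (auto intro: order_trans)
    qed
  next
    case (Suc K)
    show ?case
    proof (cases "x = 0")
      case True
      then show ?thesis by (cases k) (auto simp: u0)
    next
      case False
      have vim: "(+) c -` {k..} = {k - c..}" for c :: nat by auto
      have "emeasure (total_losses n x) {k..}
          = (\<integral>\<^sup>+m. emeasure (total_losses n (min (x + m) (n + 1) - 1)) {k - (x + m - (n + 1))..} \<partial>measure_pmf \<pi>)"
        using False Suc.prems by (subst total_losses_step) (auto simp: vim)
      also have "\<dots> \<le> (\<integral>\<^sup>+m. (u (min (x + m) (n + 1) - 1) (k - (x + m - (n + 1)))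
          + not_emptied n K (min (x + m) (n + 1) - 1)) \<partial>measure_pmf \<pi>)"
        by (intro nn_integral_mono Suc.IH) auto
      also have "\<dots> \<le> u x k + not_emptied n (Suc K) x"
        using False uS[of x k] Suc.prems by (simp add: nn_integral_add add_right_mono)
      finally show ?thesis .
    qed
  qed
  have "emeasure (total_losses n x) {k..} \<le> (INF K. u x k + not_emptied n K x)"
    using *[OF x] by (intro INF_greatest) auto
  also have "\<dots> = u x k + (INF K. not_emptied n K x)"
    by (rule INF_ennreal_const_add)
  finally show ?thesis using not_emptied_tendsto_0[OF x] by simp
qed

end

section \<open>Random sums over a Galton--Watson generation\<close>

lemma measurable_sum_nat:
  fixes f :: "'i \<Rightarrow> 'a \<Rightarrow> nat"
  assumes "\<And>i. i \<in> I \<Longrightarrow> f i \<in> measurable M (count_space UNIV)"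
  shows "(\<lambda>x. \<Sum>i\<in>I. f i x) \<in> measurable M (count_space UNIV)"
  using assms
proof (induction I rule: infinite_finite_induct)
  case (insert i I)
  have "(\<lambda>x. f i x + (\<Sum>i\<in>I. f i x)) \<in> measurable M (count_space UNIV)"
    by (rule measurable_compose_countable[where g="f i" and f="\<lambda>k x. k + (\<Sum>i\<in>I. f i x)"])
       (use insert in \<open>auto intro: measurable_compose[of _ _ "count_space UNIV"]\<close>)
  then show ?case using insert by simp
qed auto

text \<open>
  Selecting by \<open>X\<close> one of the variables \<open>W k\<close>, each independent of \<open>X\<close>, is the probabilistic
  counterpart of \<open>bind_pmf\<close>.  Sums with a random number of terms are the case of partial sums \<open>W k\<close>.
\<close>

lemma (in prob_space) distr_indep_choice:
  fixes X :: "'a \<Rightarrow> nat" and W :: "nat \<Rightarrow> 'a \<Rightarrow> nat"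
  assumes p: "distr M (count_space UNIV) X = measure_pmf p"
    and ind: "\<And>k. indep_var (count_space UNIV) X (count_space UNIV) (W k)"
    and f: "\<And>k. distr M (count_space UNIV) (W k) = measure_pmf (f k)"
  shows "distr M (count_space UNIV) (\<lambda>\<omega>. W (X \<omega>) \<omega>) = measure_pmf (bind_pmf p f)"
proof (rule measure_eqI_countable[where A=UNIV])
  have X [measurable]: "X \<in> measurable M (count_space UNIV)"
    using ind by (rule indep_var_rv1)
  have W [measurable]: "W k \<in> measurable M (count_space UNIV)" for k
    using ind by (rule indep_var_rv2)
  have WX [measurable]: "(\<lambda>\<omega>. W (X \<omega>) \<omega>) \<in> measurable M (count_space UNIV)"
    by (rule measurable_compose_countable[where g=X and f=W]) auto
  fix l :: nat
  let ?A = "\<lambda>k. {\<omega>\<in>space M. X \<omega> = k \<and> W k \<omega> = l}"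
  have "emeasure (distr M (count_space UNIV) (\<lambda>\<omega>. W (X \<omega>) \<omega>)) {l} = emeasure M (\<Union>k. ?A k)"
    by (subst emeasure_distr) (auto intro!: arg_cong[where f="emeasure M"])
  also have "\<dots> = (\<Sum>k. emeasure M (?A k))"
    by (rule suminf_emeasure[symmetric]) (auto simp: disjoint_family_on_def)
  also have "\<dots> = (\<Sum>k. ennreal (pmf p k) * ennreal (pmf (f k) l))"
  proof (rule suminf_cong)
    fix k
    have "prob (?A k) = prob ((\<lambda>x. (X x, W k x)) -` ({k} \<times> {l}) \<inter> space M)"
      by (rule arg_cong[where f=prob]) auto
    also have "\<dots> = prob (X -` {k} \<inter> space M) * prob (W k -` {l} \<inter> space M)"
      by (rule indep_varD[OF ind]) auto
    also have "prob (X -` {k} \<inter> space M) = pmf p k"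
      using arg_cong[OF p, of "\<lambda>D. measure D {k}"] by (simp add: measure_distr measure_pmf_single)
    also have "prob (W k -` {l} \<inter> space M) = pmf (f k) l"
      using arg_cong[OF f[of k], of "\<lambda>D. measure D {l}"] by (simp add: measure_distr measure_pmf_single)
    finally show "emeasure M (?A k) = ennreal (pmf p k) * ennreal (pmf (f k) l)"
      by (simp add: emeasure_eq_measure ennreal_mult)
  qed
  also have "\<dots> = emeasure (bind_pmf p f) {l}"
    by (simp add: nn_integral_measure_pmf nn_integral_count_space_nat emeasure_pmf_single
      ennreal_pmf_bind)
  finally show "emeasure (distr M (count_space UNIV) (\<lambda>\<omega>. W (X \<omega>) \<omega>)) {l}
    = emeasure (bind_pmf p f) {l}" .
qed auto

lemma (in prob_space) distr_iid_sum:
  fixes Y :: "nat \<Rightarrow> 'a \<Rightarrow> nat"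
  assumes ind: "indep_vars (\<lambda>_. count_space UNIV) Y UNIV"
    and s: "\<And>i. distr M (count_space UNIV) (Y i) = measure_pmf s"
  shows "distr M (count_space UNIV) (\<lambda>\<omega>. \<Sum>i<k. Y i \<omega>) = measure_pmf (iid_sum s k)"
proof (induction k)
  case 0
  have "distr M (count_space UNIV) (\<lambda>\<omega>. 0::nat) = measure_pmf (return_pmf 0)"
    by (rule measure_eqI_countable[where A=UNIV]) (auto simp: emeasure_distr emeasure_space_1 indicator_def)
  then show ?case by simp
next
  case (Suc k)
  have ind2: "indep_var (count_space UNIV) (Y k) (count_space UNIV) (\<lambda>\<omega>. a + (\<Sum>i<k. Y i \<omega>))" for a
  proof -
    have "indep_var (count_space UNIV) ((\<lambda>f. f k) \<circ> (\<lambda>\<omega>. restrict (\<lambda>i. Y i \<omega>) {k}))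
        (count_space UNIV) ((\<lambda>f. a + (\<Sum>i<k. f i)) \<circ> (\<lambda>\<omega>. restrict (\<lambda>i. Y i \<omega>) {..<k}))"
      by (rule indep_var_compose[OF indep_var_restrict[OF ind]])
         (auto intro!: measurable_compose[of _ _ "count_space UNIV", OF measurable_sum_nat]
           measurable_component_singleton)
    also have "(\<lambda>f. f k) \<circ> (\<lambda>\<omega>. restrict (\<lambda>i. Y i \<omega>) {k}) = Y k" by auto
    also have "(\<lambda>f. a + (\<Sum>i<k. f i)) \<circ> (\<lambda>\<omega>. restrict (\<lambda>i. Y i \<omega>) {..<k})
        = (\<lambda>\<omega>. a + (\<Sum>i<k. Y i \<omega>))" by auto
    finally show ?thesis .
  qed
  have [measurable]: "(\<lambda>\<omega>. \<Sum>i<k. Y i \<omega>) \<in> measurable M (count_space UNIV)"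
    using indep_var_rv2[OF ind2[of 0]] by simp
  have "distr M (count_space UNIV) (\<lambda>\<omega>. a + (\<Sum>i<k. Y i \<omega>)) = measure_pmf (map_pmf ((+) a) (iid_sum s k))" for a
    by (simp add: map_pmf_rep_eq Suc[symmetric] distr_distr comp_def)
  from distr_indep_choice[OF s ind2 this]
  show ?case by (simp add: conv_pmf_def add.commute)
qed

primrec generation_pmf :: "nat pmf \<Rightarrow> nat \<Rightarrow> nat pmf" where
  "generation_pmf q 0 = return_pmf 1"
| "generation_pmf q (Suc n) = bind_pmf (generation_pmf q n) (iid_sum q)"

lemma bind_generation_iid_sum:
  "bind_pmf (generation_pmf q n) (iid_sum s) = (compound_pmf q ^^ n) s"
proof (induction n arbitrary: s)
  case (Suc n)
  show ?case
    unfolding generation_pmf.simps bind_assoc_pmf bind_iid_sum_compound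
    by (simp add: Suc funpow_swap1)
qed (simp add: bind_return_pmf)

text \<open>
  The size of generation \<open>k\<close> is a function of the offspring numbers of the earlier generations
  and thus independent of the row \<open>\<xi> k\<close>.
\<close>

lemma distr_galton_watson:
  assumes gw: "galton_watson q N Z"
  shows "distr N (count_space UNIV) (Z n) = measure_pmf (generation_pmf q n)"
proof -
  interpret prob_space N using gw by (simp add: galton_watson_def)
  obtain \<xi> :: "nat \<Rightarrow> nat \<Rightarrow> _ \<Rightarrow> nat" where
    ind: "indep_vars (\<lambda>_. count_space UNIV) (\<lambda>(k, i). \<xi> k i) UNIV"
    and q: "\<And>k i. distr N (count_space UNIV) (\<xi> k i) = measure_pmf q"
    and Z0: "\<And>\<omega>. \<omega> \<in> space N \<Longrightarrow> Z 0 \<omega> = 1"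
    and ZS: "\<And>\<omega> k. \<omega> \<in> space N \<Longrightarrow> Z (Suc k) \<omega> = (\<Sum>i<Z k \<omega>. \<xi> k i \<omega>)"
    using gw unfolding galton_watson_def by blast
  \<comment> \<open>The generation sizes as functions of the array of offspring numbers, which makes their dependence on the past rows explicit.\<close>
  define zf :: "nat \<Rightarrow> (nat \<times> nat \<Rightarrow> nat) \<Rightarrow> nat"
    where "zf = rec_nat (\<lambda>_. 1) (\<lambda>j z f. \<Sum>i<z f. f (j, i))"
  have zf0: "zf 0 f = 1" and zfS: "zf (Suc j) f = (\<Sum>i<zf j f. f (j, i))" for f j
    by (auto simp: zf_def)
  let ?past = "\<lambda>k. {..<k} \<times> (UNIV :: nat set)"
  have zf_meas: "zf j \<in> measurable (PiM (?past k) (\<lambda>_. count_space UNIV)) (count_space UNIV)"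
    if "j \<le> k" for j k
    using that
  proof (induction j)
    case 0
    then show ?case by (simp add: zf0[abs_def])
  next
    case (Suc j)
    have "(\<lambda>f. \<Sum>i<zf j f. f (j, i)) \<in> measurable (PiM (?past k) (\<lambda>_. count_space UNIV)) (count_space UNIV)"
      by (rule measurable_compose_countable[where g="zf j" and f="\<lambda>m f. \<Sum>i<m. f (j, i)"])
         (use Suc in \<open>auto intro!: measurable_sum_nat measurable_component_singleton\<close>)
    then show ?case by (simp add: zfS[abs_def])
  qed
  have zf_Z: "zf j (restrict (\<lambda>j. (case j of (k, i) \<Rightarrow> \<xi> k i) \<omega>) (?past k)) = Z j \<omega>"
    if "\<omega> \<in> space N" "j \<le> k" for j k \<omega>
    using that(2) by (induction j) (auto simp: zf0 zfS Z0 ZS that(1))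
  have ind_row: "indep_vars (\<lambda>_. count_space UNIV) (\<xi> k) UNIV" for k
  proof -
    have "indep_vars (\<lambda>_. count_space UNIV) (\<lambda>i. (\<lambda>f. f (k, i)) \<circ>
        (\<lambda>\<omega>. restrict (\<lambda>j. (case j of (k, i) \<Rightarrow> \<xi> k i) \<omega>) {(k, i)})) UNIV"
      by (rule indep_vars_compose[OF indep_vars_restrict[OF ind]])
         (auto simp: disjoint_family_on_def intro!: measurable_component_singleton)
    then show ?thesis by (simp add: comp_def)
  qed
  have ind_past: "indep_var (count_space UNIV) (Z k) (count_space UNIV) (\<lambda>\<omega>. \<Sum>i<m. \<xi> k i \<omega>)" for k m
  proof -
    let ?X = "\<lambda>\<omega>. zf k (restrict (\<lambda>j. (case j of (k, i) \<Rightarrow> \<xi> k i) \<omega>) (?past k))"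
    have "indep_var (count_space UNIV) (zf k \<circ> (\<lambda>\<omega>. restrict (\<lambda>j. (case j of (k, i) \<Rightarrow> \<xi> k i) \<omega>) (?past k)))
        (count_space UNIV) ((\<lambda>f. \<Sum>i<m. f (k, i)) \<circ> (\<lambda>\<omega>. restrict (\<lambda>j. (case j of (k, i) \<Rightarrow> \<xi> k i) \<omega>) ({k} \<times> UNIV)))"
      by (rule indep_var_compose[OF indep_var_restrict[OF ind]])
         (auto intro!: measurable_sum_nat measurable_component_singleton zf_meas)
    then have i: "indep_var (count_space UNIV) ?X (count_space UNIV) (\<lambda>\<omega>. \<Sum>i<m. \<xi> k i \<omega>)"
      by (simp add: comp_def)
    have eq: "?X \<omega> = Z k \<omega>" if "\<omega> \<in> space N" for \<omega>
      using zf_Z[OF that, of k k] by (simp add: case_prod_beta)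
    have "Z k \<in> measurable N (count_space UNIV)"
      using indep_var_rv1[OF i] eq by (simp cong: measurable_cong)
    moreover have "distr N (count_space UNIV) ?X = distr N (count_space UNIV) (Z k)"
      using eq by (intro distr_cong) auto
    moreover have "distr N (count_space UNIV \<Otimes>\<^sub>M count_space UNIV) (\<lambda>x. (?X x, \<Sum>i<m. \<xi> k i x))
        = distr N (count_space UNIV \<Otimes>\<^sub>M count_space UNIV) (\<lambda>x. (Z k x, \<Sum>i<m. \<xi> k i x))"
      using eq by (intro distr_cong) auto
    ultimately show ?thesis
      using i unfolding indep_var_distribution_eq by simp
  qed
  show ?thesis
  proof (induction n)
    case 0
    have "distr N (count_space UNIV) (Z 0) = distr N (count_space UNIV) (\<lambda>_. 1)"
      using Z0 by (intro distr_cong) auto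
    also have "\<dots> = measure_pmf (return_pmf 1)"
      by (rule measure_eqI_countable[where A=UNIV]) (auto simp: emeasure_distr emeasure_space_1 indicator_def)
    finally show ?case by simp
  next
    case (Suc n)
    have "distr N (count_space UNIV) (Z (Suc n))
        = distr N (count_space UNIV) (\<lambda>\<omega>. \<Sum>i<Z n \<omega>. \<xi> n i \<omega>)"
      using ZS by (intro distr_cong) auto
    also have "\<dots> = measure_pmf (bind_pmf (generation_pmf q n) (iid_sum q))"
      by (rule distr_indep_choice[OF Suc ind_past distr_iid_sum[OF ind_row q]])
    finally show ?case by simp
  qed
qed

lemma distr_galton_watson_random_sum:
  assumes gw: "galton_watson q N Z"
    and ind: "prob_space.indep_vars N (\<lambda>_. count_space UNIV) \<sigma> UNIV"
    and s: "\<And>i. distr N (count_space UNIV) (\<sigma> i) = measure_pmf s"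
    and indZ: "indep_sequences N Z \<sigma>"
  shows "distr N (count_space UNIV) (\<lambda>\<omega>. \<Sum>i<Z n \<omega>. \<sigma> i \<omega>) = measure_pmf ((compound_pmf q ^^ n) s)"
proof -
  interpret prob_space N using gw by (simp add: galton_watson_def)
  have i: "indep_var (count_space UNIV) (Z n) (count_space UNIV) (\<lambda>\<omega>. \<Sum>i<k. \<sigma> i \<omega>)" for k
  proof -
    have "indep_var (count_space UNIV) ((\<lambda>f. f n) \<circ> (\<lambda>\<omega> i. Z i \<omega>))
        (count_space UNIV) ((\<lambda>f. \<Sum>i<k. f i) \<circ> (\<lambda>\<omega> i. \<sigma> i \<omega>))"
      by (rule indep_var_compose[OF indZ[unfolded indep_sequences_def]])
         (auto intro!: measurable_sum_nat measurable_component_singleton)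
    then show ?thesis by (simp add: comp_def)
  qed
  have "distr N (count_space UNIV) (\<lambda>\<omega>. \<Sum>i<Z n \<omega>. \<sigma> i \<omega>)
      = measure_pmf (bind_pmf (generation_pmf q n) (iid_sum s))"
    by (rule distr_indep_choice[OF distr_galton_watson[OF gw] i distr_iid_sum[OF ind s]])
  then show ?thesis by (simp add: bind_generation_iid_sum)
qed

section \<open>The sample path of one busy period\<close>

text \<open>
  The number of customers at the start of the \<open>j\<close>-th service if \<open>m j\<close> customers arrive during it.
\<close>

primrec level :: "nat \<Rightarrow> nat \<Rightarrow> (nat \<Rightarrow> nat) \<Rightarrow> nat \<Rightarrow> nat" where
  "level n x m 0 = x"
| "level n x m (Suc j) = min (level n x m j + m j) (n + 1) - 1"

lemma level_le: "x \<le> n + 1 \<Longrightarrow> level n x m j \<le> n + 1"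
  by (cases j) auto

text \<open>
  A path whose arrivals and service completions interlace as prescribed by the counts \<open>m\<close>: customers
  \<open>1 + (\<Sum>i<j. m i), \<dots>, \<Sum>i\<le>j. m i\<close> arrive during service \<open>j\<close>, and the system empties for the first
  time after \<open>K\<close> services.  The strict inequalities exclude arrivals at the end of a service, in particular at
  the very moment at which the busy period ends.
\<close>

locale busy_path =
  fixes n K :: nat and a s :: "nat \<Rightarrow> real" and m :: "nat \<Rightarrow> nat"
  assumes a_mono: "mono a" and a_0: "a 0 = 0" and s_pos: "\<And>i. 0 < s i"
    and interlaced: "\<And>j. 1 \<le> j \<Longrightarrow> j \<le> K \<Longrightarrow>
      a (\<Sum>i<j. m i) < (\<Sum>i<j. s i) \<and> (\<Sum>i<j. s i) < a (Suc (\<Sum>i<j. m i))"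
    and K_pos: "0 < K"
    and busy: "\<And>j. j < K \<Longrightarrow> 0 < level n 1 m j" and emptied: "level n 1 m K = 0"
begin

definition dep :: "nat \<Rightarrow> real" where "dep j = (\<Sum>i<j. s i)"
definition arr :: "nat \<Rightarrow> nat" where "arr j = (\<Sum>i<j. m i)"

abbreviation "X \<equiv> level n 1 m"

lemma dep_strict_mono: "strict_mono dep"
  by (rule strict_mono_Suc_iff[THEN iffD2]) (simp add: dep_def s_pos)

lemma dep_0: "dep 0 = 0" and dep_Suc: "dep (Suc j) = dep j + s j"
  and arr_0: "arr 0 = 0" and arr_Suc: "arr (Suc j) = arr j + m j"
  by (auto simp: dep_def arr_def)

lemma X_le: "X j \<le> n + 1"
  by (rule level_le) auto

lemma arr_le_dep: "j \<le> K \<Longrightarrow> a (arr j) \<le> dep j"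
  using interlaced[of j] by (cases "j = 0") (auto simp: dep_0 arr_0 a_0 dep_def arr_def intro: less_imp_le)

lemma dep_less_next_arrival: "1 \<le> j \<Longrightarrow> j \<le> K \<Longrightarrow> dep j < a (Suc (arr j))"
  using interlaced[of j] by (auto simp: dep_def arr_def)

lemma dep_le_next_arrival: "j \<le> K \<Longrightarrow> dep j \<le> a (Suc (arr j))"
  using dep_less_next_arrival[of j] monoD[OF a_mono, of 0 "Suc (arr j)"]
  by (cases "j = 0") (auto simp: dep_0 a_0)

lemma arr_less_dep: "1 \<le> j \<Longrightarrow> j \<le> K \<Longrightarrow> a (arr j) < dep j"
  using interlaced[of j] by (auto simp: dep_def arr_def)

text \<open>
  During service \<open>j\<close> exactly the first \<open>j\<close> admitted customers have left.
\<close>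

lemma remaining_deps:
  assumes "dep j \<le> t" "t < dep (Suc j)"
  shows "remaining (map dep [1..<Suc c]) t = c - j"
proof -
  have *: "t < dep i \<longleftrightarrow> j < i" for i
    using assms strict_mono_less_eq[OF dep_strict_mono, of i j]
      strict_mono_less_eq[OF dep_strict_mono, of "Suc j" i] by (cases "j < i") auto
  show ?thesis
    by (induction c) (auto simp: remaining_def * Suc_diff_le)
qed

lemma arrival_in_service:
  assumes "j < K" "i < m j"
  shows "dep j \<le> a (arr j + Suc i)" "a (arr j + Suc i) < dep (Suc j)"
proof -
  show "dep j \<le> a (arr j + Suc i)"
    using dep_le_next_arrival[of j] monoD[OF a_mono, of "Suc (arr j)" "arr j + Suc i"] assms by auto
  show "a (arr j + Suc i) < dep (Suc j)"
    using arr_less_dep[of "Suc j"] monoD[OF a_mono, of "arr j + Suc i" "arr (Suc j)"] assms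
    by (auto simp: arr_Suc)
qed

text \<open>
  As long as the server is busy, an admitted customer departs one service time after his
  predecessor, so the departure epochs stay the partial sums \<open>dep 1, dep 2, \<dots>\<close>.  An arrival
  during service \<open>j\<close> meets the admitted customers with numbers above \<open>j\<close>.
\<close>

lemma departures_step:
  assumes "j < K" "i < m j"
    and dl: "departures n a s (Suc (arr j + i)) = map dep [1..<Suc (j + min (X j + i) (n + 1))]"
  shows "departures n a s (Suc (arr j + Suc i)) = map dep [1..<Suc (j + min (X j + Suc i) (n + 1))]"
    and "lost n a s (Suc (arr j + i)) \<longleftrightarrow> n + 1 \<le> X j + i"
proof -
  let ?c = "j + min (X j + i) (n + 1)"
  define k where "k = Suc (arr j + i)"
  note dl = dl[folded k_def]
  have c: "Suc j \<le> ?c" using busy[OF \<open>j < K\<close>] by auto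
  have t: "dep j \<le> a k" "a k < dep (Suc j)"
    using arrival_in_service[OF assms(1,2)] by (auto simp: k_def)
  have rem: "remaining (departures n a s k) (a k) = min (X j + i) (n + 1)"
    unfolding dl using remaining_deps[OF t, of ?c] by simp
  show "lost n a s (Suc (arr j + i)) \<longleftrightarrow> n + 1 \<le> X j + i"
    unfolding lost_def rem[unfolded k_def] by auto
  show "departures n a s (Suc (arr j + Suc i)) = map dep [1..<Suc (j + min (X j + Suc i) (n + 1))]"
  proof (cases "X j + i < n + 1")
    case True
    \<comment> \<open>The last admitted customer is still present, so his departure is the start of the new service.\<close>
    have "Max (insert (a k) (set (departures n a s k))) = dep ?c"
    proof (rule Max_eqI)
      have deps: "set (departures n a s k) = dep ` {1..<Suc ?c}"
        by (simp add: dl del: departures.simps upt_Suc)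
      show "y \<le> dep ?c" if "y \<in> insert (a k) (set (departures n a s k))" for y
        using that t c strict_mono_less_eq[OF dep_strict_mono] order_trans[of y "dep (Suc j)" "dep ?c"]
        unfolding deps by auto
      show "dep ?c \<in> insert (a k) (set (departures n a s k))"
        unfolding deps using c by auto
    qed simp
    then have "departures n a s (Suc k) = map dep [1..<Suc ?c] @ [dep ?c + s ?c]"
      using True rem by (simp add: Let_def dl del: upt_Suc)
    also have "\<dots> = map dep [1..<Suc (Suc ?c)]"
      by (simp add: dep_Suc)
    finally show ?thesis using True by (simp add: k_def)
  next
    case False
    then have "departures n a s (Suc k) = map dep [1..<Suc ?c]"
      using rem dl by (simp add: Let_def del: upt_Suc)
    then show ?thesis using False by (simp add: k_def)
  qed
qed

lemma departures_in_service:
  assumes "j < K" "i \<le> m j"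
  shows "departures n a s (Suc (arr j + i)) = map dep [1..<Suc (j + min (X j + i) (n + 1))]"
  using assms
proof (induction j arbitrary: i)
  case 0
  then show ?case
  proof (induction i)
    case 0
    then show ?case by (simp add: arr_0 remaining_def a_0 dep_Suc dep_0)
  next
    case (Suc i)
    then show ?case by (intro departures_step(1)) auto
  qed
next
  case (Suc j)
  then show ?case
  proof (induction i)
    case 0
    have "departures n a s (Suc (arr j + m j)) = map dep [1..<Suc (j + min (X j + m j) (n + 1))]"
      using 0 by auto
    moreover have "0 < X j" using 0 busy[of j] by simp
    ultimately show ?case
      by (simp add: arr_Suc del: upt_Suc)
  next
    case (Suc i)
    then show ?case by (intro departures_step(1)) auto
  qed
qed

lemma lost_in_service: "j < K \<Longrightarrow> i < m j \<Longrightarrow> lost n a s (Suc (arr j + i)) \<longleftrightarrow> n + 1 \<le> X j + i"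
  using departures_in_service by (intro departures_step(2)) auto

text \<open>
  In a service that starts with \<open>X j\<close> customers the first \<open>n + 1 - X j\<close> arrivals are admitted.
\<close>

lemma card_lost:
  "j \<le> K \<Longrightarrow> card {k. k \<le> arr j \<and> lost n a s k} = (\<Sum>i<j. X i + m i - (n + 1))"
proof (induction j)
  case 0
  have "\<not> lost n a s 0" by (simp add: lost_def remaining_def)
  then have "{k. k \<le> arr 0 \<and> lost n a s k} = {}" by (auto simp: arr_0)
  then show ?case by simp
next
  case (Suc j)
  have "{k. k \<le> arr (Suc j) \<and> lost n a s k} = {k. k \<le> arr j \<and> lost n a s k}
      \<union> (\<lambda>i. Suc (arr j + i)) ` {n + 1 - X j..<m j}" (is "_ = ?A \<union> ?B")
  proof (rule set_eqI)
    fix k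
    show "k \<in> {k. k \<le> arr (Suc j) \<and> lost n a s k} \<longleftrightarrow> k \<in> ?A \<union> ?B"
    proof (cases "k \<le> arr j")
      case True
      then show ?thesis by (auto simp: arr_Suc)
    next
      case False
      then obtain i where k: "k = Suc (arr j + i)" using less_imp_Suc_add[of "arr j" k] by auto
      show ?thesis
        using lost_in_service[of j i] Suc.prems X_le[of j]
        by (auto simp: k arr_Suc image_iff) 
    qed
  qed
  moreover have "card (?A \<union> ?B) = card ?A + card ?B"
    by (rule card_Un_disjoint) auto
  moreover have "card ?B = X j + m j - (n + 1)"
    using X_le[of j] by (subst card_image) (auto simp: inj_on_def)
  ultimately show ?case using Suc by simp
qed

lemma arrivals_until:
  assumes "a k \<le> t" "t < a (Suc k)"
  shows "{i. a i \<le> t} = {..k}"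
  using assms monoD[OF a_mono, of _ k] monoD[OF a_mono, of "Suc k"]
  by (auto simp: not_less_eq_eq intro: order_trans) (meson leD le_less_trans not_less_eq_eq)

text \<open>
  At every time before \<open>dep K\<close> some service \<open>j < K\<close> is in progress and its customer has not left yet.
\<close>

lemma number_in_system_positive:
  assumes "0 < t" "t < dep K"
  shows "0 < number_in_system n a s t"
proof -
  define j where "j = (GREATEST j. dep j \<le> t)"
  have bd: "i \<le> K" if "dep i \<le> t" for i
    using that assms strict_mono_less[OF dep_strict_mono, of i K] by auto
  have 1: "dep j \<le> t"
    unfolding j_def by (rule GreatestI_nat[where b=K and k=0]) (use bd assms in \<open>auto simp: dep_0\<close>)
  have "\<not> dep (Suc j) \<le> t"
    using Greatest_le_nat[of "\<lambda>j. dep j \<le> t" "Suc j" K] bd by (auto simp: j_def)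
  then have 2: "t < dep (Suc j)" by simp
  have j: "j < K" using bd[OF 1] 1 assms by (cases "j = K") auto
  define i where "i = (GREATEST i. i \<le> m j \<and> a (arr j + i) \<le> t)"
  have i: "i \<le> m j \<and> a (arr j + i) \<le> t"
    unfolding i_def
    by (rule GreatestI_nat[where b="m j" and k=0]) (use 1 arr_le_dep[of j] j in auto)
  have "t < a (Suc (arr j + i))"
  proof (cases "i = m j")
    case True
    then show ?thesis using 2 dep_le_next_arrival[of "Suc j"] j by (auto simp: arr_Suc)
  next
    case False
    then have "\<not> a (arr j + Suc i) \<le> t"
      using Greatest_le_nat[of "\<lambda>i. i \<le> m j \<and> a (arr j + i) \<le> t" "Suc i" "m j"] i
      by (auto simp: i_def)
    then show ?thesis by simp
  qed
  then have "card {k. a k \<le> t} = Suc (arr j + i)"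
    using i by (subst arrivals_until[of "arr j + i"]) auto
  then have "number_in_system n a s t = min (X j + i) (n + 1)"
    unfolding number_in_system_def
    using departures_in_service[OF j, of i] i remaining_deps[OF 1 2] by (simp del: upt_Suc)
  then show ?thesis using busy[OF j] by simp
qed

lemma number_in_system_end: "number_in_system n a s (dep K) = 0"
proof -
  obtain j where j: "K = Suc j" using K_pos by (cases K) auto
  have "card {k. a k \<le> dep K} = Suc (arr K)"
    using arr_le_dep[of K] dep_less_next_arrival[of K] K_pos
    by (subst arrivals_until[of "arr K"]) auto
  moreover have "departures n a s (Suc (arr K)) = map dep [1..<Suc K]"
  proof -
    have "j + min (X j + m j) (n + 1) = K"
      using busy[of j] emptied by (auto simp: j)
    then show ?thesis
      using departures_in_service[of j "m j"] by (simp add: j arr_Suc del: departures.simps upt_Suc)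
  qed
  ultimately show ?thesis
    using remaining_deps[of K "dep K" K] strict_mono_less[OF dep_strict_mono, of K "Suc K"]
    by (simp add: number_in_system_def del: upt_Suc)
qed

lemma busy_period_end_eq: "busy_period_end n a s = ereal (dep K)"
  unfolding busy_period_end_def
proof (rule antisym)
  have "0 < dep K" using strict_mono_less[OF dep_strict_mono, of 0 K] K_pos by (simp add: dep_0)
  then show "Inf {ereal t |t. a 0 < t \<and> number_in_system n a s t = 0} \<le> ereal (dep K)"
    using number_in_system_end by (intro Inf_lower) (auto simp: a_0)
  show "ereal (dep K) \<le> Inf {ereal t |t. a 0 < t \<and> number_in_system n a s t = 0}"
    using number_in_system_positive by (intro Inf_greatest) (force simp: a_0 not_less[symmetric])
qed

lemma losses_eq: "losses n a s = (\<Sum>j<K. X j + m j - (n + 1))"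
proof -
  have "a k < dep K \<longleftrightarrow> k \<le> arr K" for k
    using arr_less_dep[of K] dep_less_next_arrival[of K] K_pos
      monoD[OF a_mono, of k "arr K"] monoD[OF a_mono, of "Suc (arr K)" k]
    by (cases "k \<le> arr K") auto
  then have "{k. lost n a s k \<and> ereal (a k) < busy_period_end n a s} = {k. k \<le> arr K \<and> lost n a s k}"
    by (auto simp: busy_period_end_eq)
  then show ?thesis using card_lost[of K] by (simp add: losses_def)
qed

end

section \<open>Measurability of the number of losses\<close>

lemma remaining_eq_card: "remaining ds t = card {i. i < length ds \<and> t < ds ! i}"
  by (simp add: remaining_def length_filter_conv_card)

context
  fixes M :: "'a measure" and n :: nat and a s :: "'a \<Rightarrow> nat \<Rightarrow> real"
  assumes a_meas [measurable]: "\<And>k. (\<lambda>\<omega>. a \<omega> k) \<in> borel_measurable M"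
    and s_meas [measurable]: "\<And>k. (\<lambda>\<omega>. s \<omega> k) \<in> borel_measurable M"
begin

text \<open>
  The entries of the random list of departures, padded with \<open>0\<close> beyond its random length, so that
  measurability of the list can be expressed by real-valued functions.
\<close>

definition entry :: "nat \<Rightarrow> nat \<Rightarrow> 'a \<Rightarrow> real" where
  "entry k i \<omega> = (let ds = departures n (a \<omega>) (s \<omega>) k in if i < length ds then ds ! i else 0)"

lemma measurable_remaining_if:
  assumes [measurable]: "(\<lambda>\<omega>. length (departures n (a \<omega>) (s \<omega>) k)) \<in> measurable M (count_space UNIV)"
    and [measurable]: "\<And>i. entry k i \<in> borel_measurable M"
    and [measurable]: "u \<in> borel_measurable M"
  shows "(\<lambda>\<omega>. remaining (departures n (a \<omega>) (s \<omega>) k) (u \<omega>)) \<in> measurable M (count_space UNIV)"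
proof -
  have "{i. i < length (departures n (a \<omega>) (s \<omega>) k) \<and> u \<omega> < departures n (a \<omega>) (s \<omega>) k ! i}
      = {i. i < length (departures n (a \<omega>) (s \<omega>) k) \<and> u \<omega> < entry k i \<omega>}" for \<omega>
    by (auto simp: entry_def Let_def)
  then show ?thesis by (simp add: remaining_eq_card)
qed

lemma measurable_Max_departures_if:
  assumes [measurable]: "(\<lambda>\<omega>. length (departures n (a \<omega>) (s \<omega>) k)) \<in> measurable M (count_space UNIV)"
    and [measurable]: "\<And>i. entry k i \<in> borel_measurable M"
    and [measurable]: "u \<in> borel_measurable M"
  shows "(\<lambda>\<omega>. Max (insert (u \<omega>) (set (departures n (a \<omega>) (s \<omega>) k)))) \<in> borel_measurable M"
  unfolding borel_measurable_iff_le
proof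
  fix c :: real
  have "{\<omega>\<in>space M. Max (insert (u \<omega>) (set (departures n (a \<omega>) (s \<omega>) k))) \<le> c}
      = {\<omega>\<in>space M. u \<omega> \<le> c \<and> (\<forall>i. i < length (departures n (a \<omega>) (s \<omega>) k) \<longrightarrow> entry k i \<omega> \<le> c)}"
    by (auto simp: entry_def Let_def all_set_conv_all_nth in_set_conv_nth)
  also have "\<dots> \<in> sets M" by measurable
  finally show "{\<omega>\<in>space M. Max (insert (u \<omega>) (set (departures n (a \<omega>) (s \<omega>) k))) \<le> c} \<in> sets M" .
qed

lemma measurable_departures:
  "(\<lambda>\<omega>. length (departures n (a \<omega>) (s \<omega>) k)) \<in> measurable M (count_space UNIV) \<and>
   (\<forall>i. entry k i \<in> borel_measurable M)"
proof (induction k)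
  case 0
  then show ?case by (simp add: entry_def[abs_def])
next
  case (Suc k)
  then have len [measurable]: "(\<lambda>\<omega>. length (departures n (a \<omega>) (s \<omega>) k)) \<in> measurable M (count_space UNIV)"
    and ent [measurable]: "\<And>i. entry k i \<in> borel_measurable M" by auto
  define admit where "admit \<omega> \<longleftrightarrow> remaining (departures n (a \<omega>) (s \<omega>) k) (a \<omega> k) < n + 1" for \<omega>
  define new where "new \<omega> = Max (insert (a \<omega> k) (set (departures n (a \<omega>) (s \<omega>) k)))
      + s \<omega> (length (departures n (a \<omega>) (s \<omega>) k))" for \<omega>
  have [measurable]: "(\<lambda>\<omega>. remaining (departures n (a \<omega>) (s \<omega>) k) (a \<omega> k)) \<in> measurable M (count_space UNIV)"
    by (rule measurable_remaining_if) auto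
  have [measurable]: "Measurable.pred M admit" unfolding admit_def[abs_def] by measurable
  have [measurable]: "(\<lambda>\<omega>. s \<omega> (length (departures n (a \<omega>) (s \<omega>) k))) \<in> borel_measurable M"
    by (rule measurable_compose_countable[OF _ len]) auto
  have [measurable]: "new \<in> borel_measurable M"
    unfolding new_def[abs_def]
    by (intro borel_measurable_add measurable_Max_departures_if) auto
  have "length (departures n (a \<omega>) (s \<omega>) (Suc k))
      = (if admit \<omega> then Suc (length (departures n (a \<omega>) (s \<omega>) k)) else length (departures n (a \<omega>) (s \<omega>) k))" for \<omega>
    by (simp add: admit_def Let_def)
  moreover have "entry (Suc k) i \<omega> = (if admit \<omega> \<and> i = length (departures n (a \<omega>) (s \<omega>) k) then new \<omega>
      else entry k i \<omega>)" for i \<omega>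
    by (simp add: admit_def new_def entry_def Let_def nth_append)
  ultimately show ?case by (simp add: fun_eq_iff[symmetric] entry_def[abs_def, symmetric] cong: measurable_cong)
qed

lemma measurable_remaining:
  assumes "u \<in> borel_measurable M"
  shows "(\<lambda>\<omega>. remaining (departures n (a \<omega>) (s \<omega>) k) (u \<omega>)) \<in> measurable M (count_space UNIV)"
  using measurable_departures assms by (intro measurable_remaining_if) auto

lemma measurable_number_in_system [measurable]:
  "(\<lambda>\<omega>. number_in_system n (a \<omega>) (s \<omega>) t) \<in> measurable M (count_space UNIV)"
  unfolding number_in_system_def
  by (rule measurable_compose_countable[where g="\<lambda>\<omega>. card {k. a \<omega> k \<le> t}"
        and f="\<lambda>k \<omega>. remaining (departures n (a \<omega>) (s \<omega>) k) t"])
     (auto intro!: measurable_remaining)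

end

text \<open>
  On every path, however irregular, an empty system stays empty for a short while: either the
  later arrivals keep a positive distance from \<open>t\<close>, or arrivals accumulate at \<open>t\<close> from the right; then infinitely many
  customers arrive up to any later time and, by the convention \<open>card = 0\<close>, \<open>number_in_system\<close> counts nobody.
  Hence the end of the busy period is determined by rational times, and its measurability holds
  without an exceptional null set.
\<close>

lemma number_in_system_0_right:
  assumes 0: "number_in_system n a s t = 0" and "t < c"
  shows "\<exists>r\<in>\<rat>. t < r \<and> r < c \<and> number_in_system n a s r = 0"
proof -
  have "\<exists>d>t. \<forall>r. t < r \<and> r < d \<longrightarrow> number_in_system n a s r = 0"
  proof (cases "\<exists>d>t. finite {k. a k \<le> d}")
    case False
    then show ?thesis
      by (intro exI[of _ "t + 1"]) (auto simp: number_in_system_def remaining_def)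
  next
    case True
    then obtain d where d: "d > t" "finite {k. a k \<le> d}" by auto
    have "finite {k. t < a k \<and> a k \<le> d}" by (rule finite_subset[OF _ d(2)]) auto
    define e where "e = Min (insert d (a ` {k. t < a k \<and> a k \<le> d}))"
    have fin: "finite (insert d (a ` {k. t < a k \<and> a k \<le> d}))" using \<open>finite {k. t < a k \<and> a k \<le> d}\<close> by auto
    have e: "t < e" "e \<le> d" "\<And>k. t < a k \<Longrightarrow> a k \<le> d \<Longrightarrow> e \<le> a k"
      unfolding e_def using fin d(1) by (auto simp: Min_gr_iff intro!: Min_le)
    have "number_in_system n a s r = 0" if r: "t < r" "r < e" for r
    proof -
      have "{k. a k \<le> r} = {k. a k \<le> t}"
      proof -
        have "a k \<le> r \<longleftrightarrow> a k \<le> t" for k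
          using r e(2) e(3)[of k] by (cases "a k \<le> t") force+
        then show ?thesis by simp
      qed
      then show ?thesis
        using 0 r by (auto simp: number_in_system_def remaining_def filter_empty_conv)
    qed
    then show ?thesis using e by blast
  qed
  then obtain d where d: "d > t" "\<And>r. t < r \<Longrightarrow> r < d \<Longrightarrow> number_in_system n a s r = 0" by blast
  obtain r where "r \<in> \<rat>" "t < r" "r < min c d"
    using Rats_dense_in_real[of t "min c d"] d(1) assms(2) by auto
  then show ?thesis using d(2) by auto
qed

lemma busy_period_end_eq_INF:
  "busy_period_end n a s
    = (INF r\<in>\<rat>. if a 0 < r \<and> number_in_system n a s r = 0 then ereal r else \<infinity>)" (is "_ = ?I")
  unfolding busy_period_end_def
proof (rule antisym)
  show "Inf {ereal t |t. a 0 < t \<and> number_in_system n a s t = 0} \<le> ?I"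
    by (intro INF_greatest) (auto intro: Inf_lower)
  show "?I \<le> Inf {ereal t |t. a 0 < t \<and> number_in_system n a s t = 0}"
  proof (rule Inf_greatest)
    fix z assume "z \<in> {ereal t |t. a 0 < t \<and> number_in_system n a s t = 0}"
    then obtain t where z: "z = ereal t" and t: "a 0 < t" "number_in_system n a s t = 0" by auto
    show "?I \<le> z"
      unfolding z
    proof (rule dense_ge)
      fix y assume "ereal t < y"
      then obtain c where c: "t < c" "ereal c \<le> y"
        by (cases y) (auto intro: gt_ex that[of "t + 1"])
      obtain r where "r \<in> \<rat>" "t < r" "r < c" "number_in_system n a s r = 0"
        using number_in_system_0_right[OF t(2) c(1)] by auto
      then show "?I \<le> y"
        using t c by (intro INF_lower2[of r]) (auto intro: order_trans[of _ "ereal c"])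
    qed
  qed
qed

lemma measurable_losses:
  assumes [measurable]: "\<And>k. (\<lambda>\<omega>. a \<omega> k) \<in> borel_measurable M" "\<And>k. (\<lambda>\<omega>. s \<omega> k) \<in> borel_measurable M"
  shows "(\<lambda>\<omega>. losses n (a \<omega>) (s \<omega>)) \<in> measurable M (count_space UNIV)"
proof -
  note [measurable] = measurable_number_in_system[where a=a and s=s] measurable_remaining[where a=a and s=s]
  have [measurable]: "(\<lambda>\<omega>. busy_period_end n (a \<omega>) (s \<omega>)) \<in> borel_measurable M"
    unfolding busy_period_end_eq_INF by (intro borel_measurable_INF countable_rat) measurable
  have [measurable]: "Measurable.pred M (\<lambda>\<omega>. lost n (a \<omega>) (s \<omega>) k)" for k
    unfolding lost_def by measurable
  show ?thesis unfolding losses_def by measurable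
qed

section \<open>Poisson arrivals during successive services\<close>

abbreviation seq_measure :: "real measure \<Rightarrow> (nat \<Rightarrow> real) measure" where
  "seq_measure D \<equiv> \<Pi>\<^sub>M i\<in>UNIV. D"

lemma prob_space_seq_measure: "prob_space D \<Longrightarrow> prob_space (seq_measure D)"
  by (intro prob_space_PiM)

lemma nn_integral_seq_measure:
  assumes "prob_space D" and f: "f \<in> borel_measurable (seq_measure D)"
  shows "(\<integral>\<^sup>+\<omega>. f \<omega> \<partial>seq_measure D) = (\<integral>\<^sup>+x. \<integral>\<^sup>+\<omega>. f (case_nat x \<omega>) \<partial>seq_measure D \<partial>D)"
proof -
  interpret prob_space D by fact
  interpret sequence_space D by unfold_locales
  have sf: "sigma_finite_measure (seq_measure D)"
    using prob_space_seq_measure[OF assms(1)] by (simp add: prob_space_imp_sigma_finite)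
  note f [measurable]
  have "(\<integral>\<^sup>+\<omega>. f \<omega> \<partial>seq_measure D)
      = (\<integral>\<^sup>+\<omega>. f \<omega> \<partial>distr (D \<Otimes>\<^sub>M seq_measure D) (seq_measure D) (\<lambda>(s, \<omega>). case_nat s \<omega>))"
    by (subst PiM_iter) simp
  also have "\<dots> = (\<integral>\<^sup>+x. \<integral>\<^sup>+\<omega>. f (case_nat x \<omega>) \<partial>seq_measure D \<partial>D)"
    by (subst nn_integral_distr) (auto simp: sigma_finite_measure.nn_integral_fst[OF sf, symmetric] case_prod_beta)
  finally show ?thesis .
qed

text \<open>
  For interarrival times \<open>T\<close>, exactly \<open>m\<close> arrivals occur strictly before \<open>s\<close> and none at \<open>s\<close>.  The
  recursive form, one gap at a time, keeps the events for different \<open>m\<close> disjoint even for sequences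
  with negative entries.
\<close>

primrec arrivals_before :: "nat \<Rightarrow> real \<Rightarrow> (nat \<Rightarrow> real) \<Rightarrow> bool" where
  "arrivals_before 0 s T \<longleftrightarrow> 0 < s \<and> s < T 0"
| "arrivals_before (Suc m) s T \<longleftrightarrow> 0 < s \<and> arrivals_before m (s - T 0) (\<lambda>i. T (Suc i))"

text \<open>
  The interarrival times seen by an observer who starts at time \<open>s\<close> after \<open>m\<close> arrivals.
\<close>

primrec gaps_after :: "nat \<Rightarrow> real \<Rightarrow> (nat \<Rightarrow> real) \<Rightarrow> nat \<Rightarrow> real" where
  "gaps_after 0 s T = case_nat (T 0 - s) (\<lambda>i. T (Suc i))"
| "gaps_after (Suc m) s T = gaps_after m (s - T 0) (\<lambda>i. T (Suc i))"

lemma arrivals_before_pos: "arrivals_before m s T \<Longrightarrow> 0 < s"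
  by (cases m) auto

lemma arrivals_before_unique: "arrivals_before m s T \<Longrightarrow> arrivals_before m' s T \<Longrightarrow> m = m'"
proof (induction m arbitrary: m' s T)
  case 0
  then show ?case by (cases m') (auto dest: arrivals_before_pos)
next
  case (Suc m)
  then show ?case by (cases m') (auto dest: arrivals_before_pos)
qed

lemma measurable_shift_seq:
  "f \<in> measurable M (seq_measure borel) \<Longrightarrow> (\<lambda>x i. f x (Suc i)) \<in> measurable M (seq_measure borel)"
  by (intro measurable_PiM_single') (auto intro: measurable_compose[OF _ measurable_component_singleton])

lemma measurable_nth_seq:
  "f \<in> measurable M (seq_measure borel) \<Longrightarrow> (\<lambda>x. f x i) \<in> borel_measurable M"
  by (auto intro: measurable_compose[OF _ measurable_component_singleton])

lemma measurable_arrivals_before: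
  "s \<in> borel_measurable M \<Longrightarrow> T \<in> measurable M (seq_measure borel) \<Longrightarrow>
    Measurable.pred M (\<lambda>x. arrivals_before m (s x) (T x))"
proof (induction m arbitrary: s T)
  case 0
  note [measurable] = 0(1) measurable_nth_seq[OF 0(2)]
  show ?case by simp
next
  case (Suc m)
  note [measurable] = Suc(2) measurable_nth_seq[OF Suc(3)]
  have [measurable]: "Measurable.pred M (\<lambda>x. arrivals_before m (s x - T x 0) (\<lambda>i. T x (Suc i)))"
    by (rule Suc.IH) (use measurable_shift_seq[OF Suc(3)] in auto)
  show ?case by simp
qed

lemma measurable_gaps_after:
  "s \<in> borel_measurable M \<Longrightarrow> T \<in> measurable M (seq_measure borel) \<Longrightarrow>
    (\<lambda>x. gaps_after m (s x) (T x)) \<in> measurable M (seq_measure borel)"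
proof (induction m arbitrary: s T)
  case 0
  note [measurable] = 0(1) measurable_nth_seq[OF 0(2)] measurable_shift_seq[OF 0(2)]
  show ?case unfolding gaps_after.simps by measurable
next
  case (Suc m)
  note [measurable] = Suc(2) measurable_nth_seq[OF Suc(3)]
  show ?case unfolding gaps_after.simps
    by (rule Suc.IH) (use measurable_shift_seq[OF Suc(3)] in auto)
qed



abbreviation exp_measure :: "real \<Rightarrow> real measure" where
  "exp_measure lam \<equiv> density lborel (exponential_density lam)"

text \<open>
  The Markov property of the Poisson process: the number of arrivals before \<open>s\<close> is Poisson and
  independent of the process restarted at \<open>s\<close>, which is again Poisson.  No arrival: lack of memory of
  the first gap.  One more arrival: the first gap is integrated out, and its exponential density convolved
  with the Erlang density of order \<open>m\<close> gives that of order \<open>m + 1\<close>.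
\<close>

lemma nn_integral_arrivals_before:
  assumes lam: "0 < lam" and f: "f \<in> borel_measurable (seq_measure borel)"
  shows "(\<integral>\<^sup>+T. indicator {T. arrivals_before m s T} T * f (gaps_after m s T) \<partial>seq_measure (exp_measure lam))
    = (if 0 < s then ennreal (erlang_density m lam s / lam) else 0) * (\<integral>\<^sup>+T. f T \<partial>seq_measure (exp_measure lam))"
proof (induction m arbitrary: s)
  let ?E = "exp_measure lam"
  let ?S = "seq_measure ?E"
  have E: "prob_space ?E" by (rule prob_space_exponential_density[OF lam])
  then interpret S: prob_space ?S by (rule prob_space_seq_measure)
  have sets_S [measurable_cong]: "sets ?S = sets (seq_measure borel)"
    by (intro sets_PiM_cong) auto
  note f [measurable]
  have [measurable]: "(\<lambda>T. T i) \<in> borel_measurable (seq_measure borel)" for i :: nat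
    by (rule measurable_component_singleton) simp
  have ident: "(\<lambda>T. T) \<in> measurable (seq_measure borel) (seq_measure borel)" by simp
  have [measurable]: "Measurable.pred (seq_measure borel) (\<lambda>T. arrivals_before m s T)" for m s
    by (rule measurable_arrivals_before) (auto intro: ident)
  have [measurable]: "(\<lambda>T. f (gaps_after m s T)) \<in> borel_measurable (seq_measure borel)" for m s
    by (rule measurable_compose[OF _ f], rule measurable_gaps_after) (auto intro: ident)
  have [measurable]: "(\<lambda>(x, \<omega>). f (case_nat x \<omega>)) \<in> borel_measurable (borel \<Otimes>\<^sub>M seq_measure borel)"
    by measurable
  {
    case 0
    define g where "g x = (\<integral>\<^sup>+\<omega>. f (case_nat x \<omega>) \<partial>?S)" for x
    have g [measurable]: "g \<in> borel_measurable borel"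
      unfolding g_def by measurable
    have "(\<integral>\<^sup>+T. indicator {T. arrivals_before 0 s T} T * f (gaps_after 0 s T) \<partial>?S)
        = (\<integral>\<^sup>+x. \<integral>\<^sup>+\<omega>. indicator {x. 0 < s \<and> s < x} x * f (case_nat (x - s) \<omega>) \<partial>?S \<partial>?E)"
    proof -
      have h: "(\<lambda>T. indicator {T. arrivals_before 0 s T} T * f (gaps_after 0 s T)) \<in> borel_measurable ?S"
        by measurable
      show ?thesis
        unfolding nn_integral_seq_measure[OF E h]
        by (intro nn_integral_cong) (auto simp: indicator_def)
    qed
    also have "\<dots> = (\<integral>\<^sup>+x. indicator {x. 0 < s \<and> s < x} x * g (x - s) \<partial>?E)"
      unfolding g_def by (intro nn_integral_cong nn_integral_cmult) simp
    also have "\<dots> = (\<integral>\<^sup>+x. ennreal (exponential_density lam x) * (indicator {x. 0 < s \<and> s < x} x * g (x - s)) \<partial>lborel)"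
      by (subst nn_integral_density) auto
    also have "\<dots> = (\<integral>\<^sup>+x. ennreal (exponential_density lam (s + x)) * (indicator {x. 0 < s \<and> s < x} (s + x) * g x) \<partial>lborel)"
      by (subst nn_integral_real_affine[where t=s and c=1]) auto
    also have "\<dots> = (\<integral>\<^sup>+x. (if 0 < s then ennreal (erlang_density 0 lam s / lam) else 0) *
          (ennreal (exponential_density lam x) * g x) \<partial>lborel)"
    proof (rule nn_integral_cong_AE, rule AE_mp[OF AE_lborel_singleton[of 0]], intro AE_I2 impI)
      fix x :: real assume "x \<noteq> 0"
      have e: "ennreal (exponential_density lam (s + x))
          = ennreal (exponential_density lam s / lam) * ennreal (exponential_density lam x)" if "0 < s" "0 < x"
      proof -
        have "exponential_density lam (s + x) = exponential_density lam s / lam * exponential_density lam x"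
          using that lam by (simp add: erlang_density_def mult_exp_exp algebra_simps)
        then show ?thesis using lam by (subst ennreal_mult[symmetric]) auto
      qed
      show "ennreal (exponential_density lam (s + x)) * (indicator {x. 0 < s \<and> s < x} (s + x) * g x)
        = (if 0 < s then ennreal (erlang_density 0 lam s / lam) else 0) * (ennreal (exponential_density lam x) * g x)"
      proof (cases "0 < s \<and> 0 < x")
        case True
        then show ?thesis by (simp add: e mult.assoc)
      next
        case False
        then show ?thesis using \<open>x \<noteq> 0\<close> by (auto simp: erlang_density_def[of _ _ x])
      qed
    qed
    also have "\<dots> = (if 0 < s then ennreal (erlang_density 0 lam s / lam) else 0) * (\<integral>\<^sup>+x. g x \<partial>?E)"
      by (simp add: nn_integral_cmult nn_integral_density)
    also have "(\<integral>\<^sup>+x. g x \<partial>?E) = (\<integral>\<^sup>+T. f T \<partial>?S)"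
      unfolding g_def by (rule nn_integral_seq_measure[OF E, symmetric]) simp
    finally show ?case .
  next
    case (Suc m)
    let ?I = "\<integral>\<^sup>+T. f T \<partial>?S"
    have "(\<integral>\<^sup>+T. indicator {T. arrivals_before (Suc m) s T} T * f (gaps_after (Suc m) s T) \<partial>?S)
        = (\<integral>\<^sup>+x. \<integral>\<^sup>+\<omega>. indicator {x. 0 < s} x * (indicator {T. arrivals_before m (s - x) T} \<omega> * f (gaps_after m (s - x) \<omega>)) \<partial>?S \<partial>?E)"
    proof -
      have h: "(\<lambda>T. indicator {T. arrivals_before (Suc m) s T} T * f (gaps_after (Suc m) s T)) \<in> borel_measurable ?S"
        by measurable
      show ?thesis
        unfolding nn_integral_seq_measure[OF E h]
        by (intro nn_integral_cong) (auto simp: indicator_def)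
    qed
    also have "\<dots> = (\<integral>\<^sup>+x. indicator {x. 0 < s} x * ((if 0 < s - x then ennreal (erlang_density m lam (s - x) / lam) else 0) * ?I) \<partial>?E)"
      by (intro nn_integral_cong, subst nn_integral_cmult, measurable) (simp only: Suc.IH)
    also have "\<dots> = (\<integral>\<^sup>+x. ennreal (exponential_density lam x) *
        (indicator {x. 0 < s} x * ((if 0 < s - x then ennreal (erlang_density m lam (s - x) / lam) else 0) * ?I)) \<partial>lborel)"
      by (subst nn_integral_density) auto
    also have "\<dots> = (\<integral>\<^sup>+x. (if 0 < s then ennreal (1 / lam) * ?I else 0) *
        (ennreal (erlang_density m lam (s - x)) * ennreal (erlang_density 0 lam x)) \<partial>lborel)"
    proof (rule nn_integral_cong_AE, rule AE_mp[OF AE_lborel_singleton[of s]], intro AE_I2 impI)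
      fix x :: real assume "x \<noteq> s"
      moreover have "ennreal (erlang_density m lam (s - x) / lam) = ennreal (1 / lam) * ennreal (erlang_density m lam (s - x))"
        using lam by (simp add: ennreal_mult[symmetric])
      moreover have "erlang_density m lam (s - x) = 0" if "s < x" using that by (simp add: erlang_density_def)
      ultimately show "ennreal (exponential_density lam x) *
        (indicator {x. 0 < s} x * ((if 0 < s - x then ennreal (erlang_density m lam (s - x) / lam) else 0) * ?I))
        = (if 0 < s then ennreal (1 / lam) * ?I else 0) *
        (ennreal (erlang_density m lam (s - x)) * ennreal (erlang_density 0 lam x))"
        by (cases "s < x") (auto simp: mult_ac)
    qed
    also have "\<dots> = (if 0 < s then ennreal (1 / lam) * ?I else 0) * ennreal (erlang_density (Suc m) lam s)"
      using fun_cong[OF convolution_erlang_density[OF lam, of m 0], of s]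
      by (subst nn_integral_cmult) auto
    also have "\<dots> = (if 0 < s then ennreal (erlang_density (Suc m) lam s / lam) else 0) * ?I"
    proof -
      have "ennreal (1 / lam) * ennreal (erlang_density (Suc m) lam s) = ennreal (erlang_density (Suc m) lam s / lam)"
        using lam by (subst ennreal_mult[symmetric]) auto
      moreover have "ennreal (1 / lam) * ?I * ennreal (erlang_density (Suc m) lam s)
          = ennreal (1 / lam) * ennreal (erlang_density (Suc m) lam s) * ?I"
        by (simp add: mult_ac)
      ultimately show ?thesis by simp
    qed
    finally show ?case .
  }
qed



section \<open>Losses of a path with prescribed arrival counts\<close>

text \<open>
  The list records the numbers of arrivals during the first services.  Lists are countable, so
  events that ask for some list are countable unions.
\<close>

primrec realizes :: "nat list \<Rightarrow> (nat \<Rightarrow> real) \<Rightarrow> (nat \<Rightarrow> real) \<Rightarrow> bool" where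
  "realizes [] T S \<longleftrightarrow> True"
| "realizes (m # ms) T S \<longleftrightarrow> arrivals_before m (S 0) T \<and> realizes ms (gaps_after m (S 0) T) (\<lambda>i. S (Suc i))"

text \<open>
  The chain of \<open>level\<close> run along a list: \<open>empties\<close> holds if \<open>0\<close> is reached at the end of the list and not
  before, and \<open>spilled\<close> counts the losses.
\<close>

primrec empties :: "nat \<Rightarrow> nat \<Rightarrow> nat list \<Rightarrow> bool" where
  "empties n x [] \<longleftrightarrow> x = 0"
| "empties n x (m # ms) \<longleftrightarrow> 0 < x \<and> empties n (min (x + m) (n + 1) - 1) ms"

primrec spilled :: "nat \<Rightarrow> nat \<Rightarrow> nat list \<Rightarrow> nat" where
  "spilled n x [] = 0"
| "spilled n x (m # ms) = (x + m - (n + 1)) + spilled n (min (x + m) (n + 1) - 1) ms"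

lemma level_Cons: "level n x (nth (m # ms)) (Suc j) = level n (min (x + m) (n + 1) - 1) (nth ms) j"
  by (induction j) auto

lemma empties_iff_level:
  "empties n x ms \<longleftrightarrow> (\<forall>j<length ms. 0 < level n x (nth ms) j) \<and> level n x (nth ms) (length ms) = 0"
proof (induction ms arbitrary: x)
  case (Cons m ms)
  show ?case
    unfolding length_Cons All_less_Suc2 level_Cons empties.simps Cons.IH by simp
qed simp

lemma spilled_eq_sum_level:
  "spilled n x ms = (\<Sum>j<length ms. level n x (nth ms) j + ms ! j - (n + 1))"
proof (induction ms arbitrary: x)
  case (Cons m ms)
  show ?case
    unfolding length_Cons sum.lessThan_Suc_shift level_Cons spilled.simps Cons.IH by simp
qed simp

lemma arrivals_before_imp_less:
  "arrivals_before m s T \<Longrightarrow> 0 < s \<and> (\<Sum>i<m. T i) < s \<and> s < (\<Sum>i<Suc m. T i)"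
proof (induction m arbitrary: s T)
  case (Suc m)
  show ?case
    using Suc.IH[of "s - T 0" "\<lambda>i. T (Suc i)"] Suc.prems
    unfolding sum.lessThan_Suc_shift[of _ m] sum.lessThan_Suc_shift[of _ "Suc m"] by auto
qed auto

lemma sum_gaps_after: "(\<Sum>i<Suc k. gaps_after m s T i) = (\<Sum>i<Suc (m + k). T i) - s"
proof (induction m arbitrary: s T)
  case 0
  then show ?case by (simp add: sum.lessThan_Suc_shift del: sum.lessThan_Suc)
next
  case (Suc m)
  have "(\<Sum>i<Suc (Suc m + k). T i) = T 0 + (\<Sum>i<Suc (m + k). T (Suc i))"
    unfolding add_Suc by (rule sum.lessThan_Suc_shift)
  with Suc[of "s - T 0" "\<lambda>i. T (Suc i)"] show ?case by (simp del: sum.lessThan_Suc)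
qed

text \<open>
  Unfolding the successive restarts, one recovers where the partial sums of the service times lie
  among the arrival epochs.  A restarted sequence whose next count is \<open>0\<close> contributes no arrival; the
  strict inequality then comes from the preceding service.
\<close>

lemma realizes_imp_interlaced:
  assumes "realizes ms T S" "\<And>i. 0 < S i" "1 \<le> j" "j \<le> length ms"
  shows "(\<Sum>i<(\<Sum>l<j. ms ! l). T i) < (\<Sum>i<j. S i) \<and> (\<Sum>i<j. S i) < (\<Sum>i<Suc (\<Sum>l<j. ms ! l). T i)"
  using assms
proof (induction ms arbitrary: T S j)
  case (Cons m ms)
  then obtain j' where j: "j = Suc j'" by (cases j) auto
  have c: "(\<Sum>i<m. T i) < S 0" "S 0 < (\<Sum>i<Suc m. T i)"
    using arrivals_before_imp_less[of m "S 0" T] Cons.prems by auto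
  show ?case
  proof (cases "j' = 0")
    case True
    then show ?thesis using c j by simp
  next
    case False
    define M where "M = (\<Sum>l<j'. ms ! l)"
    have IH: "(\<Sum>i<M. gaps_after m (S 0) T i) < (\<Sum>i<j'. S (Suc i))"
      "(\<Sum>i<j'. S (Suc i)) < (\<Sum>i<Suc M. gaps_after m (S 0) T i)"
      using Cons.IH[of "gaps_after m (S 0) T" "\<lambda>i. S (Suc i)" j'] Cons.prems False j
      unfolding M_def by auto
    have Sj: "(\<Sum>i<j. S i) = S 0 + (\<Sum>i<j'. S (Suc i))"
      unfolding j by (rule sum.lessThan_Suc_shift)
    have Mj: "(\<Sum>l<j. (m # ms) ! l) = m + M"
      unfolding j M_def by (subst sum.lessThan_Suc_shift) simp
    have "0 \<le> (\<Sum>i<j'. S (Suc i))" using Cons.prems(2) by (intro sum_nonneg) (auto intro: less_imp_le)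
    then have "(\<Sum>i<m + M. T i) < (\<Sum>i<j. S i)"
      using c IH(1) sum_gaps_after[where k="M - 1" and m=m and s="S 0" and T=T] by (cases M) (auto simp: Sj simp del: sum.lessThan_Suc)
    moreover have "(\<Sum>i<j. S i) < (\<Sum>i<Suc (m + M). T i)"
      using IH(2) unfolding sum_gaps_after Sj by simp
    ultimately show ?thesis unfolding Mj by simp
  qed
qed simp

lemma losses_of_realized_path:
  assumes r: "realizes ms T S" and S: "\<And>i. 0 < S i" and T: "\<And>i. 0 \<le> T i"
    and e: "empties n 1 ms"
  shows "losses n (\<lambda>k. \<Sum>i<k. T i) S = spilled n 1 ms"
proof -
  interpret busy_path n "length ms" "\<lambda>k. \<Sum>i<k. T i" S "nth ms"
  proof
    show "mono (\<lambda>k. \<Sum>i<k. T i)"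
      using T by (intro monoI sum_mono2) auto
    show "0 < length ms" using e by (cases ms) auto
    show "(\<Sum>i<\<Sum>i<j. ms ! i. T i) < (\<Sum>i<j. S i) \<and> (\<Sum>i<j. S i) < (\<Sum>i<Suc (\<Sum>i<j. ms ! i). T i)"
      if "1 \<le> j" "j \<le> length ms" for j
      using realizes_imp_interlaced[OF r S that] .
  qed (use S e in \<open>auto simp: empties_iff_level\<close>)
  show ?thesis by (simp add: losses_eq spilled_eq_sum_level)
qed

section \<open>Mixed Poisson laws and residual service times\<close>

definition poisson_mixture :: "real \<Rightarrow> real measure \<Rightarrow> nat pmf" where
  "poisson_mixture lam G = embed_pmf (\<lambda>m. \<integral>x. exp (- lam * x) * (lam * x) ^ m / fact m \<partial>G)"

text \<open>
  The mean of \<open>\<Xi>\<close> at an Erlang time of order \<open>i + 1\<close>.  For a distribution function this is the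
  probability that the time it describes ends before the \<open>(i + 1)\<close>-st Poisson arrival, and up to a
  constant it is the integral that defines the order \<open>C_le\<close>.
\<close>

definition erlang_mean :: "real \<Rightarrow> nat \<Rightarrow> (real \<Rightarrow> real) \<Rightarrow> ennreal" where
  "erlang_mean lam i \<Xi> = (\<integral>\<^sup>+x. ennreal (erlang_density i lam x) * ennreal (\<Xi> x) \<partial>lborel)"

lemma erlang_density_eq_poisson:
  "0 \<le> x \<Longrightarrow> 0 < lam \<Longrightarrow> erlang_density m lam x / lam = exp (- lam * x) * (lam * x) ^ m / fact m"
  by (simp add: erlang_density_def power_mult_distrib)

lemma poisson_sums_1: "(\<lambda>m. exp (- r) * r ^ m / fact m) sums (1::real)"
proof -
  have "(\<lambda>m. exp (- r) * (r ^ m /\<^sub>R fact m)) sums (exp (- r) * exp r)"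
    by (intro sums_mult exp_converges)
  then show ?thesis by (simp add: exp_minus divide_inverse mult_ac)
qed

context
  fixes lam :: real and G :: "real measure"
  assumes lam: "0 < lam" and G: "nonneg_law G"
begin

interpretation G: real_distribution G
  using G by (simp add: nonneg_law_def)

lemma borel_measurable_cdf_G [measurable]: "cdf G \<in> borel_measurable borel"
  by (rule borel_measurable_mono) (auto intro!: monoI G.cdf_nondecreasing)

lemma AE_G_nonneg: "AE x in G. 0 \<le> x"
  using G by (simp add: nonneg_law_def)

lemma integrable_poisson_weight:
  "integrable G (\<lambda>x. exp (- lam * x) * (lam * x) ^ m / fact m)"
proof (rule G.integrable_const_bound[where B=1])
  show "AE x in G. norm (exp (- lam * x) * (lam * x) ^ m / fact m) \<le> 1"
    using AE_G_nonneg
  proof eventually_elim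
    case (elim x)
    have s: "(\<lambda>m. exp (- (lam * x)) * (lam * x) ^ m / fact m) sums 1" by (rule poisson_sums_1)
    have "(\<Sum>k\<in>{m}. exp (- (lam * x)) * (lam * x) ^ k / fact k) \<le> (\<Sum>m. exp (- (lam * x)) * (lam * x) ^ m / fact m)"
      using elim lam by (intro sum_le_suminf sums_summable[OF s]) auto
    then show ?case using s elim lam by (simp add: sums_iff)
  qed
qed simp

lemma ennreal_integral_poisson_weight:
  "ennreal (\<integral>x. exp (- lam * x) * (lam * x) ^ m / fact m \<partial>G) = (\<integral>\<^sup>+x. ennreal (erlang_density m lam x / lam) \<partial>G)"
proof -
  have "ennreal (\<integral>x. exp (- lam * x) * (lam * x) ^ m / fact m \<partial>G)
      = (\<integral>\<^sup>+x. ennreal (exp (- lam * x) * (lam * x) ^ m / fact m) \<partial>G)"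
    using AE_G_nonneg lam
    by (intro nn_integral_eq_integral[symmetric] integrable_poisson_weight) (auto elim!: eventually_mono)
  also have "\<dots> = (\<integral>\<^sup>+x. ennreal (erlang_density m lam x / lam) \<partial>G)"
    using AE_G_nonneg lam
    by (intro nn_integral_cong_AE) (auto elim!: eventually_mono simp: erlang_density_eq_poisson)
  finally show ?thesis .
qed

lemma integral_poisson_weight_nonneg: "0 \<le> (\<integral>x. exp (- lam * x) * (lam * x) ^ m / fact m \<partial>G)"
  using AE_G_nonneg lam by (intro integral_nonneg_AE) (auto elim!: eventually_mono)

lemma pmf_poisson_mixture:
  "pmf (poisson_mixture lam G) m = (\<integral>x. exp (- lam * x) * (lam * x) ^ m / fact m \<partial>G)"
  unfolding poisson_mixture_def
proof (rule pmf_embed_pmf)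
  have "(\<integral>\<^sup>+m. ennreal (\<integral>x. exp (- lam * x) * (lam * x) ^ m / fact m \<partial>G) \<partial>count_space UNIV)
      = (\<integral>\<^sup>+x. (\<Sum>m. ennreal (erlang_density m lam x / lam)) \<partial>G)"
    unfolding ennreal_integral_poisson_weight nn_integral_count_space_nat
    by (rule nn_integral_suminf[symmetric]) simp
  also have "\<dots> = (\<integral>\<^sup>+x. 1 \<partial>G)"
    using AE_G_nonneg
  proof (intro nn_integral_cong_AE, eventually_elim)
    case (elim x)
    have "(\<lambda>m. erlang_density m lam x / lam) sums 1"
      using poisson_sums_1[of "lam * x"] elim lam by (simp add: erlang_density_eq_poisson)
    then show "(\<Sum>m. ennreal (erlang_density m lam x / lam)) = 1"
      using lam by (subst suminf_ennreal2) (auto simp: sums_iff)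
  qed
  also have "\<dots> = 1" using G.emeasure_space_1 by simp
  finally show "(\<integral>\<^sup>+m. ennreal (\<integral>x. exp (- lam * x) * (lam * x) ^ m / fact m \<partial>G) \<partial>count_space UNIV) = 1" .
qed (rule integral_poisson_weight_nonneg)

lemma ennreal_pmf_poisson_mixture:
  "ennreal (pmf (poisson_mixture lam G) m) = (\<integral>\<^sup>+x. ennreal (erlang_density m lam x / lam) \<partial>G)"
  by (simp only: pmf_poisson_mixture ennreal_integral_poisson_weight)

lemma erlang_tail:
  assumes "0 \<le> u"
  shows "(\<integral>\<^sup>+v. ennreal (erlang_density i lam v) * indicator {u..} v \<partial>lborel)
      = ennreal (\<Sum>l\<le>i. erlang_density l lam u / lam)"
proof -
  have sum: "(\<Sum>l\<le>i. erlang_density l lam u / lam) = 1 - erlang_CDF i lam u"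
    using assms lam by (simp add: erlang_CDF_def erlang_density_eq_poisson mult_ac)
  let ?D = "density lborel (erlang_density i lam)"
  interpret D: prob_space ?D by (rule prob_space_erlang_density[OF lam])
  have "(\<integral>\<^sup>+v. ennreal (erlang_density i lam v) * indicator {u..} v \<partial>lborel)
      = (\<integral>\<^sup>+v. ennreal (erlang_density i lam v) * indicator (- {..u}) v \<partial>lborel)"
    by (rule nn_integral_cong_AE, rule AE_mp[OF AE_lborel_singleton[of u]])
       (auto intro!: AE_I2 simp: indicator_def)
  also have "\<dots> = emeasure ?D (space ?D - {..u})"
    by (subst emeasure_density) (auto simp: Compl_eq_Diff_UNIV)
  also have "\<dots> = ennreal (1 - erlang_CDF i lam u)"
    using emeasure_erlang_density[OF lam, of i u] erlang_CDF_nonneg[OF lam, of i u]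
    by (subst D.emeasure_eq_measure, subst D.prob_compl) (auto simp: D.emeasure_eq_measure)
  finally show "(\<integral>\<^sup>+v. ennreal (erlang_density i lam v) * indicator {u..} v \<partial>lborel)
      = ennreal (\<Sum>l\<le>i. erlang_density l lam u / lam)" unfolding sum .
qed

text \<open>
  At most \<open>i\<close> arrivals occur in a time iff the \<open>(i + 1)\<close>-st arrival comes later.  Exchanging the
  integrals over the time and over this arrival epoch replaces the law by its distribution function.
\<close>

lemma emeasure_poisson_mixture_atMost:
  "emeasure (poisson_mixture lam G) {..i} = erlang_mean lam i (cdf G)"
proof -
  have "emeasure (poisson_mixture lam G) {..i} = (\<Sum>l\<le>i. ennreal (pmf (poisson_mixture lam G) l))"
    by (subst emeasure_measure_pmf_finite) auto
  also have "\<dots> = (\<integral>\<^sup>+x. (\<Sum>l\<le>i. ennreal (erlang_density l lam x / lam)) \<partial>G)"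
    unfolding ennreal_pmf_poisson_mixture by (rule nn_integral_sum[symmetric]) simp
  also have "\<dots> = (\<integral>\<^sup>+x. (\<integral>\<^sup>+v. ennreal (erlang_density i lam v) * indicator {v. x \<le> v} v \<partial>lborel) \<partial>G)"
    using AE_G_nonneg lam
    by (intro nn_integral_cong_AE) (auto elim!: eventually_mono simp: erlang_tail atLeast_def[symmetric])
  also have "\<dots> = (\<integral>\<^sup>+v. (\<integral>\<^sup>+x. ennreal (erlang_density i lam v) * indicator {v. x \<le> v} v \<partial>G) \<partial>lborel)"
    by (rule pair_sigma_finite.Fubini'[symmetric]) 
       (auto simp: pair_sigma_finite_def lborel.sigma_finite_measure_axioms G.sigma_finite_measure_axioms)
  also have "\<dots> = (\<integral>\<^sup>+v. ennreal (erlang_density i lam v) * ennreal (cdf G v) \<partial>lborel)"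
  proof (intro nn_integral_cong)
    fix v :: real
    have "(\<integral>\<^sup>+x. ennreal (erlang_density i lam v) * indicator {v. x \<le> v} v \<partial>G)
        = (\<integral>\<^sup>+x. ennreal (erlang_density i lam v) * indicator {..v} x \<partial>G)"
      by (intro nn_integral_cong) (auto simp: indicator_def)
    then show "(\<integral>\<^sup>+x. ennreal (erlang_density i lam v) * indicator {v. x \<le> v} v \<partial>G)
        = ennreal (erlang_density i lam v) * ennreal (cdf G v)"
      by (simp add: nn_integral_cmult cdf_def G.emeasure_eq_measure)
  qed
  finally show ?thesis by (simp add: erlang_mean_def)
qed

lemma emeasure_poisson_mixture_atLeast_Suc:
  "emeasure (poisson_mixture lam G) {Suc j..}
    = (\<integral>\<^sup>+y. ennreal (erlang_density j lam y) * ennreal (1 - cdf G y) \<partial>lborel)"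
proof -
  have cdf1: "1 - cdf G y = measure G {y<..}" for y
  proof -
    have "measure G {y<..} = measure G (space G - {..y})"
      by (rule arg_cong[where f="measure G"]) auto
    also have "\<dots> = 1 - cdf G y"
      by (subst G.prob_compl) (auto simp: cdf_def)
    finally show ?thesis ..
  qed
  have "emeasure (poisson_mixture lam G) {Suc j..} + emeasure (poisson_mixture lam G) {..j} = 1"
  proof -
    have "{Suc j..} \<union> {..j} = UNIV" by auto
    then show ?thesis by (subst plus_emeasure) (auto simp: measure_pmf.emeasure_space_1[simplified])
  qed
  moreover have "(\<integral>\<^sup>+y. ennreal (erlang_density j lam y) * ennreal (1 - cdf G y) \<partial>lborel)
      + erlang_mean lam j (cdf G) = 1"
  proof -
    have "(\<integral>\<^sup>+y. ennreal (erlang_density j lam y) * ennreal (1 - cdf G y) \<partial>lborel)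
      + erlang_mean lam j (cdf G) = (\<integral>\<^sup>+y. ennreal (erlang_density j lam y) * ennreal (1 - cdf G y)
        + ennreal (erlang_density j lam y) * ennreal (cdf G y) \<partial>lborel)"
      unfolding erlang_mean_def by (subst nn_integral_add) auto
    also have "\<dots> = (\<integral>\<^sup>+y. ennreal (erlang_density j lam y) \<partial>lborel)"
      using G.cdf_bounded_prob G.cdf_nonneg
      by (intro nn_integral_cong) (simp add: distrib_left[symmetric] ennreal_plus[symmetric] del: ennreal_plus)
    also have "\<dots> = 1"
      using prob_space.emeasure_space_1[OF prob_space_erlang_density[OF lam, of j]]
      by (simp add: emeasure_density)
    finally show ?thesis .
  qed
  ultimately show ?thesis
    unfolding emeasure_poisson_mixture_atMost
    by (metis ennreal_add_diff_cancel_right ennreal_one_neq_top ennreal_add_eq_top)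
qed

text \<open>
  Condition on the epoch \<open>y\<close> of the \<open>(j + 1)\<close>-st arrival, which has an Erlang density: at most
  \<open>i\<close> further arrivals fall into the rest of the service, and the service ends in \<open>(y, y + x]\<close> with
  probability \<open>cdf G (x + y) - cdf G y\<close>.
\<close>

lemma poisson_mixture_Suc_window:
  "emeasure (poisson_mixture lam G) {Suc j..Suc j + i}
    = (\<integral>\<^sup>+y. ennreal (erlang_density j lam y) * erlang_mean lam i (\<lambda>x. cdf G (x + y) - cdf G y) \<partial>lborel)"
proof -
  \<comment> \<open>Splitting \<open>Suc j + l\<close> arrivals at the epoch of number \<open>Suc j\<close> is a convolution of Erlang densities.\<close>
  have conv: "ennreal (erlang_density (Suc j + l) lam s / lam)
      = (\<integral>\<^sup>+y. ennreal (erlang_density j lam y) * ennreal (erlang_density l lam (s - y) / lam) \<partial>lborel)" for l s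
  proof -
    have "(\<integral>\<^sup>+y. ennreal (erlang_density j lam y) * ennreal (erlang_density l lam (s - y) / lam) \<partial>lborel)
        = (\<integral>\<^sup>+y. ennreal (1 / lam) * (ennreal (erlang_density l lam (s - y)) * ennreal (erlang_density j lam y)) \<partial>lborel)"
      using lam by (intro nn_integral_cong) (simp add: ennreal_mult[symmetric])
    also have "\<dots> = ennreal (1 / lam) * ennreal (erlang_density (Suc l + Suc j - 1) lam s)"
      using fun_cong[OF convolution_erlang_density[OF lam, of l j], of s] by (subst nn_integral_cmult) auto
    also have "\<dots> = ennreal (erlang_density (Suc j + l) lam s / lam)"
      using lam by (simp add: ennreal_mult[symmetric] add.commute)
    finally show ?thesis ..
  qed
  have tail: "(\<Sum>l\<le>i. ennreal (erlang_density l lam u / lam))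
      = (\<integral>\<^sup>+v. ennreal (erlang_density i lam v) * indicator {v. 0 < u \<and> u \<le> v} v \<partial>lborel)" if "u \<noteq> 0" for u
  proof (cases "0 < u")
    case True
    then have "{v. 0 < u \<and> u \<le> v} = {u..}" by auto
    then show ?thesis using True erlang_tail[of u i] lam by (simp add: sum_ennreal)
  next
    case False
    then show ?thesis using that by (simp add: erlang_density_def)
  qed
  have "{Suc j..Suc j + i} = (+) (Suc j) ` {..i}"
    by (auto simp: image_iff) (metis atMost_iff le_add_diff_inverse add_Suc nat_add_left_cancel_le)
  then have "emeasure (poisson_mixture lam G) {Suc j..Suc j + i} = (\<Sum>l\<le>i. ennreal (pmf (poisson_mixture lam G) (Suc j + l)))"
    by (simp only:, subst emeasure_measure_pmf_finite) (auto simp: sum.reindex inj_on_def sum_ennreal)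
  also have "\<dots> = (\<integral>\<^sup>+s. (\<Sum>l\<le>i. ennreal (erlang_density (Suc j + l) lam s / lam)) \<partial>G)"
    unfolding ennreal_pmf_poisson_mixture by (rule nn_integral_sum[symmetric]) simp
  also have "\<dots> = (\<integral>\<^sup>+s. (\<integral>\<^sup>+y. ennreal (erlang_density j lam y) *
      (\<Sum>l\<le>i. ennreal (erlang_density l lam (s - y) / lam)) \<partial>lborel) \<partial>G)"
    unfolding conv by (intro nn_integral_cong) (subst nn_integral_sum[symmetric], auto simp: sum_distrib_left)
  also have "\<dots> = (\<integral>\<^sup>+s. (\<integral>\<^sup>+y. ennreal (erlang_density j lam y) *
      (\<integral>\<^sup>+v. ennreal (erlang_density i lam v) * indicator {v. 0 < s - y \<and> s - y \<le> v} v \<partial>lborel) \<partial>lborel) \<partial>G)"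
  proof (rule nn_integral_cong, rule nn_integral_cong_AE)
    fix s
    show "AE y in lborel. ennreal (erlang_density j lam y) * (\<Sum>l\<le>i. ennreal (erlang_density l lam (s - y) / lam))
       = ennreal (erlang_density j lam y) *
      (\<integral>\<^sup>+v. ennreal (erlang_density i lam v) * indicator {v. 0 < s - y \<and> s - y \<le> v} v \<partial>lborel)"
      by (rule AE_mp[OF AE_lborel_singleton[of s]]) (auto intro!: AE_I2 simp: tail)
  qed
  also have "\<dots> = (\<integral>\<^sup>+y. (\<integral>\<^sup>+s. ennreal (erlang_density j lam y) *
      (\<integral>\<^sup>+v. ennreal (erlang_density i lam v) * indicator {v. 0 < s - y \<and> s - y \<le> v} v \<partial>lborel) \<partial>G) \<partial>lborel)"
    by (rule pair_sigma_finite.Fubini'[symmetric]) 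
       (auto simp: pair_sigma_finite_def lborel.sigma_finite_measure_axioms G.sigma_finite_measure_axioms)
  also have "\<dots> = (\<integral>\<^sup>+y. ennreal (erlang_density j lam y) * erlang_mean lam i (\<lambda>x. cdf G (x + y) - cdf G y) \<partial>lborel)"
  proof (rule nn_integral_cong)
    fix y :: real
    have "(\<integral>\<^sup>+s. (\<integral>\<^sup>+v. ennreal (erlang_density i lam v) * indicator {v. 0 < s - y \<and> s - y \<le> v} v \<partial>lborel) \<partial>G)
        = (\<integral>\<^sup>+v. (\<integral>\<^sup>+s. ennreal (erlang_density i lam v) * indicator {v. 0 < s - y \<and> s - y \<le> v} v \<partial>G) \<partial>lborel)"
      by (rule pair_sigma_finite.Fubini'[symmetric]) 
         (auto simp: pair_sigma_finite_def lborel.sigma_finite_measure_axioms G.sigma_finite_measure_axioms)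
    also have "\<dots> = erlang_mean lam i (\<lambda>x. cdf G (x + y) - cdf G y)"
      unfolding erlang_mean_def
    proof (rule nn_integral_cong)
      fix v :: real
      have "(\<integral>\<^sup>+s. ennreal (erlang_density i lam v) * indicator {v. 0 < s - y \<and> s - y \<le> v} v \<partial>G)
          = (\<integral>\<^sup>+s. ennreal (erlang_density i lam v) * indicator {y<..v + y} s \<partial>G)"
        by (intro nn_integral_cong) (auto simp: indicator_def)
      also have "\<dots> = ennreal (erlang_density i lam v) * emeasure G {y<..v + y}"
        by (simp add: nn_integral_cmult)
      also have "\<dots> = ennreal (erlang_density i lam v) * ennreal (cdf G (v + y) - cdf G y)"
        using lam G.cdf_diff_eq[of y "v + y"]
        by (cases "0 < v"; cases "v = 0") (auto simp: G.emeasure_eq_measure erlang_density_def)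
      finally show "(\<integral>\<^sup>+s. ennreal (erlang_density i lam v) * indicator {v. 0 < s - y \<and> s - y \<le> v} v \<partial>G)
          = ennreal (erlang_density i lam v) * ennreal (cdf G (v + y) - cdf G y)" .
    qed
    finally show "(\<integral>\<^sup>+s. ennreal (erlang_density j lam y) *
        (\<integral>\<^sup>+v. ennreal (erlang_density i lam v) * indicator {v. 0 < s - y \<and> s - y \<le> v} v \<partial>lborel) \<partial>G)
      = ennreal (erlang_density j lam y) * erlang_mean lam i (\<lambda>x. cdf G (x + y) - cdf G y)"
      by (subst nn_integral_cmult) auto
  qed
  finally show ?thesis .
qed

text \<open>
  A bound for the residual services that is uniform in the age \<open>y\<close> passes to the conditional law of
  the remaining arrivals, since both sides are integrals over the same arrival epoch.
\<close>

lemma poisson_mixture_window_le: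
  assumes G0: "cdf G 0 = 0"
    and C: "\<And>y. 0 \<le> y \<Longrightarrow> erlang_mean lam i (\<lambda>x. cdf G (x + y) - cdf G y) \<le> C * ennreal (1 - cdf G y)"
  shows "emeasure (poisson_mixture lam G) {j..j + i} \<le> C * emeasure (poisson_mixture lam G) {j..}"
proof (cases j)
  case 0
  have "emeasure (poisson_mixture lam G) {j..j + i} = erlang_mean lam i (cdf G)"
    by (simp add: 0 emeasure_poisson_mixture_atMost[symmetric] atLeast0AtMost)
  with C[of 0] G0 0 show ?thesis
    by (simp add: atLeast_0 measure_pmf.emeasure_space_1[simplified])
next
  case (Suc k)
  have "emeasure (poisson_mixture lam G) {j..j + i}
      \<le> (\<integral>\<^sup>+y. C * (ennreal (erlang_density k lam y) * ennreal (1 - cdf G y)) \<partial>lborel)"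
    unfolding Suc poisson_mixture_Suc_window
  proof (intro nn_integral_mono)
    fix y :: real
    show "ennreal (erlang_density k lam y) * erlang_mean lam i (\<lambda>x. cdf G (x + y) - cdf G y)
       \<le> C * (ennreal (erlang_density k lam y) * ennreal (1 - cdf G y))"
      using mult_left_mono[OF C, of y "ennreal (erlang_density k lam y)"]
      by (cases "0 \<le> y") (auto simp: mult_ac erlang_density_def)
  qed
  also have "\<dots> = C * emeasure (poisson_mixture lam G) {j..}"
    unfolding Suc emeasure_poisson_mixture_atLeast_Suc by (rule nn_integral_cmult) simp
  finally show ?thesis .
qed

end

section \<open>A numerical inequality for the cut-off at three halves of the mean\<close>

text \<open>
  Four Taylor steps of length \<open>3/8\<close> suffice.
\<close>

lemma exp_neg_three_halves_le: "exp (- 3/2 :: real) \<le> 23/100"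
proof -
  have "(1 + 3/8 + (3/8)\<^sup>2 / 2 :: real) ^ 4 \<le> exp (3/8) ^ 4"
    by (intro power_mono exp_lower_Taylor_quadratic) auto
  also have "\<dots> = exp (3/2 :: real)" using exp_of_nat_mult[of 4 "3/8 :: real"] by simp
  finally have "100/23 \<le> exp (3/2 :: real)" by (simp add: power2_eq_square eval_nat_numeral)
  then show ?thesis by (simp add: exp_minus field_simps)
qed

lemma exp_neg_ge_quadratic:
  fixes x :: real
  assumes "x \<le> 2"
  shows "1 - x + x\<^sup>2 / 4 \<le> exp (- x)"
proof -
  have "1 - x / 2 \<le> exp (- x / 2)" using exp_ge_add_one_self[of "- x / 2"] by simp
  then have "(1 - x / 2)\<^sup>2 \<le> exp (- x / 2) ^ 2" using assms by (intro power_mono) auto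
  also have "\<dots> = exp (- x)" by (simp add: power2_eq_square mult_exp_exp)
  finally show ?thesis by (simp add: power2_eq_square algebra_simps)
qed

lemma exp_neg_le_quadratic:
  fixes x :: real
  assumes "0 \<le> x"
  shows "exp (- x) \<le> 1 - x + x\<^sup>2 / 2"
proof -
  have "(1 - x + x\<^sup>2 / 2) * (1 + x + x\<^sup>2 / 2) = 1 + (x\<^sup>2)\<^sup>2 / 4"
    by (simp add: power2_eq_square algebra_simps)
  then have "1 \<le> (1 - x + x\<^sup>2 / 2) * (1 + x + x\<^sup>2 / 2)" by simp
  also have "\<dots> \<le> (1 - x + x\<^sup>2 / 2) * exp x"
  proof (rule mult_left_mono)
    show "1 + x + x\<^sup>2 / 2 \<le> exp x" using assms by (rule exp_lower_Taylor_quadratic)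
    have *: "1 - x + x\<^sup>2 / 2 = ((1 - x)\<^sup>2 + 1) / 2" by (simp add: power2_eq_square field_simps)
    show "0 \<le> 1 - x + x\<^sup>2 / 2" unfolding * by simp
  qed
  finally show ?thesis by (simp add: exp_minus field_simps)
qed

text \<open>
  With \<open>x = 3/2 * lam / mu\<close> and \<open>q = exp (- x)\<close>, the deficit in \<open>transform_ratio_bound\<close> is at most \<open>d\<close> times
  \<open>(2 + (1 - q) mu / lam) / (1 - 23/100 q)\<close>, and this factor is at most \<open>4\<close> once \<open>lam / mu \<ge> 1/5\<close>.
  Both \<open>(1 - exp (- x)) / x\<close> and \<open>exp (- x)\<close> decrease, so their values at \<open>3/10\<close> decide.
\<close>

lemma cutoff_constant_large:
  fixes x :: real
  assumes x: "3/10 \<le> x"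
  shows "2 + 3/2 * ((1 - exp (- x)) / x) \<le> 4 * (1 - 23/100 * exp (- x))"
proof -
  define e where "e = exp (- 3/10 :: real)"
  have "(97/100) ^ 10 \<le> exp (- 3/100 :: real) ^ 10"
    using exp_ge_add_one_self[of "- 3/100 :: real"] by (intro power_mono) auto
  also have "\<dots> = e" using exp_of_nat_mult[of 10 "- 3/100 :: real"] by (simp add: e_def)
  finally have e1: "736/1000 \<le> e" by (simp add: eval_nat_numeral)
  have "13/10 \<le> exp (3/10 :: real)" using exp_ge_add_one_self[of "3/10 :: real"] by simp
  then have e2: "13/10 * e \<le> 1" by (simp add: e_def exp_minus field_simps)
  have e0: "0 < e" by (simp add: e_def)
  have ex: "exp (- x) = e * exp (- (x - 3/10))" by (simp add: e_def mult_exp_exp)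
  have "e * (1 - (x - 3/10)) \<le> exp (- x)"
    unfolding ex using e0 exp_ge_add_one_self[of "- (x - 3/10)"] by (intro mult_left_mono) auto
  then have "(1 - exp (- x)) / x \<le> (1 - e * (1 - (x - 3/10))) / x"
    using x by (intro divide_right_mono) auto
  also have "\<dots> = (1 - 13/10 * e) / x + e" using x by (simp add: field_simps)
  also have "(1 - 13/10 * e) / x \<le> (1 - 13/10 * e) / (3/10)"
    using x e2 by (intro divide_left_mono) auto
  finally have 1: "(1 - exp (- x)) / x \<le> (1 - 13/10 * e) / (3/10) + e" by simp
  have 2: "exp (- x) \<le> e" using x by (simp add: e_def)
  define y where "y = (1 - exp (- x)) / x"
  show ?thesis using 1 2 e1 unfolding y_def[symmetric] by argo
qed

text \<open>
  For \<open>lam / mu \<le> 1/5\<close> a factor \<open>1 + lam / mu\<close> can be afforded and the constant \<open>5\<close> is still not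
  reached.
\<close>

lemma cutoff_constant_small:
  fixes x :: real
  assumes x: "0 < x" "x \<le> 3/10"
  shows "(1 + 2/3 * x) * (2 + 3/2 * ((1 - exp (- x)) / x)) \<le> 5 * (1 - 23/100 * exp (- x))"
proof -
  have "1 - x + x\<^sup>2 / 4 \<le> exp (- x)" using x by (intro exp_neg_ge_quadratic) auto
  then have "(1 - exp (- x)) / x \<le> 1 - x / 4"
    using x by (subst pos_divide_le_eq) (auto simp: power2_eq_square algebra_simps)
  then have "(1 + 2/3 * x) * (2 + 3/2 * ((1 - exp (- x)) / x)) \<le> (1 + 2/3 * x) * (2 + 3/2 * (1 - x / 4))"
    using x by (intro mult_left_mono add_left_mono) auto
  also have "\<dots> = 7/2 + 47/24 * x - x\<^sup>2 / 4" by (simp add: power2_eq_square field_simps)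
  also have "\<dots> \<le> 5 * (1 - 23/100 * (1 - x + x\<^sup>2 / 2))"
  proof -
    have "x\<^sup>2 \<le> (3/10) * x" unfolding power2_eq_square using x by (intro mult_right_mono) auto
    then have "13/40 * x\<^sup>2 \<le> 39/400 * x" by simp
    moreover have "97/120 * x \<le> 97/400" "39/400 * x \<le> 3/100" using x by auto
    ultimately have "0 \<le> 35/100 - 97/120 * x - 13/40 * x\<^sup>2" by argo
    also have "\<dots> = 5 * (1 - 23/100 * (1 - x + x\<^sup>2 / 2)) - (7/2 + 47/24 * x - x\<^sup>2 / 4)"
      by (simp add: field_simps)
    finally show ?thesis by (simp only: diff_ge_0_iff_ge)
  qed
  also have "\<dots> \<le> 5 * (1 - 23/100 * exp (- x))"
    using exp_neg_le_quadratic[of x] x by simp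
  finally show ?thesis .
qed

text \<open>
  The elementary part of the cut-off argument.  Here \<open>q = exp (- lam h)\<close> for the cut-off \<open>h = 3 / (2 mu)\<close>,
  \<open>A\<close> is the transform of the tail \<open>H\<close> up to \<open>h\<close>, and \<open>Hh\<close> and \<open>th\<close> stand for \<open>H h\<close> and for the equilibrium
  tail at \<open>h\<close>.  The deficit \<open>w = 1 - (lam + mu) r\<close> satisfies
  \<open>w (1 - q exp (- 3/2)) \<le> d (2 + (1 - q) mu / lam)\<close>.
  For large \<open>lam / mu\<close> this gives \<open>w \<le> 4 d\<close>, to be combined with \<open>(lam + mu) R \<le> 1 + d\<close>; for
  small \<open>lam / mu\<close> it gives \<open>(1 + lam / mu) w \<le> 5 d\<close>, to be combined with
  \<open>(lam + mu) R \<le> 1 + w lam / mu\<close>.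
\<close>

lemma transform_ratio_bound:
  fixes lam mu d eps A R r th Hh q :: real
  assumes pos: "0 < lam" "0 < mu" and d: "0 \<le> d" "d < eps" "5 * eps < 1"
    and r: "0 \<le> r" "r \<le> R"
    and q: "q = exp (- (3/2 * (lam / mu)))"
    and 1: "lam * r + mu * R \<le> 1"
    and 2: "(lam + mu) * R \<le> 1 + d"
    and 3: "exp (3/2) * th \<le> 1 + d * (exp (3/2) - 1)"
    and 4: "1 \<le> (lam + mu) * A + d * (1 - q) + q * th"
    and 5: "A + q * r * Hh \<le> r + d * ((1 - q) / lam + q * r)" and th_Hh: "th \<le> Hh + d"
  shows "(1 - 5 * eps) * R < r" and "(1 - 5 * eps) / (lam + mu) < r"
proof -
  define l where "l = lam / mu"
  define x where "x = 3/2 * l"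
  define w where "w = 1 - (lam + mu) * r"
  have l: "0 < l" and x: "0 < x" using pos by (auto simp: l_def x_def)
  have q': "q = exp (- x)" by (simp add: q x_def l_def)
  have q01: "0 < q" "q < 1" using x by (auto simp: q')
  have "mu * r \<le> mu * R" using r pos by simp
  then have "(lam + mu) * r \<le> 1" using 1 by (simp add: algebra_simps)
  then have w: "0 \<le> w" by (simp add: w_def)
  define a where "a = exp (- 3/2 :: real)"
  have a: "0 < a" "a \<le> 23/100" using exp_neg_three_halves_le by (auto simp: a_def)
  have "a * exp (3/2) = 1" by (simp add: a_def mult_exp_exp)
  then have "th = a * (exp (3/2) * th)" by simp
  also have "\<dots> \<le> a * (1 + d * (exp (3/2) - 1))" using a 3 by (intro mult_left_mono) auto
  also have "\<dots> = a + d * (a * exp (3/2) - a)" by (simp add: algebra_simps)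
  also have "\<dots> \<le> a + d" using \<open>a * exp (3/2) = 1\<close> d a mult_left_mono[of "1 - a" 1 d] by simp
  finally have th_a: "th \<le> a + d" .
  have "q * r * (th - d) \<le> q * r * Hh" using th_Hh q01 r by (intro mult_left_mono) auto
  with 5 have cut5: "A + q * r * th \<le> r + d * ((1 - q) / lam + 2 * q * r)" by (simp add: algebra_simps)
  have "(lam + mu) * (A + q * r * th) \<le> (lam + mu) * (r + d * ((1 - q) / lam + 2 * q * r))"
    using cut5 pos by (intro mult_left_mono) auto
  then have "(lam + mu) * A + q * th * ((lam + mu) * r)
      \<le> (lam + mu) * r + d * ((lam + mu) * ((1 - q) / lam) + 2 * q * ((lam + mu) * r))"
    by (simp add: algebra_simps)
  also have "(lam + mu) * ((1 - q) / lam) = (1 - q) + (1 - q) / l"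
    using pos by (simp add: l_def field_simps)
  finally have ineq6: "(lam + mu) * A + q * th * (1 - w) \<le> (1 - w) + d * ((1 - q) + (1 - q) / l + 2 * q * (1 - w))"
    by (simp add: w_def)
  have 7: "w * (1 - q * th + 2 * q * d) \<le> d * (2 + (1 - q) / l)"
    using 4 ineq6 by (simp add: algebra_simps)
  have "q * th \<le> q * (23/100 + d)" using th_a a q01 by (intro mult_left_mono) auto
  then have "q * th \<le> 23/100 * q + d * q" by (simp add: algebra_simps)
  moreover have "2 * q * d = d * q + d * q" by simp
  moreover have "0 \<le> d * q" using d q01 by simp
  ultimately have "1 - 23/100 * q \<le> 1 - q * th + 2 * q * d" by (smt (verit))
  then have "w * (1 - 23/100 * q) \<le> w * (1 - q * th + 2 * q * d)"
    using w by (rule mult_left_mono)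
  with 7 have 8: "w * (1 - 23/100 * q) \<le> d * (2 + 3/2 * ((1 - q) / x))"
  proof -
    have "3/2 * ((1 - q) / x) = (1 - q) / l" using l by (simp add: x_def field_simps)
    with 7 \<open>w * (1 - 23/100 * q) \<le> w * (1 - q * th + 2 * q * d)\<close> show ?thesis by (simp only:)
  qed
  have qq: "0 < 1 - 23/100 * q" using q01 by simp
  have goals: "(1 - 5 * eps) * ((lam + mu) * R) < 1 - w \<and> 1 - 5 * eps < 1 - w"
  proof (cases "3/10 \<le> x")
    case True
    have "w * (1 - 23/100 * q) \<le> d * (4 * (1 - 23/100 * q))"
      using 8 mult_left_mono[OF cutoff_constant_large[OF True] d(1)] by (simp add: q')
    also have "\<dots> = 4 * d * (1 - 23/100 * q)" by (simp only: mult.assoc mult.left_commute)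
    finally have w4: "w \<le> 4 * d" using qq by (rule mult_right_le_imp_le)
    have "(1 - 5 * eps) * ((lam + mu) * R) \<le> (1 - 5 * eps) * (1 + d)"
      using 2 d by (intro mult_left_mono) auto
    also have "\<dots> < (1 - 5 * d) * (1 + d)"
      using d by (intro mult_strict_right_mono) auto
    also have "\<dots> \<le> 1 - 4 * d" using d by (simp add: algebra_simps)
    finally show ?thesis using w4 d by auto
  next
    case False
    have "(1 + l) * (w * (1 - 23/100 * q)) \<le> (1 + l) * (d * (2 + 3/2 * ((1 - q) / x)))"
      using 8 l by (intro mult_left_mono) auto
    also have "\<dots> = d * ((1 + 2/3 * x) * (2 + 3/2 * ((1 - exp (- x)) / x)))"
      by (simp add: x_def q' mult_ac)
    also have "\<dots> \<le> d * (5 * (1 - 23/100 * q))"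
      using False d x unfolding q' by (intro mult_left_mono cutoff_constant_small) auto
    finally have "((1 + l) * w) * (1 - 23/100 * q) \<le> (5 * d) * (1 - 23/100 * q)"
      by (simp only: mult.assoc mult.left_commute)
    then have w5: "(1 + l) * w \<le> 5 * d" using qq by (rule mult_right_le_imp_le)
    have "(lam + mu) / mu * (lam * r + mu * R) \<le> (lam + mu) / mu * 1"
      using 1 pos by (intro mult_left_mono) auto
    then have "l * ((lam + mu) * r) + (lam + mu) * R \<le> 1 + l"
      using pos by (simp add: l_def field_simps)
    then have P: "(lam + mu) * R \<le> 1 + l * w" by (simp add: w_def algebra_simps)
    have lw: "0 \<le> l * w" using l w by simp
    have "(1 - 5 * eps) * ((lam + mu) * R) \<le> (1 - 5 * eps) * (1 + l * w)"
      using P d by (intro mult_left_mono) auto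
    also have "\<dots> < (1 - 5 * d) * (1 + l * w)"
      using d lw by (intro mult_strict_right_mono) auto
    also have "\<dots> \<le> 1 + l * w - 5 * d" using d lw mult_nonneg_nonneg[of d "l * w"] by (simp add: algebra_simps)
    also have "\<dots> \<le> 1 - w" using w5 by (simp add: algebra_simps)
    finally have "(1 - 5 * eps) * ((lam + mu) * R) < 1 - w" .
    moreover have "1 - 5 * eps < 1 - w" using w5 d lw by (simp add: algebra_simps)
    ultimately show ?thesis by simp
  qed
  have s: "0 < lam + mu" using pos by simp
  have "(lam + mu) * ((1 - 5 * eps) * R) < (lam + mu) * r"
    using goals by (simp add: w_def algebra_simps)
  then show "(1 - 5 * eps) * R < r" using s by (simp only: mult_less_cancel_left_pos)
  show "(1 - 5 * eps) / (lam + mu) < r"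
    using goals s by (simp add: w_def divide_less_eq mult.commute)
qed

section \<open>Transforms of a nearly memoryless tail\<close>

definition laplace_tail :: "(real \<Rightarrow> real) \<Rightarrow> real \<Rightarrow> real \<Rightarrow> ennreal" where
  "laplace_tail H lam y =
     (\<integral>\<^sup>+x. ennreal (exp (- lam * x)) * (ennreal (H (x + y)) * indicator {0..} x) \<partial>lborel)"

definition laplace_upto :: "(real \<Rightarrow> real) \<Rightarrow> real \<Rightarrow> real \<Rightarrow> ennreal" where
  "laplace_upto H lam h =
     (\<integral>\<^sup>+x. ennreal (exp (- lam * x)) * (ennreal (H x) * indicator {0..<h} x) \<partial>lborel)"

text \<open>
  For a tail \<open>H\<close> with mean \<open>1 / mu\<close>, the tail of the stationary residual life.
\<close>

definition equilibrium_tail :: "(real \<Rightarrow> real) \<Rightarrow> real \<Rightarrow> real \<Rightarrow> ennreal" where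
  "equilibrium_tail H mu x = ennreal mu * (\<integral>\<^sup>+u. ennreal (H u) * indicator {x..} u \<partial>lborel)"

context
  fixes H :: "real \<Rightarrow> real" and lam mu d r :: real
  assumes lam: "0 < lam" and mu: "0 < mu" and d: "0 \<le> d" and r: "0 \<le> r"
    and H_borel [measurable]: "H \<in> borel_measurable borel"
    and H_nonneg: "\<And>x. 0 \<le> x \<Longrightarrow> 0 \<le> H x"
    and H_mean: "(\<integral>\<^sup>+x. ennreal (H x) * indicator {0..} x \<partial>lborel) = ennreal (1 / mu)"
    and H_mult: "\<And>x y. 0 \<le> x \<Longrightarrow> 0 \<le> y \<Longrightarrow> \<bar>H (x + y) - H x * H y\<bar> \<le> d * H y"
begin

lemma shift_integral:
  fixes f :: "real \<Rightarrow> ennreal"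
  assumes [measurable]: "f \<in> borel_measurable borel"
  shows "(\<integral>\<^sup>+u. f u * indicator {x..} u \<partial>lborel) = (\<integral>\<^sup>+y. f (y + x) * indicator {0..} y \<partial>lborel)"
  by (subst nn_integral_real_affine[where t=x and c=1])
     (auto intro!: nn_integral_cong simp: indicator_def add.commute)

lemma H_mult_le:
  assumes "0 \<le> x" "0 \<le> y"
  shows "ennreal (H (x + y)) \<le> ennreal (H x + d) * ennreal (H y)"
    and "ennreal (H x) * ennreal (H y) \<le> ennreal (H (x + y)) + ennreal d * ennreal (H y)"
  using H_mult[OF assms] H_nonneg[OF assms(1)] H_nonneg[OF assms(2)] H_nonneg[of "x + y"] assms d
  by (auto simp: ennreal_mult[symmetric] ennreal_plus[symmetric] algebra_simps abs_le_iff
      simp del: ennreal_plus intro!: ennreal_leI)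

lemma scaled_mean: "ennreal mu * (\<integral>\<^sup>+x. ennreal (H x) * indicator {0..} x \<partial>lborel) = 1"
  using mu by (simp add: H_mean ennreal_mult[symmetric])

lemma scaled_mean_left:
  "ennreal mu * (c * (\<integral>\<^sup>+x. ennreal (H x) * indicator {0..} x \<partial>lborel)) = c"
  by (metis scaled_mean mult.left_commute mult.right_neutral)

text \<open>
  The equilibrium tail is the average of the residual tails \<open>H (x + y) / H y\<close> with weight
  \<open>mu * H y\<close>, and each of them is within \<open>d\<close> of \<open>H x\<close>.
\<close>

lemma equilibrium_tail_le:
  assumes "0 \<le> x"
  shows "equilibrium_tail H mu x \<le> ennreal (H x + d)" and "ennreal (H x) \<le> equilibrium_tail H mu x + ennreal d"
proof -
  have t: "equilibrium_tail H mu x = ennreal mu * (\<integral>\<^sup>+y. ennreal (H (x + y)) * indicator {0..} y \<partial>lborel)"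
    unfolding equilibrium_tail_def by (subst shift_integral) (auto simp: add.commute)
  have "equilibrium_tail H mu x \<le> ennreal mu * (\<integral>\<^sup>+y. ennreal (H x + d) * (ennreal (H y) * indicator {0..} y) \<partial>lborel)"
    unfolding t using H_mult_le(1)[OF assms]
    by (intro mult_left_mono nn_integral_mono) (auto simp: indicator_def)
  also have "\<dots> = ennreal (H x + d)"
    by (subst nn_integral_cmult) (auto simp: scaled_mean_left)
  finally show "equilibrium_tail H mu x \<le> ennreal (H x + d)" .
  have "ennreal (H x) = ennreal mu * (\<integral>\<^sup>+y. ennreal (H x) * (ennreal (H y) * indicator {0..} y) \<partial>lborel)"
    by (subst nn_integral_cmult) (auto simp: scaled_mean_left)
  also have "\<dots> \<le> ennreal mu * (\<integral>\<^sup>+y. ennreal (H (x + y)) * indicator {0..} y + ennreal d * (ennreal (H y) * indicator {0..} y) \<partial>lborel)"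
    using H_mult_le(2)[OF assms]
    by (intro mult_left_mono nn_integral_mono) (auto simp: indicator_def)
  also have "\<dots> = equilibrium_tail H mu x + ennreal d"
    by (subst nn_integral_add) (auto simp: nn_integral_cmult distrib_left t scaled_mean_left)
  finally show "ennreal (H x) \<le> equilibrium_tail H mu x + ennreal d" .
qed

text \<open>
  Integration by parts, obtained from Tonelli so that jumps of \<open>H\<close> do no harm.
\<close>

lemma integral_equilibrium_tail:
  fixes v V :: "real \<Rightarrow> real"
  assumes v [measurable]: "v \<in> borel_measurable borel"
    and V: "\<And>u. 0 \<le> u \<Longrightarrow> (\<integral>\<^sup>+x. ennreal (v x) * indicator {0..u} x \<partial>lborel) = ennreal (V u)"
  shows "(\<integral>\<^sup>+x. ennreal (v x) * (equilibrium_tail H mu x * indicator {0..} x) \<partial>lborel)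
    = ennreal mu * (\<integral>\<^sup>+u. ennreal (V u) * (ennreal (H u) * indicator {0..} u) \<partial>lborel)"
proof -
  have "(\<integral>\<^sup>+x. ennreal (v x) * (equilibrium_tail H mu x * indicator {0..} x) \<partial>lborel)
      = (\<integral>\<^sup>+x. (\<integral>\<^sup>+u. ennreal mu * (ennreal (v x) * (ennreal (H u) * indicator {(x, u). 0 \<le> x \<and> x \<le> u} (x, u))) \<partial>lborel) \<partial>lborel)"
  proof (rule nn_integral_cong)
    fix x :: real
    have "(\<integral>\<^sup>+u. ennreal mu * (ennreal (v x) * (ennreal (H u) * indicator {(x, u). 0 \<le> x \<and> x \<le> u} (x, u))) \<partial>lborel)
        = (\<integral>\<^sup>+u. (ennreal mu * ennreal (v x) * indicator {0..} x) * (ennreal (H u) * indicator {x..} u) \<partial>lborel)"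
      by (intro nn_integral_cong) (auto simp: indicator_def mult_ac)
    also have "\<dots> = (ennreal mu * ennreal (v x) * indicator {0..} x) * (\<integral>\<^sup>+u. ennreal (H u) * indicator {x..} u \<partial>lborel)"
      by (rule nn_integral_cmult) measurable
    finally show "ennreal (v x) * (equilibrium_tail H mu x * indicator {0..} x)
        = (\<integral>\<^sup>+u. ennreal mu * (ennreal (v x) * (ennreal (H u) * indicator {(x, u). 0 \<le> x \<and> x \<le> u} (x, u))) \<partial>lborel)"
      by (simp add: equilibrium_tail_def mult_ac)
  qed
  also have "\<dots> = (\<integral>\<^sup>+u. (\<integral>\<^sup>+x. ennreal mu * (ennreal (v x) * (ennreal (H u) * indicator {(x, u). 0 \<le> x \<and> x \<le> u} (x, u))) \<partial>lborel) \<partial>lborel)"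
    by (rule lborel_pair.Fubini'[symmetric]) measurable
  also have "\<dots> = (\<integral>\<^sup>+u. ennreal mu * (ennreal (V u) * (ennreal (H u) * indicator {0..} u)) \<partial>lborel)"
  proof (rule nn_integral_cong)
    fix u :: real
    have "(\<integral>\<^sup>+x. ennreal mu * (ennreal (v x) * (ennreal (H u) * indicator {(x, u). 0 \<le> x \<and> x \<le> u} (x, u))) \<partial>lborel)
        = (\<integral>\<^sup>+x. (ennreal mu * (ennreal (H u) * indicator {0..} u)) * (ennreal (v x) * indicator {0..u} x) \<partial>lborel)"
      by (intro nn_integral_cong) (auto simp: indicator_def mult_ac)
    also have "\<dots> = (ennreal mu * (ennreal (H u) * indicator {0..} u)) * (\<integral>\<^sup>+x. ennreal (v x) * indicator {0..u} x \<partial>lborel)"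
      by (rule nn_integral_cmult) measurable
    finally show "(\<integral>\<^sup>+x. ennreal mu * (ennreal (v x) * (ennreal (H u) * indicator {(x, u). 0 \<le> x \<and> x \<le> u} (x, u))) \<partial>lborel)
       = ennreal mu * (ennreal (V u) * (ennreal (H u) * indicator {0..} u))"
      using V[of u] by (cases "0 \<le> u") (auto simp: mult_ac)
  qed
  also have "\<dots> = ennreal mu * (\<integral>\<^sup>+u. ennreal (V u) * (ennreal (H u) * indicator {0..} u) \<partial>lborel)"
  proof (rule nn_integral_cmult)
    have "(\<lambda>u. (\<integral>\<^sup>+x. ennreal (v x) * indicator {(u, x). 0 \<le> x \<and> x \<le> u} (u, x) \<partial>lborel)) \<in> borel_measurable borel"
      by measurable
    then have [measurable]: "(\<lambda>u. (\<integral>\<^sup>+x. ennreal (v x) * indicator {(u, x). 0 \<le> x \<and> x \<le> u} (u, x) \<partial>lborel)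
        * (ennreal (H u) * indicator {0..} u)) \<in> borel_measurable borel"
      by measurable
    have eq: "(\<lambda>u. ennreal (V u) * (ennreal (H u) * indicator {0..} u)) = (\<lambda>u. (\<integral>\<^sup>+x. ennreal (v x) * indicator {(u, x). 0 \<le> x \<and> x \<le> u} (u, x) \<partial>lborel)
        * (ennreal (H u) * indicator {0..} u))"
    proof
      fix u :: real
      have "(\<integral>\<^sup>+x. ennreal (v x) * indicator {(u, x). 0 \<le> x \<and> x \<le> u} (u, x) \<partial>lborel)
          = (\<integral>\<^sup>+x. ennreal (v x) * indicator {0..u} x \<partial>lborel)"
        by (intro nn_integral_cong) (auto simp: indicator_def)
      then show "ennreal (V u) * (ennreal (H u) * indicator {0..} u) = (\<integral>\<^sup>+x. ennreal (v x) * indicator {(u, x). 0 \<le> x \<and> x \<le> u} (u, x) \<partial>lborel)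
        * (ennreal (H u) * indicator {0..} u)"
        using V[of u] by (cases "0 \<le> u") auto
    qed
    show "(\<lambda>u. ennreal (V u) * (ennreal (H u) * indicator {0..} u)) \<in> borel_measurable lborel"
      unfolding eq by simp
  qed
  finally show ?thesis .
qed

lemma integral_exp_upto:
  assumes "c \<noteq> 0" "0 \<le> u"
  shows "(\<integral>\<^sup>+x. ennreal (\<bar>c\<bar> * exp (c * x)) * indicator {0..u} x \<partial>lborel) = ennreal (\<bar>exp (c * u) - 1\<bar>)"
proof -
  have "(\<integral>\<^sup>+x. ennreal (\<bar>c\<bar> * exp (c * x)) * indicator {0..u} x \<partial>lborel)
      = ennreal (sgn c * exp (c * u) - sgn c * exp (c * 0))"
    using assms
    by (intro nn_integral_FTC_Icc) (auto intro!: derivative_eq_intros simp: sgn_if split: if_splits)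
  also have "sgn c * exp (c * u) - sgn c * exp (c * 0) = \<bar>exp (c * u) - 1\<bar>"
    using assms by (cases "c > 0") (auto simp: sgn_if mult_nonpos_nonneg)
  finally show ?thesis .
qed

lemma integral_exp_upto_min:
  assumes "c \<noteq> 0" "0 \<le> u" "0 \<le> h"
  shows "(\<integral>\<^sup>+x. ennreal (\<bar>c\<bar> * exp (c * x) * indicator {0..h} x) * indicator {0..u} x \<partial>lborel)
    = ennreal (\<bar>exp (c * min u h) - 1\<bar>)"
proof -
  have "(\<integral>\<^sup>+x. ennreal (\<bar>c\<bar> * exp (c * x) * indicator {0..h} x) * indicator {0..u} x \<partial>lborel)
      = (\<integral>\<^sup>+x. ennreal (\<bar>c\<bar> * exp (c * x)) * indicator {0..min u h} x \<partial>lborel)"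
    by (intro nn_integral_cong) (auto simp: indicator_def)
  then show ?thesis using integral_exp_upto[of c "min u h"] assms by simp
qed

lemma laplace_tail_0: "laplace_tail H lam 0 = (\<integral>\<^sup>+x. ennreal (exp (- lam * x)) * (ennreal (H x) * indicator {0..} x) \<partial>lborel)"
  by (simp add: laplace_tail_def)

lemma borel_measurable_equilibrium_tail [measurable]: "equilibrium_tail H mu \<in> borel_measurable borel"
proof -
  have "(\<lambda>x. ennreal mu * (\<integral>\<^sup>+u. ennreal (H u) * indicator {(x, u). x \<le> u} (x, u) \<partial>lborel)) \<in> borel_measurable borel"
    by measurable
  also have "(\<lambda>x. ennreal mu * (\<integral>\<^sup>+u. ennreal (H u) * indicator {(x, u). x \<le> u} (x, u) \<partial>lborel)) = equilibrium_tail H mu"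
    by (auto simp: equilibrium_tail_def fun_eq_iff indicator_def intro!: nn_integral_cong arg_cong2[where f="(*)"])
  finally show ?thesis .
qed

lemma equilibrium_tail_laplace:
  "(\<integral>\<^sup>+x. ennreal (lam * exp (- lam * x)) * (equilibrium_tail H mu x * indicator {0..} x) \<partial>lborel)
    + ennreal mu * laplace_tail H lam 0 = 1"
proof -
  have I: "(\<integral>\<^sup>+x. ennreal (lam * exp (- lam * x)) * (equilibrium_tail H mu x * indicator {0..} x) \<partial>lborel)
    = ennreal mu * (\<integral>\<^sup>+u. ennreal \<bar>exp (- lam * u) - 1\<bar> * (ennreal (H u) * indicator {0..} u) \<partial>lborel)"
    using integral_exp_upto[of "- lam"] lam
    by (intro integral_equilibrium_tail[where V="\<lambda>u. \<bar>exp (- lam * u) - 1\<bar>"]) auto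
  have "(\<integral>\<^sup>+u. ennreal \<bar>exp (- lam * u) - 1\<bar> * (ennreal (H u) * indicator {0..} u) \<partial>lborel) + laplace_tail H lam 0
    = (\<integral>\<^sup>+u. (ennreal \<bar>exp (- lam * u) - 1\<bar> * (ennreal (H u) * indicator {0..} u) +
        ennreal (exp (- lam * u)) * (ennreal (H u) * indicator {0..} u)) \<partial>lborel)"
    unfolding laplace_tail_0 by (rule nn_integral_add[symmetric]) auto
  also have "\<dots> = (\<integral>\<^sup>+u. ennreal (H u) * indicator {0..} u \<partial>lborel)"
  proof (intro nn_integral_cong)
    fix u :: real
    show "ennreal \<bar>exp (- lam * u) - 1\<bar> * (ennreal (H u) * indicator {0..} u) +
        ennreal (exp (- lam * u)) * (ennreal (H u) * indicator {0..} u) = ennreal (H u) * indicator {0..} u"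
    proof (cases "0 \<le> u")
      case True
      then have "exp (- lam * u) \<le> 1" using mult_nonneg_nonneg[of lam u] lam by simp
      then have "ennreal \<bar>exp (- lam * u) - 1\<bar> + ennreal (exp (- lam * u)) = 1"
        by (simp add: ennreal_plus[symmetric] del: ennreal_plus)
      then show ?thesis by (metis distrib_right mult_1)
    qed simp
  qed
  finally show ?thesis
    unfolding I distrib_left[symmetric] by (simp add: scaled_mean)
qed

text \<open>
  Integrated against \<open>mu * H y\<close>, the lower bound \<open>r\<close> for the residual transforms becomes a lower bound
  for the transform of the equilibrium tail, which is \<open>(1 - mu * R) / lam\<close>.
\<close>

lemma minimum_le_transforms:
  assumes min: "\<And>y. 0 \<le> y \<Longrightarrow> ennreal (r * H y) \<le> laplace_tail H lam y"
  shows "ennreal (lam * r) + ennreal mu * laplace_tail H lam 0 \<le> 1"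
proof -
  have "ennreal r = ennreal mu * (\<integral>\<^sup>+y. ennreal r * (ennreal (H y) * indicator {0..} y) \<partial>lborel)"
    by (subst nn_integral_cmult) (auto simp: scaled_mean_left)
  also have "\<dots> \<le> ennreal mu * (\<integral>\<^sup>+y. laplace_tail H lam y * indicator {0..} y \<partial>lborel)"
    using min r H_nonneg
    by (intro mult_left_mono nn_integral_mono) (auto simp: indicator_def ennreal_mult[symmetric])
  also have "(\<integral>\<^sup>+y. laplace_tail H lam y * indicator {0..} y \<partial>lborel)
    = (\<integral>\<^sup>+y. (\<integral>\<^sup>+x. ennreal (exp (- lam * x)) * (ennreal (H (x + y)) * indicator {0..} x) * indicator {0..} y \<partial>lborel) \<partial>lborel)"
    unfolding laplace_tail_def by (intro nn_integral_cong nn_integral_multc[symmetric]) auto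
  also have "\<dots> = (\<integral>\<^sup>+x. (\<integral>\<^sup>+y. ennreal (exp (- lam * x)) * (ennreal (H (x + y)) * indicator {0..} x) * indicator {0..} y \<partial>lborel) \<partial>lborel)"
    by (rule lborel_pair.Fubini') measurable
  also have "\<dots> = (\<integral>\<^sup>+x. ennreal (exp (- lam * x)) * ((\<integral>\<^sup>+y. ennreal (H (y + x)) * indicator {0..} y \<partial>lborel) * indicator {0..} x) \<partial>lborel)"
  proof (rule nn_integral_cong)
    fix x
    have "(\<integral>\<^sup>+y. ennreal (exp (- lam * x)) * (ennreal (H (x + y)) * indicator {0..} x) * indicator {0..} y \<partial>lborel)
      = (\<integral>\<^sup>+y. (ennreal (exp (- lam * x)) * indicator {0..} x) * (ennreal (H (y + x)) * indicator {0..} y) \<partial>lborel)"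
      by (intro nn_integral_cong) (simp add: mult_ac add.commute)
    also have "\<dots> = (ennreal (exp (- lam * x)) * indicator {0..} x) * (\<integral>\<^sup>+y. ennreal (H (y + x)) * indicator {0..} y \<partial>lborel)"
      by (rule nn_integral_cmult) simp
    also have "\<dots> = ennreal (exp (- lam * x)) * ((\<integral>\<^sup>+y. ennreal (H (y + x)) * indicator {0..} y \<partial>lborel) * indicator {0..} x)"
      by (simp only: mult.assoc mult.commute[of "indicator {0..} x"])
    finally show "(\<integral>\<^sup>+y. ennreal (exp (- lam * x)) * (ennreal (H (x + y)) * indicator {0..} x) * indicator {0..} y \<partial>lborel)
      = ennreal (exp (- lam * x)) * ((\<integral>\<^sup>+y. ennreal (H (y + x)) * indicator {0..} y \<partial>lborel) * indicator {0..} x)" .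
  qed
  finally have "ennreal r \<le> ennreal mu * \<dots>" .
  also have "\<dots> = (\<integral>\<^sup>+x. ennreal (exp (- lam * x)) * (equilibrium_tail H mu x * indicator {0..} x) \<partial>lborel)"
    unfolding equilibrium_tail_def shift_integral[of "\<lambda>u. ennreal (H u)", simplified]
    by (subst nn_integral_cmult[symmetric]) (auto simp: mult_ac)
  finally have "ennreal lam * ennreal r \<le> ennreal lam * (\<integral>\<^sup>+x. ennreal (exp (- lam * x)) * (equilibrium_tail H mu x * indicator {0..} x) \<partial>lborel)"
    by (rule mult_left_mono) simp
  also have "\<dots> = (\<integral>\<^sup>+x. ennreal (lam * exp (- lam * x)) * (equilibrium_tail H mu x * indicator {0..} x) \<partial>lborel)"
    using lam by (subst nn_integral_cmult[symmetric]) (auto simp: ennreal_mult mult_ac)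
  finally have "ennreal (lam * r) \<le> (\<integral>\<^sup>+x. ennreal (lam * exp (- lam * x)) * (equilibrium_tail H mu x * indicator {0..} x) \<partial>lborel)"
    using lam r by (simp add: ennreal_mult)
  from add_right_mono[OF this, of "ennreal mu * laplace_tail H lam 0"] show ?thesis
    unfolding equilibrium_tail_laplace .
qed

lemma integral_exp_density_pos: "(\<integral>\<^sup>+x. ennreal (lam * exp (- lam * x)) * indicator {0..} x \<partial>lborel) = 1"
proof -
  have "(\<integral>\<^sup>+x. ennreal (lam * exp (- lam * x)) * indicator {0..} x \<partial>lborel)
      = (\<integral>\<^sup>+x. ennreal (exponential_density lam x) \<partial>lborel)"
    by (intro nn_integral_cong) (auto simp: exponential_density_def indicator_def mult.commute)
  also have "\<dots> = 1"
    using prob_space.emeasure_space_1[OF prob_space_exponential_density[OF lam]]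
    by (simp add: emeasure_density)
  finally show ?thesis .
qed

text \<open>
  The same transform, now bounded below by that of \<open>H\<close> itself up to the error \<open>d\<close>.
\<close>

lemma transform_le_near_memoryless: "ennreal lam * laplace_tail H lam 0 + ennreal mu * laplace_tail H lam 0 \<le> 1 + ennreal d"
proof -
  have "ennreal lam * laplace_tail H lam 0 = (\<integral>\<^sup>+x. ennreal (lam * exp (- lam * x)) * (ennreal (H x) * indicator {0..} x) \<partial>lborel)"
    using lam unfolding laplace_tail_0 by (subst nn_integral_cmult[symmetric]) (auto simp: ennreal_mult mult_ac)
  also have "\<dots> \<le> (\<integral>\<^sup>+x. ennreal (lam * exp (- lam * x)) * (equilibrium_tail H mu x * indicator {0..} x)
      + ennreal d * (ennreal (lam * exp (- lam * x)) * indicator {0..} x) \<partial>lborel)"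
  proof (rule nn_integral_mono)
    fix x
    show "ennreal (lam * exp (- lam * x)) * (ennreal (H x) * indicator {0..} x)
      \<le> ennreal (lam * exp (- lam * x)) * (equilibrium_tail H mu x * indicator {0..} x)
      + ennreal d * (ennreal (lam * exp (- lam * x)) * indicator {0..} x)"
      using mult_left_mono[OF equilibrium_tail_le(2)[of x], of "ennreal (lam * exp (- lam * x))"]
      by (cases "0 \<le> x") (auto simp: distrib_left distrib_right mult.commute)
  qed
  also have "\<dots> = (\<integral>\<^sup>+x. ennreal (lam * exp (- lam * x)) * (equilibrium_tail H mu x * indicator {0..} x) \<partial>lborel) + ennreal d"
    using integral_exp_density_pos by (subst nn_integral_add) (auto simp: nn_integral_cmult)
  finally have "ennreal lam * laplace_tail H lam 0 + ennreal mu * laplace_tail H lam 0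
      \<le> ((\<integral>\<^sup>+x. ennreal (lam * exp (- lam * x)) * (equilibrium_tail H mu x * indicator {0..} x) \<partial>lborel) + ennreal d)
        + ennreal mu * laplace_tail H lam 0"
    by (rule add_right_mono)
  also have "\<dots> = 1 + ennreal d"
    using equilibrium_tail_laplace by (simp add: add_ac)
  finally show ?thesis .
qed

lemma integral_stopped_split:
  assumes [measurable]: "g \<in> borel_measurable borel" and h: "0 \<le> h" 
  shows "(\<integral>\<^sup>+u. ennreal (g (min u h)) * (ennreal (H u) * indicator {0..} u) \<partial>lborel)
    = (\<integral>\<^sup>+u. ennreal (g u) * (ennreal (H u) * indicator {0..<h} u) \<partial>lborel)
      + ennreal (g h) * (\<integral>\<^sup>+u. ennreal (H u) * indicator {h..} u \<partial>lborel)"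
proof -
  have "(\<integral>\<^sup>+u. ennreal (g (min u h)) * (ennreal (H u) * indicator {0..} u) \<partial>lborel)
    = (\<integral>\<^sup>+u. ennreal (g u) * (ennreal (H u) * indicator {0..<h} u) + ennreal (g h) * (ennreal (H u) * indicator {h..} u) \<partial>lborel)"
    using h by (intro nn_integral_cong) (auto simp: indicator_def min_def)
  then show ?thesis by (simp add: nn_integral_add nn_integral_cmult)
qed

text \<open>
  For \<open>c = - lam\<close> and \<open>c = mu\<close>, comparison with \<open>equilibrium_tail_weighted_eq\<close> yields the two bounds at
  the cut-off below.
\<close>

lemma equilibrium_tail_weighted_le:
  assumes c: "c \<noteq> 0" and h: "0 \<le> h"
  shows "(\<integral>\<^sup>+x. ennreal (\<bar>c\<bar> * exp (c * x) * indicator {0..h} x) * (equilibrium_tail H mu x * indicator {0..} x) \<partial>lborel)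
    \<le> ennreal \<bar>c\<bar> * (\<integral>\<^sup>+x. ennreal (exp (c * x)) * (ennreal (H x) * indicator {0..<h} x) \<partial>lborel)
      + ennreal d * ennreal \<bar>exp (c * h) - 1\<bar>" (is "?L \<le> _")
proof -
  have "?L \<le> (\<integral>\<^sup>+x. ennreal \<bar>c\<bar> * (ennreal (exp (c * x)) * (ennreal (H x) * indicator {0..<h} x))
      + ennreal d * (ennreal (\<bar>c\<bar> * exp (c * x)) * indicator {0..h} x) \<partial>lborel)"
  proof (rule nn_integral_mono_AE, rule AE_mp[OF AE_lborel_singleton[of h]], intro AE_I2 impI)
    fix x assume "x \<noteq> h"
    show "ennreal (\<bar>c\<bar> * exp (c * x) * indicator {0..h} x) * (equilibrium_tail H mu x * indicator {0..} x)
      \<le> ennreal \<bar>c\<bar> * (ennreal (exp (c * x)) * (ennreal (H x) * indicator {0..<h} x))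
      + ennreal d * (ennreal (\<bar>c\<bar> * exp (c * x)) * indicator {0..h} x)"
    proof (cases "0 \<le> x \<and> x < h")
      case True
      have "ennreal (\<bar>c\<bar> * exp (c * x)) * equilibrium_tail H mu x \<le> ennreal (\<bar>c\<bar> * exp (c * x)) * ennreal (H x + d)"
        using equilibrium_tail_le(1) True by (intro mult_left_mono) auto
      also have "\<dots> = ennreal \<bar>c\<bar> * (ennreal (exp (c * x)) * ennreal (H x)) + ennreal d * ennreal (\<bar>c\<bar> * exp (c * x))"
        using H_nonneg[of x] d True by (simp add: ennreal_mult distrib_left mult_ac)
      finally show ?thesis using True by simp
    next
      case False
      then show ?thesis using \<open>x \<noteq> h\<close> by (auto simp: indicator_def)
    qed
  qed
  also have "\<dots> = ennreal \<bar>c\<bar> * (\<integral>\<^sup>+x. ennreal (exp (c * x)) * (ennreal (H x) * indicator {0..<h} x) \<partial>lborel)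
      + ennreal d * ennreal \<bar>exp (c * h) - 1\<bar>"
    using integral_exp_upto[OF c h] by (simp add: nn_integral_add nn_integral_cmult)
  finally show ?thesis .
qed

lemma equilibrium_tail_weighted_eq:
  assumes c: "c \<noteq> 0" and h: "0 \<le> h"
  shows "(\<integral>\<^sup>+x. ennreal (\<bar>c\<bar> * exp (c * x) * indicator {0..h} x) * (equilibrium_tail H mu x * indicator {0..} x) \<partial>lborel)
    = ennreal mu * (\<integral>\<^sup>+u. ennreal \<bar>exp (c * min u h) - 1\<bar> * (ennreal (H u) * indicator {0..} u) \<partial>lborel)"
  using integral_exp_upto_min[OF c _ h]
  by (intro integral_equilibrium_tail[where V="\<lambda>u. \<bar>exp (c * min u h) - 1\<bar>"]) auto

text \<open>
  Integrating \<open>mu * H\<close> against \<open>exp (- lam min u h)\<close> and against its complement, the latter by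
  parts, bounds the part of the transform of \<open>H\<close> before \<open>h\<close> from below.
\<close>

lemma laplace_upto_bound:
  assumes h: "0 \<le> h"
  shows "1 \<le> ennreal (lam + mu) * laplace_upto H lam h + ennreal d * ennreal (1 - exp (- lam * h))
    + ennreal (exp (- lam * h)) * equilibrium_tail H mu h"
proof -
  let ?V = "\<integral>\<^sup>+u. ennreal \<bar>exp (- lam * min u h) - 1\<bar> * (ennreal (H u) * indicator {0..} u) \<partial>lborel"
  let ?W = "\<integral>\<^sup>+u. ennreal (exp (- lam * min u h)) * (ennreal (H u) * indicator {0..} u) \<partial>lborel"
  have abs1: "\<bar>exp (- lam * h) - 1\<bar> = 1 - exp (- lam * h)" if "0 \<le> h" for h
  proof -
    have "exp (- lam * h) \<le> 1" using mult_nonneg_nonneg[of lam h] lam that by simp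
    then show ?thesis by simp
  qed
  have "?V + ?W = (\<integral>\<^sup>+u. ennreal \<bar>exp (- lam * min u h) - 1\<bar> * (ennreal (H u) * indicator {0..} u)
      + ennreal (exp (- lam * min u h)) * (ennreal (H u) * indicator {0..} u) \<partial>lborel)"
    by (rule nn_integral_add[symmetric]) auto
  also have "\<dots> = (\<integral>\<^sup>+u. ennreal (H u) * indicator {0..} u \<partial>lborel)"
  proof (rule nn_integral_cong)
    fix u :: real
    show "ennreal \<bar>exp (- lam * min u h) - 1\<bar> * (ennreal (H u) * indicator {0..} u)
      + ennreal (exp (- lam * min u h)) * (ennreal (H u) * indicator {0..} u) = ennreal (H u) * indicator {0..} u"
    proof (cases "0 \<le> u")
      case True
      then have "exp (- lam * min u h) \<le> 1" using mult_nonneg_nonneg[of lam "min u h"] lam h by simp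
      then have "ennreal \<bar>exp (- lam * min u h) - 1\<bar> + ennreal (exp (- lam * min u h)) = 1"
        by (simp add: ennreal_plus[symmetric] del: ennreal_plus)
      then show ?thesis by (metis distrib_right mult_1)
    qed simp
  qed
  finally have "1 = ennreal mu * ?V + ennreal mu * ?W"
    using scaled_mean by (simp add: distrib_left[symmetric])
  also have "ennreal mu * ?V \<le> ennreal lam * laplace_upto H lam h + ennreal d * ennreal (1 - exp (- lam * h))"
    using equilibrium_tail_weighted_eq[of "- lam" h] equilibrium_tail_weighted_le[of "- lam" h] lam h abs1[OF h]
    by (simp add: laplace_upto_def)
  also have "ennreal mu * ?W = ennreal mu * laplace_upto H lam h + ennreal (exp (- lam * h)) * equilibrium_tail H mu h"
    using integral_stopped_split[of "\<lambda>u. exp (- lam * u)" h] h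
    by (simp add: laplace_upto_def equilibrium_tail_def distrib_left mult_ac)
  finally show ?thesis
    using lam mu by (simp add: distrib_right add_ac)
qed

text \<open>
  The derivative of the equilibrium tail \<open>T\<close> is \<open>- mu H\<close>, which is at most \<open>- mu (T - d)\<close>; hence
  \<open>exp (mu x) (T x - d)\<close> does not increase.  As \<open>H\<close> may jump, the argument is carried out with
  integrals.
\<close>

lemma equilibrium_tail_bound:
  assumes h: "0 \<le> h"
  shows "ennreal (exp (mu * h)) * equilibrium_tail H mu h \<le> 1 + ennreal d * ennreal (exp (mu * h) - 1)"
proof -
  let ?V = "\<integral>\<^sup>+u. ennreal \<bar>exp (mu * min u h) - 1\<bar> * (ennreal (H u) * indicator {0..} u) \<partial>lborel"
  let ?W = "\<integral>\<^sup>+u. ennreal (exp (mu * min u h)) * (ennreal (H u) * indicator {0..} u) \<partial>lborel"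
  let ?A = "\<integral>\<^sup>+x. ennreal (exp (mu * x)) * (ennreal (H x) * indicator {0..<h} x) \<partial>lborel"
  have "?V + (\<integral>\<^sup>+u. ennreal (H u) * indicator {0..} u \<partial>lborel)
      = (\<integral>\<^sup>+u. ennreal \<bar>exp (mu * min u h) - 1\<bar> * (ennreal (H u) * indicator {0..} u)
      + ennreal (H u) * indicator {0..} u \<partial>lborel)"
    by (rule nn_integral_add[symmetric]) auto
  also have "\<dots> = ?W"
  proof (rule nn_integral_cong)
    fix u :: real
    have "ennreal \<bar>exp (mu * min u h) - 1\<bar> + 1 = ennreal (exp (mu * min u h))" if "0 \<le> u"
      using h mu that by (simp add: ennreal_1[symmetric] ennreal_plus[symmetric] del: ennreal_plus ennreal_1)
    then show "ennreal \<bar>exp (mu * min u h) - 1\<bar> * (ennreal (H u) * indicator {0..} u)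
      + ennreal (H u) * indicator {0..} u = ennreal (exp (mu * min u h)) * (ennreal (H u) * indicator {0..} u)"
      by (cases "0 \<le> u") (metis distrib_right mult_1, simp)
  qed
  finally have "ennreal mu * (?V + (\<integral>\<^sup>+u. ennreal (H u) * indicator {0..} u \<partial>lborel)) = ennreal mu * ?W"
    by (rule arg_cong)
  then have VW: "ennreal mu * ?V + 1 = ennreal mu * ?W"
    unfolding distrib_left scaled_mean .
  have V: "ennreal mu * ?V \<le> ennreal mu * ?A + ennreal d * ennreal (exp (mu * h) - 1)"
  proof -
    have "mu \<noteq> 0" "\<bar>mu\<bar> = mu" "\<bar>exp (mu * h) - 1\<bar> = exp (mu * h) - 1" using mu h by auto
    then show ?thesis
      using equilibrium_tail_weighted_le[OF \<open>mu \<noteq> 0\<close> h, unfolded equilibrium_tail_weighted_eq[OF \<open>mu \<noteq> 0\<close> h]]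
      by (simp only:)
  qed
  have W: "ennreal mu * ?W = ennreal mu * ?A + ennreal (exp (mu * h)) * equilibrium_tail H mu h"
    using integral_stopped_split[of "\<lambda>u. exp (mu * u)" h] h by (simp add: equilibrium_tail_def distrib_left mult_ac)
  have "?A \<le> (\<integral>\<^sup>+x. ennreal (exp (mu * h)) * (ennreal (H x) * indicator {0..} x) \<partial>lborel)"
    using mu by (intro nn_integral_mono) (auto simp: indicator_def intro!: mult_right_mono ennreal_leI)
  also have "\<dots> = ennreal (exp (mu * h)) * ennreal (1 / mu)"
    using H_mean by (simp add: nn_integral_cmult)
  also have "\<dots> < \<top>" by (simp add: ennreal_mult_less_top)
  finally have fin: "ennreal mu * ?A \<noteq> \<top>" by (simp add: ennreal_mult_eq_top_iff)
  have "ennreal mu * ?A + ennreal (exp (mu * h)) * equilibrium_tail H mu h = ennreal mu * ?V + 1"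
    using VW W by simp
  also have "\<dots> \<le> (ennreal mu * ?A + ennreal d * ennreal (exp (mu * h) - 1)) + 1"
    by (rule add_right_mono[OF V])
  also have "\<dots> = ennreal mu * ?A + (1 + ennreal d * ennreal (exp (mu * h) - 1))"
  proof -
    have "(a + b) + 1 = a + (1 + b)" for a b :: ennreal by (simp add: add_ac)
    then show ?thesis .
  qed
  finally have "ennreal mu * ?A + ennreal (exp (mu * h)) * equilibrium_tail H mu h
      \<le> ennreal mu * ?A + (1 + ennreal d * ennreal (exp (mu * h) - 1))" .
  then show ?thesis using fin by (simp add: ennreal_add_left_cancel_le)
qed

text \<open>
  The residual life at the minimising age \<open>y0\<close>, cut at \<open>h\<close>: before \<open>h\<close> its tail is at least \<open>H - d\<close>, and
  a residual life that survives \<open>h\<close> is the residual life at age \<open>y0 + h\<close>, whose transform is at least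
  \<open>r\<close>.  Everything is multiplied by \<open>H y0\<close> to avoid quotients.
\<close>

lemma laplace_minimiser_bound:
  assumes min: "\<And>y. 0 \<le> y \<Longrightarrow> ennreal (r * H y) \<le> laplace_tail H lam y"
    and y0: "0 \<le> y0" "0 < H y0" "laplace_tail H lam y0 = ennreal (r * H y0)" and h: "0 \<le> h"
  shows "laplace_upto H lam h + ennreal (exp (- lam * h) * r * H h)
    \<le> ennreal (r + d * ((1 - exp (- lam * h)) / lam + exp (- lam * h) * r))"
proof -
  let ?q = "exp (- lam * h)"
  let ?B = "\<integral>\<^sup>+x. ennreal (exp (- lam * x)) * (ennreal (H (x + y0)) * indicator {0..<h} x) \<partial>lborel"
  have e: "(\<integral>\<^sup>+x. ennreal (exp (- lam * x)) * indicator {0..<h} x \<partial>lborel) = ennreal ((1 - ?q) / lam)"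
  proof -
    have "ennreal lam * (\<integral>\<^sup>+x. ennreal (exp (- lam * x)) * indicator {0..<h} x \<partial>lborel)
        = (\<integral>\<^sup>+x. ennreal (\<bar>- lam\<bar> * exp (- lam * x)) * indicator {0..h} x \<partial>lborel)"
    proof -
      have "ennreal lam * (\<integral>\<^sup>+x. ennreal (exp (- lam * x)) * indicator {0..<h} x \<partial>lborel)
          = (\<integral>\<^sup>+x. ennreal lam * (ennreal (exp (- lam * x)) * indicator {0..<h} x) \<partial>lborel)"
        by (rule nn_integral_cmult[symmetric]) simp
      also have "\<dots> = (\<integral>\<^sup>+x. ennreal (\<bar>- lam\<bar> * exp (- lam * x)) * indicator {0..h} x \<partial>lborel)"
        using lam
        by (intro nn_integral_cong_AE, intro AE_mp[OF AE_lborel_singleton[of h] AE_I2])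
           (auto simp: indicator_def ennreal_mult)
      finally show ?thesis .
    qed
    also have "\<dots> = ennreal (1 - ?q)"
    proof -
      have "?q \<le> 1" using mult_nonneg_nonneg[of lam h] lam h by simp
      then show ?thesis using lam h integral_exp_upto[of "- lam" h] by simp
    qed
    also have "\<dots> = ennreal lam * ennreal ((1 - ?q) / lam)"
      using lam h by (subst ennreal_mult[symmetric]) auto
    finally show ?thesis using lam by (simp add: ennreal_mult_cancel_left)
  qed
  have A: "laplace_upto H lam h * ennreal (H y0) \<le> ?B + ennreal d * ennreal (H y0) * ennreal ((1 - ?q) / lam)"
  proof -
    have "laplace_upto H lam h * ennreal (H y0) = (\<integral>\<^sup>+x. ennreal (exp (- lam * x)) * (ennreal (H x) * indicator {0..<h} x) * ennreal (H y0) \<partial>lborel)"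
      unfolding laplace_upto_def by (rule nn_integral_multc[symmetric]) simp
    also have "\<dots> \<le> (\<integral>\<^sup>+x. ennreal (exp (- lam * x)) * (ennreal (H (x + y0)) * indicator {0..<h} x)
        + ennreal d * ennreal (H y0) * (ennreal (exp (- lam * x)) * indicator {0..<h} x) \<partial>lborel)"
    proof (rule nn_integral_mono)
      fix x
      show "ennreal (exp (- lam * x)) * (ennreal (H x) * indicator {0..<h} x) * ennreal (H y0)
        \<le> ennreal (exp (- lam * x)) * (ennreal (H (x + y0)) * indicator {0..<h} x)
        + ennreal d * ennreal (H y0) * (ennreal (exp (- lam * x)) * indicator {0..<h} x)"
        using mult_left_mono[OF H_mult_le(2)[of x y0], of "ennreal (exp (- lam * x))"] y0(1)
        by (cases "0 \<le> x \<and> x < h") (auto simp: distrib_left mult_ac)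
    qed
    also have "\<dots> = ?B + ennreal d * ennreal (H y0) * ennreal ((1 - ?q) / lam)"
      unfolding e[symmetric] by (subst nn_integral_add) (auto simp: nn_integral_cmult)
    finally show ?thesis .
  qed
  have split: "laplace_tail H lam y0 = ?B + ennreal ?q * laplace_tail H lam (y0 + h)"
  proof -
    have "laplace_tail H lam y0 = (\<integral>\<^sup>+x. ennreal (exp (- lam * x)) * (ennreal (H (x + y0)) * indicator {0..<h} x)
        + (ennreal (exp (- lam * x)) * ennreal (H (x + y0))) * indicator {h..} x \<partial>lborel)"
      unfolding laplace_tail_def using h by (intro nn_integral_cong) (auto simp: indicator_def)
    also have "\<dots> = ?B + (\<integral>\<^sup>+x. (ennreal (exp (- lam * x)) * ennreal (H (x + y0))) * indicator {h..} x \<partial>lborel)"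
      by (rule nn_integral_add) auto
    also have "(\<integral>\<^sup>+x. (ennreal (exp (- lam * x)) * ennreal (H (x + y0))) * indicator {h..} x \<partial>lborel)
        = (\<integral>\<^sup>+x. (ennreal (exp (- lam * (x + h))) * ennreal (H (x + h + y0))) * indicator {0..} x \<partial>lborel)"
      by (rule shift_integral) simp
    also have "\<dots> = (\<integral>\<^sup>+x. ennreal ?q * (ennreal (exp (- lam * x)) * (ennreal (H (x + (y0 + h))) * indicator {0..} x)) \<partial>lborel)"
    proof (rule nn_integral_cong)
      fix x
      have "exp (- lam * (x + h)) = ?q * exp (- lam * x)"
        by (simp add: mult_exp_exp algebra_simps)
      then have "ennreal (exp (- lam * (x + h))) = ennreal ?q * ennreal (exp (- lam * x))"
        by (simp only: ennreal_mult exp_ge_zero)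
      moreover have "x + h + y0 = x + (y0 + h)" by simp
      ultimately show "ennreal (exp (- lam * (x + h))) * ennreal (H (x + h + y0)) * indicator {0..} x
          = ennreal ?q * (ennreal (exp (- lam * x)) * (ennreal (H (x + (y0 + h))) * indicator {0..} x))"
        by (simp only: mult.assoc)
    qed
    also have "\<dots> = ennreal ?q * laplace_tail H lam (y0 + h)"
      unfolding laplace_tail_def by (rule nn_integral_cmult) simp
    finally show ?thesis .
  qed
  have "r * (H h * H y0) \<le> r * (H (h + y0) + d * H y0)"
    using H_mult[of h y0] h y0(1) r by (intro mult_left_mono) auto
  then have "ennreal (?q * r * H h * H y0) \<le> ennreal (?q * (r * H (h + y0)) + ?q * r * d * H y0)"
    using mult_left_mono[of "r * (H h * H y0)" "r * (H (h + y0) + d * H y0)" ?q]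
    by (intro ennreal_leI) (simp add: algebra_simps)
  also have "\<dots> = ennreal ?q * ennreal (r * H (y0 + h)) + ennreal (?q * r * d * H y0)"
    using r d h y0 H_nonneg[of "h + y0"] by (simp add: ennreal_plus ennreal_mult add.commute)
  also have "\<dots> \<le> ennreal ?q * laplace_tail H lam (y0 + h) + ennreal (?q * r * d * H y0)"
    using h y0 by (intro add_right_mono mult_left_mono min) auto
  finally have "laplace_upto H lam h * ennreal (H y0) + ennreal (?q * r * H h * H y0)
      \<le> (?B + ennreal d * ennreal (H y0) * ennreal ((1 - ?q) / lam))
        + (ennreal ?q * laplace_tail H lam (y0 + h) + ennreal (?q * r * d * H y0))"
    using A by (intro add_mono) 
  also have "\<dots> = ennreal (r * H y0) + ennreal d * ennreal (H y0) * ennreal ((1 - ?q) / lam) + ennreal (?q * r * d * H y0)"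
    unfolding y0(3)[symmetric] split by (simp add: add_ac)
  also have "\<dots> = ennreal (r + d * ((1 - ?q) / lam + ?q * r)) * ennreal (H y0)"
  proof -
    have "?q \<le> 1" using mult_nonneg_nonneg[of lam h] lam h by simp
    then have "0 \<le> (1 - ?q) / lam" using lam by simp
    then show ?thesis
      using r d y0(2)
      by (simp add: ennreal_mult[symmetric] ennreal_plus[symmetric] distrib_left distrib_right mult_ac add_ac
          del: ennreal_plus times_divide_eq_left times_divide_eq_right)
  qed
  finally have "(laplace_upto H lam h + ennreal (?q * r * H h)) * ennreal (H y0)
      \<le> ennreal (r + d * ((1 - ?q) / lam + ?q * r)) * ennreal (H y0)"
    using y0 r H_nonneg[OF h] by (simp add: distrib_right ennreal_mult[symmetric])
  then show ?thesis
    using y0(2) by (subst (asm) (1 2) mult.commute) (simp add: ennreal_mult_le_mult_iff)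
qed


lemma minimiser_exceeds_fraction:
  assumes min: "\<And>y. 0 \<le> y \<Longrightarrow> ennreal (r * H y) \<le> laplace_tail H lam y"
    and y0: "0 \<le> y0" "0 < H y0" "laplace_tail H lam y0 = ennreal (r * H y0)"
    and R: "laplace_tail H lam 0 = ennreal R" "0 \<le> R" "r \<le> R"
    and eps: "d < eps" "5 * eps < 1"
  shows "(1 - 5 * eps) * R < r" and "(1 - 5 * eps) / (lam + mu) < r"
proof -
  \<comment> \<open>The cut-off almost minimises \<open>(2 + mu h) / (1 - exp (- mu h))\<close>, the constant of the argument for \<open>lam \<longrightarrow> 0\<close>; its value is about \<open>4.5\<close>.\<close>
  define h where "h = 3/2 / mu"
  have h: "0 \<le> h" using mu by (simp add: h_def)
  let ?q = "exp (- lam * h)"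
  have q1: "?q \<le> 1" using mult_nonneg_nonneg[of lam h] lam h by simp
  have "laplace_upto H lam h \<le> laplace_tail H lam 0"
    unfolding laplace_upto_def laplace_tail_0 by (intro nn_integral_mono) (auto simp: indicator_def)
  then obtain A where A: "laplace_upto H lam h = ennreal A" "0 \<le> A"
    unfolding R(1) by (cases "laplace_upto H lam h") (auto simp: top_unique)
  have "equilibrium_tail H mu h \<le> ennreal (H h + d)" by (rule equilibrium_tail_le(1)[OF h])
  then obtain th where th: "equilibrium_tail H mu h = ennreal th" "0 \<le> th"
    by (cases "equilibrium_tail H mu h") (auto simp: top_unique)
  have 1: "lam * r + mu * R \<le> 1"
    using minimum_le_transforms[OF min] R lam mu r
    by (simp add: ennreal_mult[symmetric] ennreal_plus[symmetric] del: ennreal_plus)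
  have 2: "(lam + mu) * R \<le> 1 + d"
    using transform_le_near_memoryless R lam mu d
    by (simp add: ennreal_mult[symmetric] ennreal_plus[symmetric] ennreal_1[symmetric] distrib_right
        del: ennreal_plus ennreal_1)
  have 3: "exp (3/2) * th \<le> 1 + d * (exp (3/2) - 1)"
  proof -
    have "mu * h = 3/2" using mu by (simp add: h_def)
    with equilibrium_tail_bound[OF h] have "ennreal (exp (3/2)) * ennreal th \<le> 1 + ennreal d * ennreal (exp (3/2) - 1)"
      by (simp only: th)
    then show ?thesis using th d
      by (simp add: ennreal_mult[symmetric] ennreal_plus[symmetric] ennreal_1[symmetric]
          del: ennreal_plus ennreal_1)
  qed
  have 4: "1 \<le> (lam + mu) * A + d * (1 - ?q) + ?q * th"
    using laplace_upto_bound[OF h] lam mu d q1 A(2) th(2) unfolding A(1) th(1)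
    by (simp add: ennreal_mult[symmetric] ennreal_plus[symmetric] ennreal_1[symmetric]
        del: ennreal_plus ennreal_1)
  have 5: "A + ?q * r * H h \<le> r + d * ((1 - ?q) / lam + ?q * r)"
  proof -
    have "0 \<le> ?q * r * H h" using r H_nonneg[OF h] by simp
    moreover have "0 \<le> r + d * ((1 - ?q) / lam + ?q * r)" using r d q1 lam by simp
    moreover have "ennreal A + ennreal (?q * r * H h) \<le> ennreal (r + d * ((1 - ?q) / lam + ?q * r))"
      unfolding A(1)[symmetric] using min y0 h by (rule laplace_minimiser_bound)
    ultimately show ?thesis
      using A(2) by (simp add: ennreal_plus[symmetric] del: ennreal_plus)
  qed
  have 6: "th \<le> H h + d"
    using equilibrium_tail_le(1)[OF h] th H_nonneg[OF h] d by (simp del: ennreal_plus)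
  have q: "?q = exp (- (3/2 * (lam / mu)))" by (simp add: h_def)
  note bound = transform_ratio_bound[OF lam mu d eps r R(3) q 1 2 3 4 5 6]
  show "(1 - 5 * eps) * R < r" by (rule bound(1))
  show "(1 - 5 * eps) / (lam + mu) < r" by (rule bound(2))
qed

end

section \<open>The law of the losses of the queue\<close>

lemma measurable_realizes:
  "T \<in> measurable M (seq_measure borel) \<Longrightarrow> S \<in> measurable M (seq_measure borel) \<Longrightarrow>
    Measurable.pred M (\<lambda>x. realizes ms (T x) (S x))"
proof (induction ms arbitrary: T S)
  case (Cons m ms)
  have [measurable]: "Measurable.pred M (\<lambda>x. arrivals_before m (S x 0) (T x))"
    by (rule measurable_arrivals_before[OF measurable_nth_seq]) (use Cons.prems in auto)
  have [measurable]: "Measurable.pred M (\<lambda>x. realizes ms (gaps_after m (S x 0) (T x)) (\<lambda>i. S x (Suc i)))"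
    by (rule Cons.IH[OF measurable_gaps_after[OF measurable_nth_seq] measurable_shift_seq]) (use Cons.prems in auto)
  show ?case by simp
qed simp

context
  fixes lam :: real and B :: "real measure" and n :: nat
  assumes lam: "0 < lam" and B_law: "nonneg_law B" and B_0: "cdf B 0 = 0"
begin

interpretation B: real_distribution B
  using B_law by (simp add: nonneg_law_def)

abbreviation input_measure :: "((nat \<Rightarrow> real) \<times> (nat \<Rightarrow> real)) measure" where
  "input_measure \<equiv> seq_measure (exp_measure lam) \<Otimes>\<^sub>M seq_measure B"

lemma prob_space_exp: "prob_space (exp_measure lam)"
  by (rule prob_space_exponential_density[OF lam])

lemma sets_input_measure [measurable_cong]:
  "sets input_measure = sets (seq_measure borel \<Otimes>\<^sub>M seq_measure borel)"
  by (intro sets_pair_measure_cong sets_PiM_cong) auto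

lemma AE_B_pos: "AE s in B. 0 < s"
proof -
  have "emeasure B {..0} = 0" using B_0 by (simp add: cdf_def B.emeasure_eq_measure)
  then show ?thesis by (intro AE_I[where N="{..0}"]) (auto simp: not_less)
qed

text \<open>
  One service: the number of arrivals during it has the mixed Poisson law and is independent of
  the input that is left, which has the same law as the original input.
\<close>

lemma nn_integral_service:
  assumes f: "f \<in> borel_measurable (seq_measure borel \<Otimes>\<^sub>M seq_measure borel)"
  shows "(\<integral>\<^sup>+\<omega>. indicator {\<omega>. arrivals_before m (snd \<omega> 0) (fst \<omega>)} \<omega>
      * f (gaps_after m (snd \<omega> 0) (fst \<omega>), \<lambda>i. snd \<omega> (Suc i)) \<partial>input_measure)
    = ennreal (pmf (poisson_mixture lam B) m) * (\<integral>\<^sup>+\<omega>. f \<omega> \<partial>input_measure)"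
proof -
  let ?E = "seq_measure (exp_measure lam)" and ?B = "seq_measure B"
  interpret E: prob_space ?E by (rule prob_space_seq_measure[OF prob_space_exp])
  interpret Bs: prob_space ?B by (rule prob_space_seq_measure) unfold_locales
  interpret P: pair_sigma_finite ?E ?B ..
  have sE [measurable_cong]: "sets ?E = sets (seq_measure borel)" and sB [measurable_cong]: "sets ?B = sets (seq_measure borel)"
    by (intro sets_PiM_cong; simp)+
  note f [measurable]
  define h where "h S = (\<integral>\<^sup>+T. f (T, S) \<partial>?E)" for S
  have h [measurable]: "h \<in> borel_measurable (seq_measure borel)"
    unfolding h_def by measurable
  define F where "F \<omega> = indicator {\<omega>. arrivals_before m (snd \<omega> 0) (fst \<omega>)} \<omega>
      * f (gaps_after m (snd \<omega> 0) (fst \<omega>), \<lambda>i. snd \<omega> (Suc i))" for \<omega>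
  have fst: "fst \<in> measurable (seq_measure borel \<Otimes>\<^sub>M seq_measure borel) (seq_measure borel)"
    and snd: "snd \<in> measurable (seq_measure borel \<Otimes>\<^sub>M seq_measure borel) (seq_measure borel)"
    by measurable
  have [measurable]: "Measurable.pred (seq_measure borel \<Otimes>\<^sub>M seq_measure borel) (\<lambda>\<omega>. arrivals_before m (snd \<omega> 0) (fst \<omega>))"
    by (rule measurable_arrivals_before[OF measurable_nth_seq[OF snd] fst])
  have [measurable]: "(\<lambda>\<omega>. f (gaps_after m (snd \<omega> 0) (fst \<omega>), \<lambda>i. snd \<omega> (Suc i))) \<in> borel_measurable (seq_measure borel \<Otimes>\<^sub>M seq_measure borel)"
    by (rule measurable_compose[OF _ f], rule measurable_Pair)
       (intro measurable_gaps_after measurable_nth_seq measurable_shift_seq fst snd)+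
  have F [measurable]: "F \<in> borel_measurable (seq_measure borel \<Otimes>\<^sub>M seq_measure borel)"
    unfolding F_def by measurable
  define G where "G S = (\<integral>\<^sup>+T. F (T, S) \<partial>?E)" for S
  have G [measurable]: "G \<in> borel_measurable ?B"
    unfolding G_def by measurable
  have G_case: "G (case_nat s S) = (if 0 < s then ennreal (erlang_density m lam s / lam) else 0) * h S" for s S
  proof -
    have "(\<lambda>T. f (T, S)) \<in> borel_measurable (seq_measure borel)"
      by (rule measurable_compose[OF _ f]) (simp add: space_PiM)
    from nn_integral_arrivals_before[OF lam this, of m s]
    show ?thesis by (simp add: G_def F_def h_def indicator_def)
  qed
  have "(\<integral>\<^sup>+\<omega>. F \<omega> \<partial>input_measure) = (\<integral>\<^sup>+S. G S \<partial>?B)"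
    unfolding G_def by (rule P.nn_integral_snd[symmetric]) simp
  also have "\<dots> = (\<integral>\<^sup>+s. \<integral>\<^sup>+S. (if 0 < s then ennreal (erlang_density m lam s / lam) else 0) * h S \<partial>?B \<partial>B)"
    unfolding nn_integral_seq_measure[OF B.prob_space_axioms G] G_case ..
  also have "\<dots> = (\<integral>\<^sup>+s. (if 0 < s then ennreal (erlang_density m lam s / lam) else 0) * (\<integral>\<^sup>+S. h S \<partial>?B) \<partial>B)"
    by (intro nn_integral_cong nn_integral_cmult) simp
  also have "\<dots> = (\<integral>\<^sup>+s. ennreal (erlang_density m lam s / lam) * (\<integral>\<^sup>+S. h S \<partial>?B) \<partial>B)"
    using AE_B_pos by (intro nn_integral_cong_AE) (auto elim!: eventually_mono)
  also have "\<dots> = ennreal (pmf (poisson_mixture lam B) m) * (\<integral>\<^sup>+S. h S \<partial>?B)"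
    unfolding ennreal_pmf_poisson_mixture[OF lam B_law] by (rule nn_integral_multc) simp
  also have "(\<integral>\<^sup>+S. h S \<partial>?B) = (\<integral>\<^sup>+\<omega>. f \<omega> \<partial>input_measure)"
    unfolding h_def by (rule P.nn_integral_snd) simp
  finally show ?thesis unfolding F_def .
qed

text \<open>
  Inputs for which a service that starts with \<open>x\<close> customers is followed by a return to \<open>0\<close> with at
  least \<open>k\<close> losses on the way.
\<close>

definition losing_paths :: "nat \<Rightarrow> nat \<Rightarrow> ((nat \<Rightarrow> real) \<times> (nat \<Rightarrow> real)) set" where
  "losing_paths x k = {\<omega>. \<exists>ms. empties n x ms \<and> k \<le> spilled n x ms \<and> realizes ms (fst \<omega>) (snd \<omega>)}"

lemma pred_losing_paths [measurable]:
  "Measurable.pred (seq_measure borel \<Otimes>\<^sub>M seq_measure borel) (\<lambda>\<omega>. \<omega> \<in> losing_paths x k)"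
proof -
  have [measurable]: "Measurable.pred (seq_measure borel \<Otimes>\<^sub>M seq_measure borel) (\<lambda>\<omega>. realizes ms (fst \<omega>) (snd \<omega>))" for ms
    by (rule measurable_realizes) measurable
  show ?thesis unfolding losing_paths_def by simp
qed

lemma losing_paths_sets [simp]: "losing_paths x k \<in> sets input_measure"
proof -
  have "{\<omega>\<in>space (seq_measure borel \<Otimes>\<^sub>M seq_measure borel). \<omega> \<in> losing_paths x k}
      \<in> sets (seq_measure borel \<Otimes>\<^sub>M seq_measure (borel :: real measure))" by measurable
  then show ?thesis by (simp add: sets_input_measure space_pair_measure space_PiM)
qed

text \<open>
  Different first counts \<open>m\<close> belong to disjoint events, so the probabilities of the continuations
  may be added.
\<close>

lemma losing_paths_step:
  assumes "0 < x"
  shows "(\<integral>\<^sup>+m. emeasure input_measure (losing_paths (min (x + m) (n + 1) - 1) (k - (x + m - (n + 1)))) \<partial>poisson_mixture lam B)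
    \<le> emeasure input_measure (losing_paths x k)"
proof -
  let ?L = "\<lambda>m. losing_paths (min (x + m) (n + 1) - 1) (k - (x + m - (n + 1)))"
  let ?W = "\<lambda>m \<omega>. indicator {\<omega>. arrivals_before m (snd \<omega> 0) (fst \<omega>)} \<omega>
      * (indicator (?L m) (gaps_after m (snd \<omega> 0) (fst \<omega>), \<lambda>i. snd \<omega> (Suc i)) :: ennreal)"
  have fst: "fst \<in> measurable (seq_measure borel \<Otimes>\<^sub>M seq_measure borel) (seq_measure borel)"
    and snd: "snd \<in> measurable (seq_measure borel \<Otimes>\<^sub>M seq_measure borel) (seq_measure borel)"
    by measurable
  have ind [measurable]: "indicator (?L m) \<in> borel_measurable (seq_measure borel \<Otimes>\<^sub>M seq_measure borel)" for m
    by measurable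
  have [measurable]: "Measurable.pred (seq_measure borel \<Otimes>\<^sub>M seq_measure borel) (\<lambda>\<omega>. arrivals_before m (snd \<omega> 0) (fst \<omega>))" for m
    by (rule measurable_arrivals_before[OF measurable_nth_seq[OF snd] fst])
  have [measurable]: "(\<lambda>\<omega>. indicator (?L m) (gaps_after m (snd \<omega> 0) (fst \<omega>), \<lambda>i. snd \<omega> (Suc i)) :: ennreal)
      \<in> borel_measurable (seq_measure borel \<Otimes>\<^sub>M seq_measure borel)" for m
    by (rule measurable_compose[OF _ ind], rule measurable_Pair)
       (intro measurable_gaps_after measurable_nth_seq measurable_shift_seq fst snd)+
  have "(\<integral>\<^sup>+m. emeasure input_measure (?L m) \<partial>poisson_mixture lam B)
      = (\<Sum>m. ennreal (pmf (poisson_mixture lam B) m) * emeasure input_measure (?L m))"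
    by (simp add: nn_integral_measure_pmf nn_integral_count_space_nat)
  also have "\<dots> = (\<Sum>m. \<integral>\<^sup>+\<omega>. ?W m \<omega> \<partial>input_measure)"
    using nn_integral_service[OF ind] by simp
  also have "\<dots> = (\<integral>\<^sup>+\<omega>. (\<Sum>m. ?W m \<omega>) \<partial>input_measure)"
    by (rule nn_integral_suminf[symmetric]) measurable
  also have "\<dots> \<le> (\<integral>\<^sup>+\<omega>. indicator (losing_paths x k) \<omega> \<partial>input_measure)"
  proof (rule nn_integral_mono)
    fix \<omega> :: "(nat \<Rightarrow> real) \<times> (nat \<Rightarrow> real)"
    show "(\<Sum>m. ?W m \<omega>) \<le> indicator (losing_paths x k) \<omega>"
    proof (cases "\<exists>m. ?W m \<omega> \<noteq> 0")
      case True
      then obtain m where m: "?W m \<omega> \<noteq> 0" by blast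
      then have c: "arrivals_before m (snd \<omega> 0) (fst \<omega>)"
        and l: "(gaps_after m (snd \<omega> 0) (fst \<omega>), \<lambda>i. snd \<omega> (Suc i)) \<in> ?L m"
        by (auto simp: indicator_def split: if_splits)
      have "?W m' \<omega> = 0" if "m' \<noteq> m" for m'
        using arrivals_before_unique[OF c, of m'] that by (auto simp: indicator_def)
      then have "(\<Sum>m. ?W m \<omega>) = (\<Sum>m\<in>{m}. ?W m \<omega>)"
        by (intro suminf_finite) auto
      also have "\<dots> = ?W m \<omega>"
        by (simp only: sum.insert finite.emptyI empty_iff sum.empty add_0_right not_False_eq_True)
      also have "\<dots> \<le> 1" by (auto simp: indicator_def)
      also have "1 = indicator (losing_paths x k) \<omega>"
      proof -
        obtain ms where "empties n (min (x + m) (n + 1) - 1) ms"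
          "k - (x + m - (n + 1)) \<le> spilled n (min (x + m) (n + 1) - 1) ms"
          "realizes ms (gaps_after m (snd \<omega> 0) (fst \<omega>)) (\<lambda>i. snd \<omega> (Suc i))"
          using l by (auto simp: losing_paths_def)
        then have "\<omega> \<in> losing_paths x k"
          unfolding losing_paths_def using assms c by (auto intro!: exI[of _ "m # ms"])
        then show ?thesis by simp
      qed
      finally show ?thesis .
    next
      case False
      then have "(\<lambda>m. ?W m \<omega>) = (\<lambda>m. 0)" by (intro ext) blast
      then have "(\<Sum>m. ?W m \<omega>) = (\<Sum>m. 0)" by (rule arg_cong)
      then show ?thesis by (simp only: suminf_zero zero_le)
    qed
  qed
  also have "\<dots> = emeasure input_measure (losing_paths x k)" by simp
  finally show ?thesis .
qed

lemma emeasure_losing_paths_empty: "emeasure input_measure (losing_paths 0 0) = 1"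
proof -
  interpret E: prob_space "seq_measure (exp_measure lam)" by (rule prob_space_seq_measure[OF prob_space_exp])
  interpret Bs: prob_space "seq_measure B" by (rule prob_space_seq_measure) unfold_locales
  interpret P: pair_prob_space "seq_measure (exp_measure lam)" "seq_measure B" ..
  have "losing_paths 0 0 = space input_measure"
    by (auto simp: losing_paths_def space_pair_measure space_PiM intro!: exI[of _ "[]"])
  then show ?thesis by (simp add: P.emeasure_space_1)
qed

lemma poisson_mixture_full_support: "set_pmf (poisson_mixture lam B) = UNIV"
proof -
  have "pmf (poisson_mixture lam B) m \<noteq> 0" for m
  proof
    assume "pmf (poisson_mixture lam B) m = 0"
    then have "(\<integral>\<^sup>+x. ennreal (erlang_density m lam x / lam) \<partial>B) = 0"
      using ennreal_pmf_poisson_mixture[OF lam B_law, of m] by simp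
    then have "AE x in B. ennreal (erlang_density m lam x / lam) = 0"
      by (subst (asm) nn_integral_0_iff_AE) auto
    with AE_B_pos have "AE x in B. False"
    proof eventually_elim
      case (elim x)
      then have "0 < erlang_density m lam x / lam" using lam by (simp add: erlang_density_def)
      with elim lam show False by (auto simp: zero_less_divide_iff)
    qed
    then show False using B.AE_False by simp
  qed
  then show ?thesis by (auto simp: set_pmf_iff)
qed

text \<open>
  Almost every input has positive service times and nonnegative gaps, and on such inputs a path in
  \<open>losing_paths 1 k\<close> belongs to a queue that loses at least \<open>k\<close> customers.
\<close>

lemma total_losses_tail_le_busy_period_losses:
  assumes queue: "MGI1_input lam B M T S"
  shows "emeasure (total_losses (poisson_mixture lam B) n 1) {k..}
    \<le> emeasure M {\<omega>\<in>space M. k \<le> busy_period_losses n T S \<omega>}"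
proof -
  interpret M: prob_space M using queue by (simp add: MGI1_input_def)
  have ind: "M.indep_vars (\<lambda>_. borel) (case_sum T S) UNIV"
    and T_distr: "\<And>i. distributed M lborel (T i) (exponential_density lam)"
    and S_distr: "\<And>i. distr M borel (S i) = B"
    using queue by (auto simp: MGI1_input_def)
  have rv: "case_sum T S i \<in> borel_measurable M" for i
    using ind by (auto simp: M.indep_vars_def)
  have T_meas [measurable]: "T i \<in> borel_measurable M" for i using rv[of "Inl i"] by simp
  have S_meas [measurable]: "S i \<in> borel_measurable M" for i using rv[of "Inr i"] by simp
  have T_law: "distr M borel (T i) = exp_measure lam" for i
  proof -
    have "distr M borel (T i) = distr M lborel (T i)" by (intro distr_cong) auto
    then show ?thesis using distributed_distr_eq_density[OF T_distr] by simp
  qed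
  have vars_seq: "distr M (seq_measure borel) (\<lambda>\<omega> i. X i \<omega>) = seq_measure D"
    if X: "M.indep_vars (\<lambda>_. borel) X UNIV" and D: "\<And>i. distr M borel (X i) = D" for X :: "nat \<Rightarrow> _ \<Rightarrow> real" and D
  proof -
    have "\<And>i. X i \<in> borel_measurable M" using X by (auto simp: M.indep_vars_def)
    then have "distr M (seq_measure borel) (\<lambda>x. \<lambda>i\<in>UNIV. X i x) = (\<Pi>\<^sub>M i\<in>UNIV. distr M borel (X i))"
      using M.indep_vars_iff_distr_eq_PiM[of UNIV X "\<lambda>_. borel"] X by simp
    moreover have "(\<lambda>x. \<lambda>i\<in>UNIV. X i x) = (\<lambda>\<omega> i. X i \<omega>)" by (auto simp: restrict_def)
    ultimately show ?thesis by (simp add: D)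
  qed
  have sub: "M.indep_vars (\<lambda>_. borel) (\<lambda>i. case_sum T S (g i)) UNIV" if "inj g" for g :: "nat \<Rightarrow> nat + nat"
  proof -
    have "M.indep_vars (\<lambda>_. borel) (\<lambda>i. (\<lambda>f. f (g i)) \<circ> (\<lambda>\<omega>. restrict (\<lambda>j. case_sum T S j \<omega>) {g i})) UNIV"
      using that
      by (intro M.indep_vars_compose[OF M.indep_vars_restrict[OF ind]])
         (auto simp: disjoint_family_on_def inj_eq intro!: measurable_component_singleton)
    then show ?thesis by (simp add: comp_def)
  qed
  have T_seq: "distr M (seq_measure borel) (\<lambda>\<omega> i. T i \<omega>) = seq_measure (exp_measure lam)"
    using sub[of Inl] by (intro vars_seq T_law) auto
  have S_seq: "distr M (seq_measure borel) (\<lambda>\<omega> i. S i \<omega>) = seq_measure B"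
    using sub[of Inr] by (intro vars_seq S_distr) auto
  have indep: "M.indep_var (seq_measure borel) (\<lambda>\<omega> i. T i \<omega>) (seq_measure borel) (\<lambda>\<omega> i. S i \<omega>)"
  proof -
    have "M.indep_var (seq_measure borel) ((\<lambda>f i. f (Inl i)) \<circ> (\<lambda>\<omega>. restrict (\<lambda>j. case_sum T S j \<omega>) (range Inl)))
      (seq_measure borel) ((\<lambda>f i. f (Inr i)) \<circ> (\<lambda>\<omega>. restrict (\<lambda>j. case_sum T S j \<omega>) (range Inr)))"
      by (rule M.indep_var_compose[OF M.indep_var_restrict[OF ind]])
         (auto intro!: measurable_PiM_single' measurable_component_singleton simp: space_PiM)
    then show ?thesis by (simp add: comp_def)
  qed
  let ?I = "\<lambda>\<omega>. (\<lambda>i. T i \<omega>, \<lambda>i. S i \<omega>)"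
  have law: "distr M (seq_measure borel \<Otimes>\<^sub>M seq_measure borel) ?I = input_measure"
    using indep unfolding M.indep_var_distribution_eq T_seq S_seq by auto
  have I_meas: "?I \<in> measurable M (seq_measure borel \<Otimes>\<^sub>M seq_measure borel)"
    using indep unfolding M.indep_var_distribution_eq by (intro measurable_Pair) auto
  have L_meas: "(\<lambda>\<omega>. busy_period_losses n T S \<omega>) \<in> measurable M (count_space UNIV)"
    unfolding busy_period_losses_def by (intro measurable_losses) (auto simp: arrival_times_def)
  have AE_T: "AE \<omega> in M. \<forall>i. 0 \<le> T i \<omega>"
  proof (subst AE_all_countable, intro allI)
    fix i
    have "AE t in exp_measure lam. 0 \<le> t"
      by (subst AE_density) (auto simp: exponential_density_def)
    then show "AE \<omega> in M. 0 \<le> T i \<omega>"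
      unfolding T_law[of i, symmetric] by (subst (asm) AE_distr_iff) auto
  qed
  have AE_S: "AE \<omega> in M. \<forall>i. 0 < S i \<omega>"
  proof (subst AE_all_countable, intro allI)
    fix i
    show "AE \<omega> in M. 0 < S i \<omega>"
      using AE_B_pos unfolding S_distr[of i, symmetric] by (subst (asm) AE_distr_iff) auto
  qed
  have "emeasure (total_losses (poisson_mixture lam B) n 1) {k..} \<le> emeasure input_measure (losing_paths 1 k)"
    by (rule total_losses_tail_le[OF poisson_mixture_full_support emeasure_losing_paths_empty losing_paths_step]) auto
  also have "\<dots> = emeasure M (?I -` losing_paths 1 k \<inter> space M)"
    unfolding law[symmetric] using I_meas losing_paths_sets[of 1 k]
    by (intro emeasure_distr) (auto simp: sets_input_measure)
  also have "\<dots> \<le> emeasure M {\<omega>\<in>space M. k \<le> busy_period_losses n T S \<omega>}"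
  proof (rule emeasure_mono_AE)
    show "AE \<omega> in M. \<omega> \<in> ?I -` losing_paths 1 k \<inter> space M \<longrightarrow> \<omega> \<in> {\<omega>\<in>space M. k \<le> busy_period_losses n T S \<omega>}"
      using AE_T AE_S
    proof eventually_elim
      case (elim \<omega>)
      show ?case
      proof
        assume "\<omega> \<in> ?I -` losing_paths 1 k \<inter> space M"
        then obtain ms where "empties n 1 ms" "k \<le> spilled n 1 ms" "realizes ms (\<lambda>i. T i \<omega>) (\<lambda>i. S i \<omega>)" "\<omega> \<in> space M"
          by (auto simp: losing_paths_def)
        then show "\<omega> \<in> {\<omega>\<in>space M. k \<le> busy_period_losses n T S \<omega>}"
          using losses_of_realized_path[of ms "\<lambda>i. T i \<omega>" "\<lambda>i. S i \<omega>" n] elim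
          by (simp add: busy_period_losses_def arrival_times_def[abs_def])
      qed
    qed
    have "{\<omega>\<in>space M. k \<le> busy_period_losses n T S \<omega>} = (\<lambda>\<omega>. busy_period_losses n T S \<omega>) -` {k..} \<inter> space M" by auto
    also have "\<dots> \<in> sets M" by (rule measurable_sets[OF L_meas]) simp
    finally show "{\<omega>\<in>space M. k \<le> busy_period_losses n T S \<omega>} \<in> sets M" .
  qed
  finally show ?thesis .
qed

end

section \<open>Erlang means and residual distributions\<close>

lemma erlang_mean_cong: "(\<And>x. 0 \<le> x \<Longrightarrow> f x = g x) \<Longrightarrow> erlang_mean lam i f = erlang_mean lam i g"
  unfolding erlang_mean_def by (intro nn_integral_cong) (auto simp: erlang_density_def)

lemma nn_integral_erlang_density_1: "0 < lam \<Longrightarrow> (\<integral>\<^sup>+x. ennreal (erlang_density i lam x) \<partial>lborel) = 1"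
  using prob_space.emeasure_space_1[OF prob_space_erlang_density[of lam i]] by (simp add: emeasure_density)

lemma erlang_mean_add:
  assumes [measurable]: "f \<in> borel_measurable borel" "g \<in> borel_measurable borel"
    and "0 \<le> a" "0 \<le> b" "\<And>x. 0 \<le> x \<Longrightarrow> 0 \<le> f x" "\<And>x. 0 \<le> x \<Longrightarrow> 0 \<le> g x"
  shows "erlang_mean lam i (\<lambda>x. a * f x + b * g x)
    = ennreal a * erlang_mean lam i f + ennreal b * erlang_mean lam i g"
proof -
  have "erlang_mean lam i (\<lambda>x. a * f x + b * g x)
     = (\<integral>\<^sup>+x. ennreal a * (ennreal (erlang_density i lam x) * ennreal (f x))
          + ennreal b * (ennreal (erlang_density i lam x) * ennreal (g x)) \<partial>lborel)"
    unfolding erlang_mean_def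
  proof (rule nn_integral_cong)
    fix x
    show "ennreal (erlang_density i lam x) * ennreal (a * f x + b * g x)
      = ennreal a * (ennreal (erlang_density i lam x) * ennreal (f x))
          + ennreal b * (ennreal (erlang_density i lam x) * ennreal (g x))"
    proof (cases "0 \<le> x")
      case True
      then have "ennreal (a * f x + b * g x) = ennreal a * ennreal (f x) + ennreal b * ennreal (g x)"
        using assms by (simp add: ennreal_mult)
      then show ?thesis by (simp only: distrib_left mult.left_commute)
    qed (simp add: erlang_density_def)
  qed
  then show ?thesis by (simp add: nn_integral_add nn_integral_cmult erlang_mean_def)
qed

lemma erlang_mean_le_1:
  assumes "0 < lam" "\<And>x. 0 \<le> x \<Longrightarrow> f x \<le> 1"
  shows "erlang_mean lam i f \<le> 1"
proof -
  have "erlang_mean lam i f \<le> (\<integral>\<^sup>+x. ennreal (erlang_density i lam x) \<partial>lborel)"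
    unfolding erlang_mean_def
  proof (rule nn_integral_mono)
    fix x
    show "ennreal (erlang_density i lam x) * ennreal (f x) \<le> ennreal (erlang_density i lam x)"
      using mult_left_mono[of "ennreal (f x)" 1 "ennreal (erlang_density i lam x)"] assms(2)[of x]
      by (cases "0 \<le> x") (auto simp: erlang_density_def[of _ _ x])
  qed
  then show ?thesis using assms(1) by (simp add: nn_integral_erlang_density_1)
qed

lemma erlang_mean_eq_integral:
  assumes lam: "0 < lam" and [measurable]: "f \<in> borel_measurable borel"
    and f: "\<And>x. 0 \<le> x \<Longrightarrow> 0 \<le> f x" "\<And>x. 0 \<le> x \<Longrightarrow> f x \<le> 1"
  shows "erlang_mean lam i f
    = ennreal (lam ^ Suc i / fact i * (LBINT x:{0..}. exp (- lam * x) * x ^ i * f x))"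
proof -
  let ?g = "\<lambda>x. erlang_density i lam x * f x"
  have "integrable lborel (erlang_density i lam)"
    using lam by (intro integrableI_nonneg) (auto simp: nn_integral_erlang_density_1)
  then have int: "integrable lborel ?g"
  proof (rule Bochner_Integration.integrable_bound)
    show "AE x in lborel. norm (erlang_density i lam x * f x) \<le> norm (erlang_density i lam x)"
    proof (rule AE_I2)
      fix x
      show "norm (erlang_density i lam x * f x) \<le> norm (erlang_density i lam x)"
        using mult_left_mono[of "\<bar>f x\<bar>" 1 "\<bar>erlang_density i lam x\<bar>"] f[of x]
        by (cases "0 \<le> x") (auto simp: abs_mult erlang_density_def[of _ _ x])
    qed
  qed simp
  have "erlang_mean lam i f = (\<integral>\<^sup>+x. ennreal (?g x) \<partial>lborel)"
    unfolding erlang_mean_def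
  proof (rule nn_integral_cong)
    show "ennreal (erlang_density i lam x) * ennreal (f x) = ennreal (?g x)" for x
      using f[of x] lam by (cases "0 \<le> x") (auto simp: ennreal_mult, simp add: erlang_density_def)
  qed
  also have "\<dots> = ennreal (\<integral>x. ?g x \<partial>lborel)"
  proof (rule nn_integral_eq_integral[OF int], rule AE_I2)
    show "0 \<le> ?g x" for x using f[of x] lam by (cases "0 \<le> x") (auto simp: erlang_density_def[of _ _ x])
  qed
  also have "(\<integral>x. ?g x \<partial>lborel)
      = (\<integral>x. (lam ^ Suc i / fact i) * (indicator {0..} x *\<^sub>R (exp (- lam * x) * x ^ i * f x)) \<partial>lborel)"
    by (intro Bochner_Integration.integral_cong refl) (auto simp: erlang_density_def indicator_def)
  also have "\<dots> = lam ^ Suc i / fact i * (LBINT x:{0..}. exp (- lam * x) * x ^ i * f x)"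
    unfolding set_lebesgue_integral_def by (rule integral_mult_right_zero)
  finally show ?thesis .
qed

lemma C_le_imp_erlang_mean_le:
  assumes "0 < lam" "C_le lam f g" "f \<in> borel_measurable borel" "g \<in> borel_measurable borel"
    and "\<And>x. 0 \<le> x \<Longrightarrow> 0 \<le> f x \<and> f x \<le> 1" "\<And>x. 0 \<le> x \<Longrightarrow> 0 \<le> g x \<and> g x \<le> 1"
  shows "erlang_mean lam i g \<le> erlang_mean lam i f"
proof -
  have "(LBINT x:{0..}. exp (- lam * x) * x ^ i * g x) \<le> (LBINT x:{0..}. exp (- lam * x) * x ^ i * f x)"
    using assms(2) by (auto simp: C_le_def)
  moreover have "0 \<le> lam ^ Suc i / fact i" using assms(1) by simp
  ultimately have "ennreal (lam ^ Suc i / fact i * (LBINT x:{0..}. exp (- lam * x) * x ^ i * g x))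
      \<le> ennreal (lam ^ Suc i / fact i * (LBINT x:{0..}. exp (- lam * x) * x ^ i * f x))"
    by (intro ennreal_leI mult_left_mono)
  then show ?thesis
    using assms by (simp only: erlang_mean_eq_integral)
qed

lemma residual_cdf_bounds: "0 \<le> residual_cdf F y x"
  "prob_space F \<Longrightarrow> sets F = sets borel \<Longrightarrow> residual_cdf F y x \<le> 1"
proof -
  show "0 \<le> residual_cdf F y x" by (simp add: residual_cdf_def cond_prob_def)
  assume F: "prob_space F" "sets F = sets borel"
  interpret prob_space F by fact
  have [simp]: "space F = UNIV" using sets_eq_imp_space_eq[OF F(2)] by simp
  have "measure F {z \<in> space F. z \<le> x + y \<and> y < z} \<le> measure F {z \<in> space F. y < z}"
    using F(2) by (intro finite_measure_mono) auto
  then show "residual_cdf F y x \<le> 1"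
    unfolding residual_cdf_def cond_prob_def
    by (cases "measure F {z \<in> space F. y < z} = 0") (auto simp: divide_le_eq_1 zero_less_measure_iff)
qed

lemma borel_measurable_residual_cdf [measurable]:
  assumes F: "prob_space F" "sets F = sets borel"
  shows "residual_cdf F y \<in> borel_measurable borel"
proof (rule borel_measurable_mono, rule monoI)
  interpret prob_space F by fact
  have [simp]: "space F = UNIV" using sets_eq_imp_space_eq[OF F(2)] by simp
  fix x x' :: real assume "x \<le> x'"
  then show "residual_cdf F y x \<le> residual_cdf F y x'"
    unfolding residual_cdf_def cond_prob_def using F(2)
    by (intro divide_right_mono finite_measure_mono) auto
qed

lemma (in real_distribution) prob_greater: "\<P>(z in M. y < z) = 1 - cdf M y"
proof -
  have "{z \<in> space M. y < z} = space M - {..y}" by auto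
  then show ?thesis by (simp only: cdf_def) (subst prob_compl, auto)
qed

lemma (in real_distribution) residual_cdf_eq:
  assumes "0 \<le> x"
  shows "residual_cdf M y x = (cdf M (x + y) - cdf M y) / (1 - cdf M y)"
proof -
  have "\<P>(z in M. z \<le> x + y \<and> y < z) = measure M {y<..x + y}"
    by (rule arg_cong[where f="measure M"]) auto
  also have "\<dots> = cdf M (x + y) - cdf M y"
    using cdf_diff_eq[of y "x + y"] assms by (cases "x = 0") auto
  finally show ?thesis by (simp only: residual_cdf_def cond_prob_def prob_greater)
qed

text \<open>
  In this product form the identity holds for every age \<open>y\<close>, also when no life exceeds \<open>y\<close>.
\<close>

lemma (in real_distribution) cdf_increment_eq_residual:
  assumes "0 \<le> x"
  shows "cdf M (x + y) - cdf M y = (1 - cdf M y) * residual_cdf M y x"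
proof (cases "cdf M y = 1")
  case True
  then show ?thesis using cdf_nondecreasing[of y "x + y"] cdf_bounded_prob[of "x + y"] assms by simp
next
  case False
  then show ?thesis using residual_cdf_eq[OF assms, of y] by simp
qed

lemma erlang_mean_exponential:
  assumes lam: "0 < lam" and mu: "0 < mu"
  shows "erlang_mean lam 0 (\<lambda>x. 1 - exp (- mu * x)) = ennreal (1 - lam / (lam + mu))"
proof -
  have "erlang_mean lam 0 (\<lambda>x. exp (- mu * x)) = (\<integral>\<^sup>+x. ennreal (lam / (lam + mu)) * ennreal (erlang_density 0 (lam + mu) x) \<partial>lborel)"
    unfolding erlang_mean_def
  proof (rule nn_integral_cong)
    fix x
    have "exp (- lam * x) * exp (- mu * x) = exp (- (lam + mu) * x)"
      by (simp add: mult_exp_exp algebra_simps)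
    then have "erlang_density 0 lam x * exp (- mu * x) = lam / (lam + mu) * erlang_density 0 (lam + mu) x"
      using lam mu by (simp add: erlang_density_def)
    then show "ennreal (erlang_density 0 lam x) * ennreal (exp (- mu * x))
      = ennreal (lam / (lam + mu)) * ennreal (erlang_density 0 (lam + mu) x)"
      using lam mu by (simp add: ennreal_mult[symmetric])
  qed
  also have "\<dots> = ennreal (lam / (lam + mu))"
    using lam mu by (simp add: nn_integral_cmult nn_integral_erlang_density_1)
  finally have 1: "erlang_mean lam 0 (\<lambda>x. exp (- mu * x)) = ennreal (lam / (lam + mu))" .
  have "erlang_mean lam 0 (\<lambda>x. 1 * (1 - exp (- mu * x)) + 1 * exp (- mu * x))
      = ennreal 1 * erlang_mean lam 0 (\<lambda>x. 1 - exp (- mu * x)) + ennreal 1 * erlang_mean lam 0 (\<lambda>x. exp (- mu * x))"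
    using mu by (intro erlang_mean_add) auto
  moreover have "erlang_mean lam 0 (\<lambda>x. 1) = 1"
    using lam by (simp add: erlang_mean_def nn_integral_erlang_density_1)
  ultimately have "1 = erlang_mean lam 0 (\<lambda>x. 1 - exp (- mu * x)) + ennreal (lam / (lam + mu))"
    using 1 by simp
  then have "erlang_mean lam 0 (\<lambda>x. 1 - exp (- mu * x)) = 1 - ennreal (lam / (lam + mu))"
    by (metis ennreal_add_diff_cancel_right ennreal_neq_top)
  also have "\<dots> = ennreal (1 - lam / (lam + mu))"
    using lam mu by (subst ennreal_minus[symmetric]) auto
  finally show ?thesis .
qed

section \<open>The offspring generating function\<close>

lemma pmf_delayed_geometric:
  assumes "0 \<le> \<beta>" "\<beta> \<le> 1" "0 < b" "b \<le> 1"
  shows "pmf (delayed_geometric \<beta> b) 0 = \<beta>"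
    and "pmf (delayed_geometric \<beta> b) (Suc k) = (1 - \<beta>) * ((1 - b) ^ k * b)"
proof -
  have "pmf (map_pmf Suc (geometric_pmf b)) 0 = 0" by (intro pmf_map_outside) auto
  then show "pmf (delayed_geometric \<beta> b) 0 = \<beta>"
    using assms by (simp add: delayed_geometric_def pmf_bind)
  show "pmf (delayed_geometric \<beta> b) (Suc k) = (1 - \<beta>) * ((1 - b) ^ k * b)"
    using assms by (simp add: delayed_geometric_def pmf_bind pmf_map_inj' mult.commute)
qed

lemma pgf_delayed_geometric:
  assumes \<beta>: "0 \<le> \<beta>" "\<beta> \<le> 1" and b: "0 < b" "b \<le> 1" and z: "\<bar>z\<bar> \<le> 1"
  shows "pgf (delayed_geometric \<beta> b) z = (\<beta> * (1 - z) + z * b) / (1 - z + z * b)"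
proof -
  have lt: "\<bar>(1 - b) * z\<bar> < 1"
    using b mult_left_mono[OF z, of "1 - b"] by (simp add: abs_mult)
  have "(\<lambda>k. ((1 - b) * z) ^ k) sums (1 / (1 - (1 - b) * z))"
    using lt by (intro geometric_sums) simp
  then have "(\<lambda>k. (1 - \<beta>) * b * z * ((1 - b) * z) ^ k) sums ((1 - \<beta>) * b * z * (1 / (1 - (1 - b) * z)))"
    by (rule sums_mult)
  then have "(\<lambda>k. pmf (delayed_geometric \<beta> b) (Suc k) * z ^ Suc k) sums ((1 - \<beta>) * b * z / (1 - (1 - b) * z))"
    using \<beta> b by (simp add: pmf_delayed_geometric power_mult_distrib mult_ac)
  then have "(\<lambda>k. pmf (delayed_geometric \<beta> b) k * z ^ k) sums ((1 - \<beta>) * b * z / (1 - (1 - b) * z) + \<beta>)"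
    using \<beta> b by (subst (asm) sums_Suc_iff) (simp add: pmf_delayed_geometric)
  then have "pgf (delayed_geometric \<beta> b) z = (1 - \<beta>) * b * z / (1 - (1 - b) * z) + \<beta>"
    by (simp add: pgf_def sums_iff)
  also have "\<dots> = (\<beta> * (1 - z) + z * b) / (1 - z + z * b)"
  proof -
    have "1 - (1 - b) * z = 1 - z + z * b" by (simp add: algebra_simps)
    moreover have "1 - z + z * b \<noteq> 0" using lt by (auto simp: algebra_simps)
    ultimately show ?thesis by (simp add: field_simps)
  qed
  finally show ?thesis .
qed

text \<open>
  Both sides have the same positive denominator.  After subtraction the claim is
  \<open>(\<beta> - b) (1 - z) < 5 eps (1 - z + 2 z b)\<close>, and
  \<open>(1 - b) (1 - z) \<le> 1 - z + 2 z b\<close> is equivalent to \<open>0 \<le> b (1 + z)\<close>.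
\<close>

lemma pgf_delayed_geometric_less:
  assumes \<beta>: "0 \<le> \<beta>" "\<beta> \<le> 1" and b: "0 < b" "b < 1" and z: "\<bar>z\<bar> \<le> 1"
    and eps: "0 < eps" and key: "\<beta> - b < 5 * eps * (1 - b)"
  shows "pgf (delayed_geometric \<beta> b) z
    < b / (1 - z + z * b) + 5 * eps * ((1 - z + 2 * z * b) / (1 - z + z * b))"
proof -
  have zb: "\<bar>(1 - b) * z\<bar> < 1"
  proof -
    have "(1 - b) * \<bar>z\<bar> \<le> (1 - b) * 1" using b z by (intro mult_left_mono) auto
    also have "\<dots> < 1" using b by simp
    finally show ?thesis using b by (simp add: abs_mult)
  qed
  then have D: "0 < 1 - z + z * b" by (auto simp: algebra_simps)
  have "(\<beta> - b) * (1 - z) < 5 * eps * (1 - z + 2 * z * b)"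
  proof (cases "z = 1")
    case True
    then show ?thesis using eps b by simp
  next
    case False
    then have "0 < 1 - z" using z by auto
    then have "(\<beta> - b) * (1 - z) < 5 * eps * (1 - b) * (1 - z)"
      using key by (rule mult_strict_right_mono[rotated])
    also have "\<dots> = 5 * eps * ((1 - b) * (1 - z))" by simp
    also have "\<dots> \<le> 5 * eps * (1 - z + 2 * z * b)"
    proof (rule mult_left_mono)
      have "0 \<le> b * (1 + z)" using b z by simp
      then show "(1 - b) * (1 - z) \<le> 1 - z + 2 * z * b" by (simp add: algebra_simps)
    qed (use eps in simp)
    finally show ?thesis .
  qed
  then have "\<beta> * (1 - z) + z * b < b + 5 * eps * (1 - z + 2 * z * b)" by (simp add: algebra_simps)
  then have "(\<beta> * (1 - z) + z * b) / (1 - z + z * b) < (b + 5 * eps * (1 - z + 2 * z * b)) / (1 - z + z * b)"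
    using D by (rule divide_strict_right_mono)
  also have "(b + 5 * eps * (1 - z + 2 * z * b)) / (1 - z + z * b)
      = b / (1 - z + z * b) + 5 * eps * ((1 - z + 2 * z * b) / (1 - z + z * b))"
    by (subst add_divide_distrib) simp
  finally show ?thesis
    using pgf_delayed_geometric[OF \<beta> b(1) less_imp_le[OF b(2)] z] by (simp only:)
qed

section \<open>The gap between the void probabilities\<close>

text \<open>
  The transform of a residual tail in terms of the probability that no Poisson arrival
  occurs during the residual life.
\<close>

lemma laplace_tail_eq_residual:
  assumes lam: "0 < lam" and F: "real_distribution F" and y: "0 \<le> y"
  shows "laplace_tail (\<lambda>x. 1 - cdf F x) lam y
    = ennreal ((1 - cdf F y) * (1 - enn2real (erlang_mean lam 0 (residual_cdf F y))) / lam)"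
proof -
  interpret F: real_distribution F by fact
  have [measurable]: "cdf F \<in> borel_measurable borel"
    by (rule borel_measurable_mono) (auto intro!: monoI F.cdf_nondecreasing)
  have [measurable]: "residual_cdf F y \<in> borel_measurable borel"
    by (rule borel_measurable_residual_cdf) (auto intro: F.prob_space_axioms)
  have res: "0 \<le> residual_cdf F y x" "residual_cdf F y x \<le> 1" for x
    using residual_cdf_bounds(1) residual_cdf_bounds(2)[of F] F.prob_space_axioms by auto
  define Q where "Q = enn2real (erlang_mean lam 0 (residual_cdf F y))"
  have Q1: "erlang_mean lam 0 (residual_cdf F y) \<le> 1"
    using lam res by (intro erlang_mean_le_1) auto
  then have Q: "erlang_mean lam 0 (residual_cdf F y) = ennreal Q"
    unfolding Q_def using le_less_trans[OF Q1 ennreal_one_less_top] by simp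
  have Q01: "0 \<le> Q" "Q \<le> 1" using Q1 unfolding Q by (auto simp: Q_def)
  have "erlang_mean lam 0 (\<lambda>x. 1 * (1 - residual_cdf F y x) + 1 * residual_cdf F y x)
      = ennreal 1 * erlang_mean lam 0 (\<lambda>x. 1 - residual_cdf F y x) + ennreal 1 * erlang_mean lam 0 (residual_cdf F y)"
    using res by (intro erlang_mean_add) auto
  moreover have "erlang_mean lam 0 (\<lambda>x. 1) = 1"
    using lam by (simp add: erlang_mean_def nn_integral_erlang_density_1)
  ultimately have "1 = erlang_mean lam 0 (\<lambda>x. 1 - residual_cdf F y x) + ennreal Q"
    by (simp add: Q)
  then have "erlang_mean lam 0 (\<lambda>x. 1 - residual_cdf F y x) = 1 - ennreal Q"
    by (metis ennreal_add_diff_cancel_right ennreal_neq_top)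
  also have "\<dots> = ennreal (1 - Q)"
    using Q01 by (simp add: ennreal_minus flip: ennreal_1)
  finally have W: "erlang_mean lam 0 (\<lambda>x. 1 - residual_cdf F y x) = ennreal (1 - Q)" .
  have Hy: "0 \<le> 1 - cdf F y" using F.cdf_bounded_prob[of y] by simp
  have surv: "1 - cdf F (x + y) = (1 - cdf F y) * (1 - residual_cdf F y x)" if "0 \<le> x" for x
    using F.cdf_increment_eq_residual[OF that, of y] by (simp add: algebra_simps)
  have "ennreal lam * laplace_tail (\<lambda>x. 1 - cdf F x) lam y
    = (\<integral>\<^sup>+x. ennreal lam * (ennreal (exp (- lam * x)) * (ennreal (1 - cdf F (x + y)) * indicator {0..} x)) \<partial>lborel)"
    unfolding laplace_tail_def by (rule nn_integral_cmult[symmetric]) measurable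
  also have "\<dots> = (\<integral>\<^sup>+x. ennreal (1 - cdf F y) * (ennreal (erlang_density 0 lam x) * ennreal (1 - residual_cdf F y x)) \<partial>lborel)"
  proof (rule nn_integral_cong)
    fix x
    show "ennreal lam * (ennreal (exp (- lam * x)) * (ennreal (1 - cdf F (x + y)) * indicator {0..} x))
      = ennreal (1 - cdf F y) * (ennreal (erlang_density 0 lam x) * ennreal (1 - residual_cdf F y x))"
      using lam Hy res[of x] surv[of x]
      by (cases "0 \<le> x") (auto simp: erlang_density_def ennreal_mult mult_ac)
  qed
  also have "\<dots> = ennreal (1 - cdf F y) * ennreal (1 - Q)"
    unfolding W[symmetric] erlang_mean_def by (rule nn_integral_cmult) measurable
  also have "\<dots> = ennreal lam * ennreal ((1 - cdf F y) * (1 - Q) / lam)"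
    using lam Hy Q01 by (simp add: ennreal_mult[symmetric])
  finally show ?thesis
    using lam by (simp add: ennreal_mult_cancel_left Q_def)
qed

lemma nn_integral_survival:
  assumes F: "nonneg_law F" and mean: "has_bochner_integral F (\<lambda>x. x) m"
  shows "(\<integral>\<^sup>+x. ennreal (1 - cdf F x) * indicator {0..} x \<partial>lborel) = ennreal m"
proof -
  interpret F: real_distribution F using F by (simp add: nonneg_law_def)
  have nn: "AE z in F. 0 \<le> z" using F by (simp add: nonneg_law_def)
  have "(\<integral>\<^sup>+x. ennreal (1 - cdf F x) * indicator {0..} x \<partial>lborel)
      = (\<integral>\<^sup>+x. (\<integral>\<^sup>+z. indicator {(x, z). 0 \<le> x \<and> x < z} (x, z) \<partial>F) \<partial>lborel)"
  proof (rule nn_integral_cong)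
    fix x :: real
    have "(\<integral>\<^sup>+z. indicator {(x, z). 0 \<le> x \<and> x < z} (x, z) \<partial>F) = (\<integral>\<^sup>+z. indicator {0..} x * indicator {x<..} z \<partial>F)"
      by (intro nn_integral_cong) (auto simp: indicator_def)
    also have "\<dots> = indicator {0..} x * emeasure F {x<..}"
      by (simp add: nn_integral_cmult)
    also have "emeasure F {x<..} = ennreal (1 - cdf F x)"
      using F.prob_greater[of x] by (simp add: F.emeasure_eq_measure greaterThan_def)
    finally show "ennreal (1 - cdf F x) * indicator {0..} x = (\<integral>\<^sup>+z. indicator {(x, z). 0 \<le> x \<and> x < z} (x, z) \<partial>F)"
      by (simp add: mult.commute)
  qed
  also have "\<dots> = (\<integral>\<^sup>+z. (\<integral>\<^sup>+x. indicator {(x, z). 0 \<le> x \<and> x < z} (x, z) \<partial>lborel) \<partial>F)"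
    by (rule pair_sigma_finite.Fubini')
       (auto simp: pair_sigma_finite_def lborel.sigma_finite_measure_axioms F.sigma_finite_measure_axioms)
  also have "\<dots> = (\<integral>\<^sup>+z. ennreal z \<partial>F)"
    using nn
  proof (intro nn_integral_cong_AE, eventually_elim)
    case (elim z)
    have "(\<integral>\<^sup>+x. indicator {(x, z). 0 \<le> x \<and> x < z} (x, z) \<partial>lborel) = (\<integral>\<^sup>+x. indicator {0..<z} x \<partial>lborel)"
      by (intro nn_integral_cong) (auto simp: indicator_def)
    then show ?case using elim by simp
  qed
  also have "\<dots> = ennreal m"
    using mean nn by (subst nn_integral_eq_integral) (auto simp: has_bochner_integral_iff)
  finally show ?thesis .
qed

lemma LST_eq_erlang_mean:
  assumes "0 < lam" "nonneg_law G"
  shows "ennreal (LST G lam) = erlang_mean lam 0 (cdf G)"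
    and "LST G lam = pmf (poisson_mixture lam G) 0"
proof -
  show eq: "LST G lam = pmf (poisson_mixture lam G) 0"
    using assms by (simp add: pmf_poisson_mixture LST_def)
  have "{..0::nat} = {0}" by auto
  then show "ennreal (LST G lam) = erlang_mean lam 0 (cdf G)"
    unfolding eq emeasure_poisson_mixture_atMost[OF assms, symmetric]
    by (simp add: emeasure_pmf_single)
qed

lemma survival_near_multiplicative:
  assumes F: "real_distribution F"
    and close: "(SUP (x, y) \<in> {(x, y). x \<ge> 0 \<and> y \<ge> 0 \<and> \<P>(z in F. z > y) > 0}.
                     \<bar>residual_cdf F y x - cdf F x\<bar>) = d"
    and xy: "0 \<le> x" "0 \<le> y"
  shows "\<bar>(1 - cdf F (x + y)) - (1 - cdf F x) * (1 - cdf F y)\<bar> \<le> d * (1 - cdf F y)"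
proof -
  interpret F: real_distribution F by fact
  let ?V = "{(x, y). x \<ge> 0 \<and> y \<ge> 0 \<and> \<P>(z in F. z > y) > 0}"
  let ?f = "\<lambda>(x, y). \<bar>residual_cdf F y x - cdf F x\<bar>"
  have res: "0 \<le> residual_cdf F y x" "residual_cdf F y x \<le> 1" for x y
    using residual_cdf_bounds(1) residual_cdf_bounds(2)[of F] F.prob_space_axioms by auto
  have "\<bar>residual_cdf F y x - cdf F x\<bar> \<le> 1" for x y
    using res[of y x] F.cdf_nonneg[of x] F.cdf_bounded_prob[of x] by auto
  then have "bdd_above (?f ` ?V)" by (intro bdd_aboveI2[of _ _ 1]) auto
  then have *: "\<bar>residual_cdf F y x - cdf F x\<bar> \<le> d" if "0 < 1 - cdf F y"
    unfolding close[symmetric] using xy that F.prob_greater[of y]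
    by (intro cSUP_upper2[of _ _ "(x, y)"]) auto
  show ?thesis
  proof (cases "0 < 1 - cdf F y")
    case True
    have "(1 - cdf F (x + y)) - (1 - cdf F x) * (1 - cdf F y)
        = (1 - cdf F y) * (cdf F x - residual_cdf F y x)"
      using F.cdf_increment_eq_residual[OF xy(1), of y] by (simp add: algebra_simps)
    then have "\<bar>(1 - cdf F (x + y)) - (1 - cdf F x) * (1 - cdf F y)\<bar>
        = (1 - cdf F y) * \<bar>residual_cdf F y x - cdf F x\<bar>"
      using True by (simp add: abs_mult abs_minus_commute)
    also have "\<dots> \<le> (1 - cdf F y) * d" using True * by (intro mult_left_mono) auto
    finally show ?thesis by (simp add: mult.commute)
  next
    case False
    then have "cdf F y = 1" using F.cdf_bounded_prob[of y] by simp
    moreover have "cdf F (x + y) = 1"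
      using F.cdf_nondecreasing[of y "x + y"] F.cdf_bounded_prob[of "x + y"] xy \<open>cdf F y = 1\<close> by simp
    ultimately show ?thesis by simp
  qed
qed

text \<open>
  A residual life is positive with positive probability because distribution functions are
  right-continuous.
\<close>

lemma residual_void_probability_less_1:
  assumes lam: "0 < lam" and F: "real_distribution F" and y: "0 \<le> y" "cdf F y < 1"
  shows "enn2real (erlang_mean lam 0 (residual_cdf F y)) < 1"
proof -
  interpret F: real_distribution F by fact
  have [measurable]: "cdf F \<in> borel_measurable borel"
    by (rule borel_measurable_mono) (auto intro!: monoI F.cdf_nondecreasing)
  have "(cdf F \<longlongrightarrow> cdf F y) (at_right y)"
    using F.cdf_is_right_cont[of y] by (simp add: continuous_within)
  then have "eventually (\<lambda>x. cdf F x < 1) (at_right y)"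
    using y(2) by (rule order_tendstoD)
  then obtain b where b: "y < b" "\<And>x. y < x \<Longrightarrow> x < b \<Longrightarrow> cdf F x < 1"
    by (auto simp: eventually_at_right_field)
  have "laplace_tail (\<lambda>x. 1 - cdf F x) lam y \<noteq> 0"
  proof
    assume "laplace_tail (\<lambda>x. 1 - cdf F x) lam y = 0"
    then have "AE x in lborel. ennreal (exp (- lam * x)) * (ennreal (1 - cdf F (x + y)) * indicator {0..} x) = 0"
      unfolding laplace_tail_def by (subst (asm) nn_integral_0_iff_AE) auto
    then have "AE x in lborel. x \<notin> {0<..<b - y}"
    proof eventually_elim
      case (elim x)
      then show ?case using b(2)[of "x + y"] by (auto simp: indicator_def ennreal_eq_0_iff)
    qed
    then have "emeasure lborel {x. 0 < x \<and> x < b - y} = 0"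
      by (subst (asm) AE_iff_measurable[OF _ refl]) auto
    moreover have "{x. 0 < x \<and> x < b - y} = {0<..<b - y}" by auto
    ultimately have "emeasure lborel {0<..<b - y} = 0" by (simp only:)
    then show False using b(1) by simp
  qed
  then have "(1 - cdf F y) * (1 - enn2real (erlang_mean lam 0 (residual_cdf F y))) / lam > 0"
    unfolding laplace_tail_eq_residual[OF lam F y(1)] by (simp add: ennreal_eq_0_iff not_le)
  then show ?thesis using lam y by (simp add: zero_less_divide_iff zero_less_mult_iff)
qed

text \<open>
  Translation of the bounds for transforms: \<open>1 - \<beta> = lam * r\<close> and \<open>1 - Bhat = lam * Rm\<close>, where \<open>Rm\<close> is the
  mixture of the transform \<open>R\<close> of the tail of \<open>F\<close> with \<open>1 / (lam + mu)\<close>.  For \<open>5 * eps \<ge> 1\<close> the claim only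
  says that \<open>\<beta> < 1\<close>.
\<close>

lemma void_probability_gap:
  fixes lam mu eps p y0 :: real
  assumes lam: "0 < lam" and mu: "0 < mu" and eps: "0 < eps" and p: "0 < p" "p \<le> 1"
    and F_law: "nonneg_law F" and mean: "has_bochner_integral F (\<lambda>x. x) (1 / mu)"
    and F0: "cdf F 0 = 0"
    and close: "(SUP (x, y) \<in> {(x, y). x \<ge> 0 \<and> y \<ge> 0 \<and> \<P>(z in F. z > y) > 0}.
                     \<bar>residual_cdf F y x - cdf F x\<bar>) < eps"
    and y0: "y0 \<ge> 0" "cdf F y0 < 1"
    and least: "\<And>y. y \<ge> 0 \<Longrightarrow> cdf F y < 1 \<Longrightarrow>
       erlang_mean lam 0 (residual_cdf F y) \<le> erlang_mean lam 0 (residual_cdf F y0)"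
  defines "\<beta> \<equiv> enn2real (erlang_mean lam 0 (residual_cdf F y0))"
    and "Bhat \<equiv> p * LST F lam + (1 - p) * (mu / (mu + lam))"
  shows "0 \<le> \<beta>" "\<beta> < 1" "0 < Bhat" "Bhat < 1"
    "erlang_mean lam 0 (residual_cdf F y0) = ennreal \<beta>"
    "erlang_mean lam 0 (\<lambda>x. 1 - exp (- mu * x)) \<le> ennreal \<beta>"
    "\<beta> - Bhat < 5 * eps * (1 - Bhat)"
proof -
  interpret F: real_distribution F using F_law by (simp add: nonneg_law_def)
  have [measurable]: "cdf F \<in> borel_measurable borel"
    by (rule borel_measurable_mono) (auto intro!: monoI F.cdf_nondecreasing)
  define d where "d = (SUP (x, y) \<in> {(x, y). x \<ge> 0 \<and> y \<ge> 0 \<and> \<P>(z in F. z > y) > 0}.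
                     \<bar>residual_cdf F y x - cdf F x\<bar>)"
  define H where "H = (\<lambda>x. 1 - cdf F x)"
  define r where "r = (1 - \<beta>) / lam"
  define R where "R = (1 - LST F lam) / lam"
  have H_borel: "H \<in> borel_measurable borel" unfolding H_def by measurable
  have H_nonneg: "0 \<le> H x" for x using F.cdf_bounded_prob[of x] by (simp add: H_def)
  have H_mean: "(\<integral>\<^sup>+x. ennreal (H x) * indicator {0..} x \<partial>lborel) = ennreal (1 / mu)"
    unfolding H_def by (rule nn_integral_survival[OF F_law mean])
  have H_mult: "\<bar>H (x + y) - H x * H y\<bar> \<le> d * H y" if "0 \<le> x" "0 \<le> y" for x y
    unfolding H_def using survival_near_multiplicative[OF F.real_distribution_axioms d_def[symmetric] that] .
  have d: "0 \<le> d" using H_mult[of 0 0] F0 by (simp add: H_def)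
  have d_eps: "d < eps" using close by (simp add: d_def)
  have res: "0 \<le> residual_cdf F y x" "residual_cdf F y x \<le> 1" for x y
    using residual_cdf_bounds(1) residual_cdf_bounds(2)[of F] F.prob_space_axioms by auto
  have fin: "erlang_mean lam 0 (residual_cdf F y) < \<top>" for y
    using erlang_mean_le_1[OF lam, of "residual_cdf F y"] res by (auto intro: le_less_trans[OF _ ennreal_one_less_top])
  show \<beta>_eq: "erlang_mean lam 0 (residual_cdf F y0) = ennreal \<beta>"
    using fin by (simp add: \<beta>_def)
  show \<beta>0: "0 \<le> \<beta>" by (simp add: \<beta>_def)
  show \<beta>1: "\<beta> < 1"
    unfolding \<beta>_def by (rule residual_void_probability_less_1[OF lam F.real_distribution_axioms y0])
  have r: "0 < r" using \<beta>1 lam by (simp add: r_def)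
  have tail: "laplace_tail H lam y = ennreal (H y * (1 - enn2real (erlang_mean lam 0 (residual_cdf F y))) / lam)"
    if "0 \<le> y" for y
    unfolding H_def by (rule laplace_tail_eq_residual[OF lam F.real_distribution_axioms that])
  have tail_y0: "laplace_tail H lam y0 = ennreal (r * H y0)"
    using tail[OF y0(1)] by (simp add: r_def \<beta>_def mult.commute)
  have min: "ennreal (r * H y) \<le> laplace_tail H lam y" if "0 \<le> y" for y
  proof (cases "cdf F y < 1")
    case True
    have "enn2real (erlang_mean lam 0 (residual_cdf F y)) \<le> \<beta>"
      unfolding \<beta>_def using least[OF that True] fin by (intro enn2real_mono) auto
    then have "r * H y \<le> H y * (1 - enn2real (erlang_mean lam 0 (residual_cdf F y))) / lam"
      using lam mult_left_mono[of "1 - \<beta>" "1 - enn2real (erlang_mean lam 0 (residual_cdf F y))" "H y"] H_nonneg[of y]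
      by (simp add: r_def mult.commute divide_right_mono)
    then show ?thesis unfolding tail[OF that] by (rule ennreal_leI)
  next
    case False
    then have "H y = 0" using F.cdf_bounded_prob[of y] by (simp add: H_def)
    then show ?thesis by simp
  qed
  have LST0: "erlang_mean lam 0 (residual_cdf F 0) = ennreal (LST F lam)"
  proof -
    have "erlang_mean lam 0 (residual_cdf F 0) = erlang_mean lam 0 (cdf F)"
      using F.residual_cdf_eq[of _ 0] F0 by (intro erlang_mean_cong) auto
    then show ?thesis using LST_eq_erlang_mean(1)[OF lam F_law] by simp
  qed
  have LST_nonneg: "0 \<le> LST F lam" using LST_eq_erlang_mean(2)[OF lam F_law] by simp
  have LST_le: "LST F lam \<le> \<beta>"
    using least[of 0] F0 unfolding LST0 \<beta>_eq using \<beta>0 by simp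
  have LST_pos: "0 < LST F lam"
  proof -
    have "LST F lam \<noteq> 0"
    proof
      assume "LST F lam = 0"
      then have "(\<integral>\<^sup>+x. ennreal (erlang_density 0 lam x / lam) \<partial>F) = 0"
        using ennreal_pmf_poisson_mixture[OF lam F_law, of 0] LST_eq_erlang_mean(2)[OF lam F_law] by simp
      then have "AE x in F. ennreal (erlang_density 0 lam x / lam) = 0"
        by (subst (asm) nn_integral_0_iff_AE) auto
      moreover have "AE x in F. 0 \<le> x" using F_law by (simp add: nonneg_law_def)
      ultimately have "AE x in F. False"
        by eventually_elim (use lam in \<open>auto simp: erlang_density_def ennreal_eq_0_iff divide_le_0_iff\<close>)
      then show False using F.AE_False by simp
    qed
    then show ?thesis using LST_nonneg by simp
  qed
  have tail_0: "laplace_tail H lam 0 = ennreal R"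
    using tail[of 0] F0 LST0 LST_nonneg by (simp add: R_def H_def)
  have R: "r \<le> R" "0 \<le> R" using LST_le lam r by (auto simp: r_def R_def divide_right_mono intro: order_trans[of 0 r])
  have "lam * r + mu * R \<le> 1"
    using minimum_le_transforms[OF lam mu d less_imp_le[OF r] H_borel H_nonneg H_mean H_mult min] R lam mu r
    unfolding tail_0 by (simp add: ennreal_mult[symmetric] ennreal_plus[symmetric] del: ennreal_plus)
  moreover have "mu * r \<le> mu * R" using R mu by simp
  moreover have "r * (lam + mu) = lam * r + mu * r" by (simp add: algebra_simps)
  ultimately have "r * (lam + mu) \<le> 1" by linarith
  then have r_E: "r \<le> 1 / (lam + mu)" using lam mu by (simp add: pos_le_divide_eq)
  have "lam * r \<le> lam * (1 / (lam + mu))" using r_E lam by (intro mult_left_mono) auto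
  then have "1 - lam / (lam + mu) \<le> \<beta>" using lam by (simp add: r_def)
  then show "erlang_mean lam 0 (\<lambda>x. 1 - exp (- mu * x)) \<le> ennreal \<beta>"
    unfolding erlang_mean_exponential[OF lam mu] by (rule ennreal_leI)
  define Rm where "Rm = p * R + (1 - p) * (1 / (lam + mu))"
  have "LST F lam = 1 - lam * R" using lam by (simp add: R_def)
  moreover have "mu / (mu + lam) = 1 - lam * (1 / (lam + mu))" using lam mu by (simp add: field_simps)
  ultimately have Bhat: "Bhat = 1 - lam * Rm"
    unfolding Bhat_def Rm_def by (simp only:) (simp add: algebra_simps)
  have "0 < R" using r R by simp
  then have "0 < Rm" unfolding Rm_def using p lam mu by (intro add_pos_nonneg mult_pos_pos) auto
  then show "Bhat < 1" using Bhat lam by simp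
  show "0 < Bhat"
    unfolding Bhat_def using p LST_pos lam mu by (intro add_pos_nonneg mult_pos_pos) auto
  have "(1 - 5 * eps) * Rm < r"
  proof (cases "5 * eps < 1")
    case True
    have Hy0: "0 < H y0" using y0 by (simp add: H_def)
    note frac = minimiser_exceeds_fraction[OF lam mu d less_imp_le[OF r] H_borel H_nonneg H_mean H_mult min
        y0(1) Hy0 tail_y0 tail_0 R(2,1) d_eps True]
    have frac: "(1 - 5 * eps) * R < r" "(1 - 5 * eps) / (lam + mu) < r"
      using frac by auto
    have "(1 - 5 * eps) * Rm = p * ((1 - 5 * eps) * R) + (1 - p) * ((1 - 5 * eps) / (lam + mu))"
    proof -
      have "c * (p * R + (1 - p) * (1 / L)) = p * (c * R) + (1 - p) * (c / L)" for c L :: real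
        by (simp add: algebra_simps diff_divide_distrib)
      then show ?thesis unfolding Rm_def .
    qed
    also have "\<dots> < p * r + (1 - p) * r"
      using p frac
      by (intro add_less_le_mono mult_strict_left_mono mult_left_mono) auto
    finally show ?thesis by (simp add: algebra_simps)
  next
    case False
    then have "(1 - 5 * eps) * Rm \<le> 0" using \<open>0 < Rm\<close> by (intro mult_nonpos_nonneg) auto
    then show ?thesis using r by simp
  qed
  then have "lam * ((1 - 5 * eps) * Rm) < lam * r" using lam by simp
  moreover have "lam * r = 1 - \<beta>" using lam by (simp add: r_def)
  ultimately show "\<beta> - Bhat < 5 * eps * (1 - Bhat)"
    unfolding Bhat by (simp add: algebra_simps)
qed

section \<open>Domination by the branching process\<close>

lemma less_of_nat_iff_nat_floor: "t < real l \<longleftrightarrow> nat (\<lfloor>t\<rfloor> + 1) \<le> l"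
proof -
  have "t < real l \<longleftrightarrow> \<lfloor>t\<rfloor> < int l" by (simp add: floor_less_iff)
  then show ?thesis by auto
qed

lemma prob_galton_watson_random_sum:
  assumes gw: "galton_watson q N Z"
    and ind: "prob_space.indep_vars N (\<lambda>_. count_space UNIV) \<sigma> UNIV"
    and s: "\<And>i m. \<P>(\<omega> in N. \<sigma> i \<omega> = m) = pmf s m"
    and indZ: "indep_sequences N Z \<sigma>"
  shows "\<P>(\<omega> in N. k \<le> (\<Sum>i<Z n \<omega>. \<sigma> i \<omega>))
    = measure (measure_pmf ((compound_pmf q ^^ n) s)) {k..}"
proof -
  interpret prob_space N using gw by (simp add: galton_watson_def)
  have \<sigma> [measurable]: "\<sigma> i \<in> measurable N (count_space UNIV)" for i
    using ind by (auto simp: indep_vars_def)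
  have "(\<lambda>\<omega> i. Z i \<omega>) \<in> measurable N (\<Pi>\<^sub>M i\<in>UNIV. count_space UNIV)"
    using indZ unfolding indep_sequences_def by (rule indep_var_rv1)
  then have Z: "Z n \<in> measurable N (count_space UNIV)"
    by (auto intro: measurable_compose[OF _ measurable_component_singleton])
  have sum: "(\<lambda>\<omega>. \<Sum>i<Z n \<omega>. \<sigma> i \<omega>) \<in> measurable N (count_space UNIV)"
    by (rule measurable_compose_countable[OF _ Z]) (auto intro: measurable_sum_nat)
  have "distr N (count_space UNIV) (\<sigma> i) = measure_pmf s" for i
  proof (rule measure_eqI_countable[where A=UNIV])
    fix m :: nat
    have "emeasure (distr N (count_space UNIV) (\<sigma> i)) {m} = ennreal (\<P>(\<omega> in N. \<sigma> i \<omega> = m))"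
      by (subst emeasure_distr) (auto simp: emeasure_eq_measure intro!: arg_cong[where f=prob])
    then show "emeasure (distr N (count_space UNIV) (\<sigma> i)) {m} = emeasure (measure_pmf s) {m}"
      by (simp add: s emeasure_pmf_single)
  qed auto
  from distr_galton_watson_random_sum[OF gw ind this indZ, of n]
  have "measure (measure_pmf ((compound_pmf q ^^ n) s)) {k..}
      = measure (distr N (count_space UNIV) (\<lambda>\<omega>. \<Sum>i<Z n \<omega>. \<sigma> i \<omega>)) {k..}" by simp
  also have "\<dots> = prob ((\<lambda>\<omega>. \<Sum>i<Z n \<omega>. \<sigma> i \<omega>) -` {k..} \<inter> space N)"
    by (rule measure_distr[OF sum]) simp
  also have "\<dots> = \<P>(\<omega> in N. k \<le> (\<Sum>i<Z n \<omega>. \<sigma> i \<omega>))"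
    by (rule arg_cong[where f=prob]) auto
  finally show ?thesis ..
qed

text \<open>
  At age \<open>y\<close> the increments of \<open>cdf B\<close> are a combination of the residual law of \<open>F\<close> and the memoryless
  exponential law, with weights that add up to \<open>1 - cdf B y\<close>; a common bound \<open>C\<close> for the two
  components is a bound for the mixture.
\<close>

lemma mixture_window_le:
  assumes lam: "0 < lam" and mu: "0 < mu" and p: "0 < p" "p \<le> 1"
    and B_law: "nonneg_law B" and B_0: "cdf B 0 = 0" and F: "real_distribution F"
    and mix: "\<And>x. x \<ge> 0 \<Longrightarrow> cdf B x = p * cdf F x + (1 - p) * (1 - exp (- mu * x))"
    and res: "\<And>y. y \<ge> 0 \<Longrightarrow> cdf F y < 1 \<Longrightarrow> erlang_mean lam i (residual_cdf F y) \<le> C"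
    and ex: "erlang_mean lam i (\<lambda>x. 1 - exp (- mu * x)) \<le> C"
  shows "emeasure (poisson_mixture lam B) {j..j + i} \<le> C * emeasure (poisson_mixture lam B) {j..}"
proof (rule poisson_mixture_window_le[OF lam B_law B_0])
  interpret F: real_distribution F by fact
  have [measurable]: "residual_cdf F y \<in> borel_measurable borel" for y
    by (rule borel_measurable_residual_cdf) (auto intro: F.prob_space_axioms)
  have r0: "0 \<le> residual_cdf F y x" for x y by (rule residual_cdf_bounds(1))
  fix y :: real assume y: "0 \<le> y"
  define a where "a = p * (1 - cdf F y)"
  define b where "b = (1 - p) * exp (- mu * y)"
  have a: "0 \<le> a" using p F.cdf_bounded_prob[of y] by (simp add: a_def)
  have b: "0 \<le> b" using p by (simp add: b_def)
  have "erlang_mean lam i (\<lambda>x. cdf B (x + y) - cdf B y)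
      = erlang_mean lam i (\<lambda>x. a * residual_cdf F y x + b * (1 - exp (- mu * x)))"
  proof (rule erlang_mean_cong)
    fix x :: real assume x: "0 \<le> x"
    have "cdf B (x + y) - cdf B y
        = p * (cdf F (x + y) - cdf F y) + (1 - p) * (exp (- mu * y) - exp (- mu * (x + y)))"
      using x y by (simp add: mix algebra_simps)
    also have "cdf F (x + y) - cdf F y = (1 - cdf F y) * residual_cdf F y x"
      by (rule F.cdf_increment_eq_residual[OF x])
    also have "exp (- mu * (x + y)) = exp (- mu * y) * exp (- mu * x)"
      by (simp add: mult_exp_exp algebra_simps)
    finally show "cdf B (x + y) - cdf B y = a * residual_cdf F y x + b * (1 - exp (- mu * x))"
      by (simp add: a_def b_def algebra_simps)
  qed
  also have "\<dots> = ennreal a * erlang_mean lam i (residual_cdf F y)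
      + ennreal b * erlang_mean lam i (\<lambda>x. 1 - exp (- mu * x))"
    using a b r0 mu by (intro erlang_mean_add) auto
  also have "\<dots> \<le> ennreal a * C + ennreal b * C"
  proof (rule add_mono)
    show "ennreal b * erlang_mean lam i (\<lambda>x. 1 - exp (- mu * x)) \<le> ennreal b * C"
      by (intro mult_left_mono ex) simp
    show "ennreal a * erlang_mean lam i (residual_cdf F y) \<le> ennreal a * C"
    proof (cases "cdf F y < 1")
      case True
      then show ?thesis using res[OF y] by (intro mult_left_mono) auto
    next
      case False
      then have "a = 0" using F.cdf_bounded_prob[of y] by (simp add: a_def)
      then show ?thesis by simp
    qed
  qed
  also have "\<dots> = C * ennreal (1 - cdf B y)"
  proof -
    have "a + b = 1 - cdf B y" using y by (simp add: mix a_def b_def algebra_simps)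
    then have "ennreal a + ennreal b = ennreal (1 - cdf B y)"
      using a b by (simp add: ennreal_plus[symmetric] del: ennreal_plus)
    then show ?thesis by (metis distrib_right mult.commute)
  qed
  finally show "erlang_mean lam i (\<lambda>x. cdf B (x + y) - cdf B y) \<le> C * ennreal (1 - cdf B y)" .
qed

lemma st_le_remaining_arrivals:
  assumes full: "set_pmf \<pi> = UNIV"
    and window: "\<And>i. emeasure (measure_pmf \<pi>) {j..j + i}
      \<le> emeasure (measure_pmf s) {..i} * emeasure (measure_pmf \<pi>) {j..}"
  shows "st_le s (remaining_arrivals \<pi> j)"
  unfolding st_le_def
proof
  fix k
  show "emeasure (measure_pmf s) {k..} \<le> emeasure (measure_pmf (remaining_arrivals \<pi> j)) {k..}"
  proof (cases k)
    case 0
    then show ?thesis by (simp add: atLeast_0 measure_pmf.emeasure_space_1[simplified])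
  next
    case (Suc i)
    let ?t = "measure (measure_pmf \<pi>) {j..}"
    have t: "0 < ?t" by (rule tail_pos[OF full])
    have "measure (measure_pmf (remaining_arrivals \<pi> j)) {..i} = (\<Sum>l\<le>i. pmf \<pi> (j + l) / ?t)"
      by (simp add: measure_measure_pmf_finite pmf_remaining_arrivals[OF full])
    also have "\<dots> = (\<Sum>m\<in>{j..j + i}. pmf \<pi> m) / ?t"
      unfolding sum_divide_distrib[symmetric]
      by (rule arg_cong2[where f="(/)"], rule sum.reindex_bij_witness[of _ "\<lambda>m. m - j" "\<lambda>l. j + l"]) auto
    also have "\<dots> = measure (measure_pmf \<pi>) {j..j + i} / ?t"
      by (simp add: measure_measure_pmf_finite)
    also have "\<dots> \<le> measure (measure_pmf s) {..i}"
      using window[of i] t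
      by (simp add: measure_pmf.emeasure_eq_measure ennreal_mult[symmetric] pos_divide_le_eq)
    finally have le: "measure (measure_pmf (remaining_arrivals \<pi> j)) {..i} \<le> measure (measure_pmf s) {..i}" .
    have compl: "measure (measure_pmf q) {Suc i..} = 1 - measure (measure_pmf q) {..i}" for q :: "nat pmf"
    proof -
      have "{Suc i..} = space (measure_pmf q) - {..i}" by auto
      then show ?thesis by (simp only:) (subst measure_pmf.prob_compl, auto)
    qed
    show ?thesis
      unfolding Suc measure_pmf.emeasure_eq_measure compl using le by (intro ennreal_leI) simp
  qed
qed

theorem theorem2p4:
  fixes lam mu eps p y0 :: real and n :: nat
    and B F :: "real measure"
    and M :: "'a measure" and T S :: "nat \<Rightarrow> 'a \<Rightarrow> real"
  assumes "lam > 0" and "mu > 0" and "eps > 0" and "0 < p" and "p \<le> 1"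
    and queue: "MGI1_input lam B M T S"
    and B_law: "nonneg_law B" and B_0: "cdf B 0 = 0"
    and F_law: "nonneg_law F" and F_mean: "has_bochner_integral F (\<lambda>x. x) (1 / mu)"
    and B_mixture: "\<And>x. x \<ge> 0 \<Longrightarrow> cdf B x = p * cdf F x + (1 - p) * (1 - exp (- mu * x))"
    and F_close: "(SUP (x, y) \<in> {(x, y). x \<ge> 0 \<and> y \<ge> 0 \<and> \<P>(z in F. z > y) > 0}.
                     \<bar>residual_cdf F y x - cdf F x\<bar>) < eps"
    and y0: "y0 \<ge> 0" "\<P>(z in F. z > y0) > 0"
    and y0_least: "\<And>y. y \<ge> 0 \<Longrightarrow> \<P>(z in F. z > y) > 0 \<Longrightarrow>
                     C_le lam (residual_cdf F y0) (residual_cdf F y)"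
  shows "let Bhat = p * LST F lam + (1 - p) * (mu / (mu + lam)) in
    \<exists>q :: nat pmf.
      (\<forall>z. \<bar>z\<bar> \<le> 1 \<longrightarrow>
         pgf q z < Bhat / (1 - z + z * Bhat)
                   + 5 * eps * ((1 - z + 2 * z * Bhat) / (1 - z + z * Bhat))) \<and>
      (\<forall>(N :: 'b measure) Z G \<sigma>.
         galton_watson q N Z \<longrightarrow>
         nonneg_law G \<longrightarrow>
         C_le lam (cdf G) (residual_cdf F y0) \<longrightarrow>
         C_le lam (cdf G) (\<lambda>x. 1 - exp (- mu * x)) \<longrightarrow>
         prob_space.indep_vars N (\<lambda>_. count_space UNIV) \<sigma> UNIV \<longrightarrow>
         (\<forall>i m. \<P>(\<omega> in N. \<sigma> i \<omega> = m) = (\<integral>x. exp (- lam * x) * (lam * x) ^ m / fact m \<partial>G)) \<longrightarrow>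
         indep_sequences N Z \<sigma> \<longrightarrow>
         st_ge M (\<lambda>\<omega>. real (busy_period_losses n T S \<omega>))
               N (\<lambda>\<omega>. real (\<Sum>i<Z n \<omega>. \<sigma> i \<omega>)))"
proof -
  interpret B: real_distribution B using B_law by (simp add: nonneg_law_def)
  interpret F: real_distribution F using F_law by (simp add: nonneg_law_def)
  interpret M: prob_space M using queue by (simp add: MGI1_input_def)
  note lam = \<open>lam > 0\<close> and mu = \<open>mu > 0\<close> and p = \<open>0 < p\<close> \<open>p \<le> 1\<close>
  define \<beta> where "\<beta> = enn2real (erlang_mean lam 0 (residual_cdf F y0))"
  define b where "b = p * LST F lam + (1 - p) * (mu / (mu + lam))"
  define \<pi> where "\<pi> = poisson_mixture lam B"
  let ?E = "\<lambda>x. 1 - exp (- mu * x)"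
  have F0: "cdf F 0 = 0" using B_mixture[of 0] B_0 p by simp
  have valid: "\<P>(z in F. z > y) > 0 \<longleftrightarrow> cdf F y < 1" for y
    using F.prob_greater[of y] by simp
  have res_borel: "residual_cdf F y \<in> borel_measurable borel" for y
    by (rule borel_measurable_residual_cdf) (auto intro: F.prob_space_axioms)
  have res01: "0 \<le> residual_cdf F y x \<and> residual_cdf F y x \<le> 1" for x y
    using residual_cdf_bounds(1) residual_cdf_bounds(2)[of F] F.prob_space_axioms by auto
  have least: "erlang_mean lam i (residual_cdf F y) \<le> erlang_mean lam i (residual_cdf F y0)"
    if "0 \<le> y" "cdf F y < 1" for i y
    using y0_least[of y] that valid lam res_borel res01
    by (intro C_le_imp_erlang_mean_le) auto
  note gap = void_probability_gap[OF lam mu \<open>eps > 0\<close> p F_law F_mean F0 F_close y0(1)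
      y0(2)[unfolded valid] least, folded \<beta>_def b_def]
  have window: "emeasure \<pi> {j..j + i} \<le> C * emeasure \<pi> {j..}"
    if "erlang_mean lam i (residual_cdf F y0) \<le> C" "erlang_mean lam i ?E \<le> C" for C i j
    unfolding \<pi>_def using that least B_mixture
    by (intro mixture_window_le[OF lam mu p B_law B_0 F.real_distribution_axioms])
       (auto intro: order_trans)
  have full: "set_pmf \<pi> = UNIV"
    unfolding \<pi>_def by (rule poisson_mixture_full_support[OF lam B_law B_0])
  have \<pi>_0: "pmf \<pi> 0 = b"
  proof -
    have cdfF: "cdf F \<in> borel_measurable borel"
      by (rule borel_measurable_mono) (auto intro!: monoI F.cdf_nondecreasing)
    have "ennreal (pmf \<pi> 0) = erlang_mean lam 0 (cdf B)"
      using LST_eq_erlang_mean[OF lam B_law] by (simp add: \<pi>_def)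
    also have "\<dots> = erlang_mean lam 0 (\<lambda>x. p * cdf F x + (1 - p) * ?E x)"
      using B_mixture by (intro erlang_mean_cong) auto
    also have "\<dots> = ennreal p * erlang_mean lam 0 (cdf F) + ennreal (1 - p) * erlang_mean lam 0 ?E"
      using p mu cdfF F.cdf_nonneg by (intro erlang_mean_add) auto
    also have "\<dots> = ennreal p * ennreal (LST F lam) + ennreal (1 - p) * ennreal (mu / (mu + lam))"
    proof -
      have "1 - lam / (lam + mu) = mu / (mu + lam)" using lam mu by (simp add: field_simps)
      then show ?thesis
        unfolding erlang_mean_exponential[OF lam mu] LST_eq_erlang_mean(1)[OF lam F_law, symmetric] by simp
    qed
    also have "\<dots> = ennreal b"
      using p lam mu LST_eq_erlang_mean(2)[OF lam F_law]
      by (simp add: b_def ennreal_mult[symmetric] ennreal_plus[symmetric] del: ennreal_plus)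
    finally show ?thesis using gap(3) by simp
  qed
  have hazard: "hazard \<pi> j \<le> \<beta>" for j
  proof -
    have "emeasure \<pi> {j..j + 0} \<le> ennreal \<beta> * emeasure \<pi> {j..}"
      using gap(5,6) by (intro window) auto
    then have "pmf \<pi> j \<le> \<beta> * measure \<pi> {j..}"
      using gap(1) by (simp add: measure_pmf.emeasure_eq_measure measure_pmf_single ennreal_mult[symmetric])
    then show ?thesis using tail_pos[OF full, of j] by (simp add: hazard_def pos_divide_le_eq)
  qed
  have "st_ge M (\<lambda>\<omega>. real (busy_period_losses n T S \<omega>)) N (\<lambda>\<omega>. real (\<Sum>i<Z n \<omega>. \<sigma> i \<omega>))"
    if gw: "galton_watson (delayed_geometric \<beta> b) N Z"
      and G_law: "nonneg_law G"
      and G_res: "C_le lam (cdf G) (residual_cdf F y0)"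
      and G_exp: "C_le lam (cdf G) ?E"
      and ind: "prob_space.indep_vars N (\<lambda>_. count_space UNIV) \<sigma> UNIV"
      and \<sigma>: "\<forall>i m. \<P>(\<omega> in N. \<sigma> i \<omega> = m) = (\<integral>x. exp (- lam * x) * (lam * x) ^ m / fact m \<partial>G)"
      and indZ: "indep_sequences N Z \<sigma>"
    for N :: "'b measure" and Z G \<sigma>
  proof -
    interpret G: real_distribution G using G_law by (simp add: nonneg_law_def)
    define s where "s = poisson_mixture lam G"
    have G_borel: "cdf G \<in> borel_measurable borel"
      by (rule borel_measurable_mono) (auto intro!: monoI G.cdf_nondecreasing)
    have G01: "0 \<le> cdf G x \<and> cdf G x \<le> 1" for x
      using G.cdf_nonneg G.cdf_bounded_prob by auto
    have E01: "0 \<le> ?E x \<and> ?E x \<le> 1" if "0 \<le> x" for x using mu that by auto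
    have s_tail: "st_le s (remaining_arrivals \<pi> j)" for j
    proof (rule st_le_remaining_arrivals[OF full])
      fix i
      show "emeasure \<pi> {j..j + i} \<le> emeasure s {..i} * emeasure \<pi> {j..}"
        unfolding s_def emeasure_poisson_mixture_atMost[OF lam G_law]
        using G_borel G01 res_borel res01 E01
        by (intro window C_le_imp_erlang_mean_le[OF lam G_res] C_le_imp_erlang_mean_le[OF lam G_exp]) auto
    qed
    have le: "\<P>(\<omega> in N. k \<le> (\<Sum>i<Z n \<omega>. \<sigma> i \<omega>)) \<le> \<P>(\<omega> in M. k \<le> busy_period_losses n T S \<omega>)" for k
    proof -
      have "st_le ((compound_pmf (delayed_geometric \<beta> b) ^^ n) s) (total_losses \<pi> n 1)"
        using branching_st_le_overflow[OF full hazard less_imp_le[OF gap(2)] s_tail, of n 0]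
        by (simp add: \<pi>_0 total_losses.simps[OF full])
      then have "emeasure ((compound_pmf (delayed_geometric \<beta> b) ^^ n) s) {k..} \<le> emeasure (total_losses \<pi> n 1) {k..}"
        by (simp add: st_le_def)
      also have "\<dots> \<le> emeasure M {\<omega>\<in>space M. k \<le> busy_period_losses n T S \<omega>}"
        unfolding \<pi>_def by (rule total_losses_tail_le_busy_period_losses[OF lam B_law B_0 queue])
      finally show ?thesis
        using prob_galton_watson_random_sum[OF gw ind _ indZ, of s k n] \<sigma>
        by (simp add: s_def pmf_poisson_mixture[OF lam G_law] M.emeasure_eq_measure measure_pmf.emeasure_eq_measure)
    qed
    show ?thesis
      unfolding st_ge_def less_of_nat_iff_nat_floor using le by simp
  qed
  moreover have "pgf (delayed_geometric \<beta> b) z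
      < b / (1 - z + z * b) + 5 * eps * ((1 - z + 2 * z * b) / (1 - z + z * b))" if "\<bar>z\<bar> \<le> 1" for z
    using gap \<open>eps > 0\<close> that by (intro pgf_delayed_geometric_less) auto
  ultimately show ?thesis
    unfolding b_def[symmetric] Let_def by (intro exI[of _ "delayed_geometric \<beta> b"]) auto
qed

end
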